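(* Let $\lambda$ be a dominant integral weight, let $\{\beta_i\}_{i\in I}$ be the special (lexicographic) $\lambda$-chain described in the context, and let $p\in\{1,\ldots,r\}$. Then $$E_p(\pi(J))=\pi(F_p(J))$$ for all admissible subsets $J\subseteq I$, as an identity of partially defined operators, where $E_p$ is the root operator on paths and $F_p$ is the root operator on admissible subsets.
   Context: Root system. Let $V$ be a finite-dimensional real vector space with a nondegenerate symmetric bilinear form $\langle\cdot,\cdot\rangle$, and let $\Phi\subset V$ be the set of real roots of a complex symmetrizable Kac-Moody algebra, with simple roots $\alpha_1,\ldots,\alpha_r$. Put $\alpha^\vee=2\alpha/\langle\alpha,\alpha\rangle$ for $\alpha\in\Phi$, $s_\alpha(v)=v-\langle v,\alpha^\vee\rangle\alpha$ and $s_{\alpha,k}(v)=s_\alpha(v)+k\alpha$ ($k\in\mathbb{Z}$). Let $W\subset GL(V)$ be the Weyl group generated by the $s_\alpha$, $\alpha\in\Phi$, with length function $\ell$ with respect to the simple reflections $s_p=s_{\alpha_p}$. Thus: $\alpha_1,\dots,\alpha_r$ are linearly independent; $\langle\alpha_p,\alpha_p\rangle>0$; $\langle\alpha_p,\alpha_q^\vee\rangle\in\mathbb{Z}_{\le0}$ for $p\ne q$; and $\Phi=\bigcup_p W\alpha_p$. $\Phi^+$ is the set of roots in the nonnegative span of the simple roots, $\Phi=\Phi^+\sqcup(-\Phi^+)$; $\mathrm{sgn}(\alpha)=1$ (we write $\alpha>0$) for $\alpha\in\Phi^+$ and $\mathrm{sgn}(\alpha)=-1$ ($\alpha<0$) for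 $\alpha\in-\Phi^+$. In Bruhat order on $W$, $w\lessdot ws_\alpha$ ($\alpha\in\Phi^+$) means $\ell(ws_\alpha)=\ell(w)+1$. Let $\Lambda=\{v\in V\mid\langle v,\alpha_p^\vee\rangle\in\mathbb{Z}\ \forall p\}$; $v\in\Lambda$ is dominant if $\langle v,\alpha^\vee\rangle\ge0$ for all $\alpha\in\Phi^+$. Fix $\rho\in\Lambda$ with $\langle\rho,\alpha_p^\vee\rangle=1$ for all $p$. Special $\lambda$-chain. $I=\{(\alpha,k)\mid\alpha\in\Phi^+,\ k\in\mathbb{Z},\ 0\le k<\langle\lambda,\alpha^\vee\rangle\}$. Fix a total order $\alpha_1<\dots<\alpha_r$ on the simple roots. For $i=(\alpha,k)\in I$ with $\alpha^\vee=c_1\alpha_1^\vee+\dots+c_r\alpha_r^\vee$ put $v_i=\frac{1}{\langle\lambda,\alpha^\vee\rangle}(k,c_1,\dots,c_r)\in\mathbb{Q}^{r+1}$; the map $i\mapsto v_i$ is injective and $I$ is totally ordered by the lexicographic order of the $v_i$. Put $\beta_i=\alpha$ and $t_i=k/\langle\lambda,\alpha^\vee\rangle\in[0,1)$ for $i=(\alpha,k)$. Admissible subsets. Put $r_i=s_{\beta_i}$, $l_i^\emptyset=\#\{j<i\mid\beta_j=\beta_i\}$, $\widehat r_i=s_{\beta_i,l_i^\emptyset}$. A finite (possibly empty) subset $J=\{j_1<\dots<j_s\}\subseteq I$ is admissible if $1\lessdot r_{j_1}\lessdot r_{j_1}r_{j_2}\lessdot\cdots\lessdot r_{j_1}\cdots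 r_{j_s}$. Its weight is $\mu(J)=\widehat r_{j_1}\cdots\widehat r_{j_s}(\lambda)$. Foldings. $\Gamma(\emptyset)=(\{(\beta_i,1)\}_{i\in I},\rho)$. For $\Gamma=(\{(\gamma_i,\varepsilon_i)\}_{i\in I},\gamma_\infty)$ with $\gamma_i\in\Phi$, $\varepsilon_i=\pm1$, $\gamma_\infty\in W\rho$, let $\phi_i(\Gamma)=(\{(\delta_j,\zeta_j)\}_{j\in I},s_{\gamma_i}(\gamma_\infty))$, where $(\delta_j,\zeta_j)$ is $(\gamma_j,\varepsilon_j)$ if $j<i$, $(\gamma_i,-\varepsilon_i)$ if $j=i$, and $(s_{\gamma_i}(\gamma_j),\varepsilon_j)$ if $j>i$. For finite $J=\{j_1<\dots<j_s\}$, $\Gamma(J)=\phi_{j_1}\cdots\phi_{j_s}(\Gamma(\emptyset))$. For $\Gamma=\Gamma(J)=(\{(\gamma_i,\varepsilon_i)\},\gamma_\infty)$, the levels are $$l_i=\delta_i'+\sum_{j<i,\ \varepsilon_j=1,\ \gamma_j=\pm\gamma_i}\mathrm{sgn}(\gamma_j),\qquad\delta_i'=0\text{ if }\gamma_i>0,\quad\delta_i'=-1\text{ if }\gamma_i<0.$$ Root operator $F_p$ on admissible subsets. Let $\infty$ be greater than all elements of $I$. For admissible $J$ and $\Gamma=\Gamma(J)$, let $I_{\alpha_p}=\{i\in I\mid\gamma_i=\pm\alpha_p\}$ (a finite set), $\widehat I_{\alpha_p}=I_{\alpha_p}\cup\{\infty\}$, and $M(J,p)=\max(\{l_i\mid i\in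 I_{\alpha_p}\}\cup\{\langle\mu(J),\alpha_p^\vee\rangle\})$ (one has $M(J,p)\ge0$). $F_p(J)$ is defined if and only if $M(J,p)>0$. In this case let $m$ be the minimum $i\in I_{\alpha_p}$ with $l_i=M(J,p)$, or $m=\infty$ if there is none; let $k$ be the predecessor of $m$ in $\widehat I_{\alpha_p}$ (it exists). Then $F_p(J)=J\triangle\{k,m\}$ if $m\ne\infty$ and $F_p(J)=J\triangle\{k\}$ if $m=\infty$ ($\triangle$ is symmetric difference); this is again admissible. The path $\pi(J)$. For admissible $J=\{j_1<\dots<j_s\}$, let $\{0=a_0<a_1<\dots<a_l\}=\{t_{j_1}\le\dots\le t_{j_s}\}\cup\{0\}$ and $a_{l+1}=1$. Let $0=n_0\le n_1<\dots<n_{l+1}=s$ be such that $t_{j_h}=a_k$ if and only if $n_k<h\le n_{k+1}$. Put $w_k=r_{j_1}\cdots r_{j_{n_{k+1}}}$ and $\mu_k=w_k(\lambda)$, $k=0,\dots,l$. Let $\gamma(J):(0,1]\to V$ be the step function with $\gamma(J)(t)=-\mu_k$ for $a_k<t\le a_{k+1}$, and $\pi(J):[0,1]\to V$, $\pi(J)(t)=\int_0^t\gamma(J)(s)\,ds$. Root operator $E_p$ on paths. For a continuous piecewise-linear path $\pi:[0,1]\to V$ with $\pi(0)=0$ and left-hand derivative $\gamma:(0,1]\to V$, let $h_p(t)=\langle\pi(t),\alpha_p^\vee\rangle$ and $m_p=\min h_p$. If $m_p>-1$, $E_p$ is undefined on $\pi$. Otherwise let $t_1\in[0,1]$ be minimal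 with $h_p(t_1)=m_p$ and $t_0\in[0,t_1]$ be maximal with $h_p(t)\ge m_p+1$ for $t\in[0,t_0]$; $E_p(\pi)$ is the path starting at $0$ whose left-hand derivative is $s_p(\gamma(t))$ for $t_0<t\le t_1$ and $\gamma(t)$ otherwise. *)

theory Defs
  imports "HOL-Analysis.Analysis"
begin

section \<open>Root data of a symmetrizable Kac-Moody algebra\<close>

text \<open>
  The ambient space is a type of class \<^class>\<open>euclidean_space\<close>, i.e. an arbitrary nonzero
  finite-dimensional real vector space.  Its built-in inner product only supplies the topology
  needed for integrals and derivatives; the invariant form is the field \<open>form\<close>, which
  need not be definite.  Simple roots are \<open>sroot 1, \<dots>, sroot n\<close> with \<open>n = nsimple\<close>, and the
  total order on them is the order of the indices.
\<close>

record 'v root_data =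
  form :: "'v \<Rightarrow> 'v \<Rightarrow> real"
  nsimple :: nat
  sroot :: "nat \<Rightarrow> 'v"

definition coroot :: "('v::euclidean_space) root_data \<Rightarrow> 'v \<Rightarrow> 'v" where
  "coroot R a = (2 / form R a a) *\<^sub>R a"

definition pairing :: "('v::euclidean_space) root_data \<Rightarrow> 'v \<Rightarrow> 'v \<Rightarrow> real" where
  "pairing R v a = form R v (coroot R a)"

definition kac_moody_root_data :: "('v::euclidean_space) root_data \<Rightarrow> bool" where
  "kac_moody_root_data R \<longleftrightarrow>
     bilinear (form R) \<and>
     (\<forall>v w. form R v w = form R w v) \<and>
     (\<forall>v. (\<forall>w. form R v w = 0) \<longrightarrow> v = 0) \<and>
     inj_on (sroot R) {1..nsimple R} \<and>
     independent (sroot R ` {1..nsimple R}) \<and>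
     (\<forall>p\<in>{1..nsimple R}. form R (sroot R p) (sroot R p) > 0) \<and>
     (\<forall>p\<in>{1..nsimple R}. \<forall>q\<in>{1..nsimple R}. p \<noteq> q \<longrightarrow>
        pairing R (sroot R p) (sroot R q) \<in> \<int> \<and> pairing R (sroot R p) (sroot R q) \<le> 0)"

definition reflection :: "('v::euclidean_space) root_data \<Rightarrow> 'v \<Rightarrow> 'v \<Rightarrow> 'v" where
  "reflection R a v = v - pairing R v a *\<^sub>R a"

definition affine_reflection :: "('v::euclidean_space) root_data \<Rightarrow> 'v \<Rightarrow> int \<Rightarrow> 'v \<Rightarrow> 'v" where
  "affine_reflection R a k v = reflection R a v + of_int k *\<^sub>R a"

text \<open>
  The Weyl group is generated here by the simple reflections, since the real roots are in turn
  defined as the orbits of the simple roots.  By \<open>reflection_in_weyl\<close> below it contains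
  the reflections in all roots, so it is also the group generated by those.  Closing under
  composition with the generators suffices because they are involutions.
\<close>

inductive_set weyl :: "('v::euclidean_space) root_data \<Rightarrow> ('v \<Rightarrow> 'v) set"
  for R where
  weyl_id: "id \<in> weyl R"
| weyl_step: "w \<in> weyl R \<Longrightarrow> p \<in> {1..nsimple R} \<Longrightarrow> w \<circ> reflection R (sroot R p) \<in> weyl R"

definition roots :: "('v::euclidean_space) root_data \<Rightarrow> 'v set" where
  "roots R = (\<Union>p\<in>{1..nsimple R}. (\<lambda>w. w (sroot R p)) ` weyl R)"

lemma weyl_comp: "w \<in> weyl R \<Longrightarrow> u \<in> weyl R \<Longrightarrow> u \<circ> w \<in> weyl R"
  by (induction rule: weyl.induct) (auto simp flip: comp_assoc intro: weyl.intros)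

lemma reflection_in_weyl:
  assumes R: "kac_moody_root_data R" and a: "a \<in> roots R"
  shows "reflection R a \<in> weyl R"
proof -
  note bil = R[unfolded kac_moody_root_data_def, THEN conjunct1]
  note sym = R[unfolded kac_moody_root_data_def, THEN conjunct2, THEN conjunct1, rule_format]
  have pos: "form R (sroot R p) (sroot R p) > 0" if "p \<in> {1..nsimple R}" for p
    using R that unfolding kac_moody_root_data_def by blast
  note lin = bilinear_ladd[OF bil] bilinear_radd[OF bil] bilinear_lmul[OF bil] bilinear_rmul[OF bil]
    bilinear_lsub[OF bil] bilinear_rsub[OF bil]
  define s where "s p = reflection R (sroot R p)" for p
  define k where "k p v = pairing R v (sroot R p)" for p v
  have s_eq: "s p v = v - k p v *\<^sub>R sroot R p" for p v
    by (simp add: s_def k_def reflection_def)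
  have k_lin: "k p (v - c *\<^sub>R b) = k p v - c * k p b" for p v b c
    by (simp add: k_def pairing_def lin)
  have k_form: "2 * form R v (sroot R p) = k p v * form R (sroot R p) (sroot R p)"
    and k_self: "k p (sroot R p) = 2" if "p \<in> {1..nsimple R}" for p v
    using pos[OF that] by (simp_all add: k_def pairing_def coroot_def lin)
  have s_lin: "s p (v - c *\<^sub>R b) = s p v - c *\<^sub>R s p b" for p v b c
    by (simp add: s_eq k_lin scaleR_left_diff_distrib scaleR_right_diff_distrib)
  have s_form: "form R (s p v) (s p b) = form R v b" if "p \<in> {1..nsimple R}" for p v b
  proof -
    have "form R (s p v) (s p b) = form R v b - k p b * form R v (sroot R p)
        - k p v * form R b (sroot R p) + k p v * k p b * form R (sroot R p) (sroot R p)"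
      unfolding s_eq by (simp add: lin sym[of "sroot R p" b] right_diff_distrib)
    moreover have "2 * (k p b * form R v (sroot R p)) = k p v * k p b * form R (sroot R p) (sroot R p)"
      "2 * (k p v * form R b (sroot R p)) = k p v * k p b * form R (sroot R p) (sroot R p)"
      using k_form[OF that, of v] k_form[OF that, of b] by algebra+
    ultimately show ?thesis
      by linarith
  qed
  have s_invol: "s p (s p v) = v" if "p \<in> {1..nsimple R}" for p v
    by (simp add: s_eq k_lin k_self[OF that])
  have s_weyl: "s p \<in> weyl R" if "p \<in> {1..nsimple R}" for p
    using weyl_step[OF weyl_id that] by (simp add: s_def)
  have conj: "s p \<circ> reflection R b \<circ> s p = reflection R (s p b)" if p: "p \<in> {1..nsimple R}" for p b
  proof
    fix v
    have "form R (s p v) b = form R v (s p b)"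
      using s_form[OF p, of "s p v" b] s_invol[OF p] by simp
    then have "pairing R (s p v) b = pairing R v (s p b)"
      by (simp add: pairing_def coroot_def lin s_form[OF p])
    then show "(s p \<circ> reflection R b \<circ> s p) v = reflection R (s p b) v"
      by (simp add: reflection_def[of R b] reflection_def[of R "s p b"] s_lin s_invol[OF p])
  qed
  have step: "reflection R (w b) \<in> weyl R" if "w \<in> weyl R" "reflection R b \<in> weyl R" for w b
    using that
  proof (induction arbitrary: b)
    case (weyl_step w p)
    have "s p \<circ> reflection R b \<circ> s p \<in> weyl R"
      by (intro weyl_comp s_weyl weyl_step)
    with weyl_step show ?case
      by (simp add: conj flip: s_def)
  qed simp
  from a obtain w p where "w \<in> weyl R" "p \<in> {1..nsimple R}" "a = w (sroot R p)"
    unfolding roots_def by blast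
  with step s_weyl show ?thesis by (simp add: s_def)
qed

definition pos_roots :: "('v::euclidean_space) root_data \<Rightarrow> 'v set" where
  "pos_roots R = {a \<in> roots R. \<exists>c :: nat \<Rightarrow> real.
     (\<forall>q\<in>{1..nsimple R}. 0 \<le> c q) \<and> a = (\<Sum>q=1..nsimple R. c q *\<^sub>R sroot R q)}"

text \<open>Only used on roots, each of which is positive or the negative of a positive root.\<close>

definition root_sgn :: "('v::euclidean_space) root_data \<Rightarrow> 'v \<Rightarrow> int" where
  "root_sgn R a = (if a \<in> pos_roots R then 1 else - 1)"

definition weyl_length :: "('v::euclidean_space) root_data \<Rightarrow> ('v \<Rightarrow> 'v) \<Rightarrow> nat" where
  "weyl_length R w = (LEAST n. \<exists>ps. length ps = n \<and> set ps \<subseteq> {1..nsimple R} \<and>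
     w = foldr (\<lambda>p u. reflection R (sroot R p) \<circ> u) ps id)"

definition bruhat_cover :: "('v::euclidean_space) root_data \<Rightarrow> ('v \<Rightarrow> 'v) \<Rightarrow> ('v \<Rightarrow> 'v) \<Rightarrow> bool" where
  "bruhat_cover R w w' \<longleftrightarrow> w \<in> weyl R \<and>
     (\<exists>a\<in>pos_roots R. w' = w \<circ> reflection R a \<and> weyl_length R w' = weyl_length R w + 1)"

definition weight_lattice :: "('v::euclidean_space) root_data \<Rightarrow> 'v set" where
  "weight_lattice R = {v. \<forall>p\<in>{1..nsimple R}. pairing R v (sroot R p) \<in> \<int>}"

definition dominant :: "('v::euclidean_space) root_data \<Rightarrow> 'v \<Rightarrow> bool" where
  "dominant R v \<longleftrightarrow> (\<forall>a\<in>pos_roots R. 0 \<le> pairing R v a)"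

definition is_rho :: "('v::euclidean_space) root_data \<Rightarrow> 'v \<Rightarrow> bool" where
  "is_rho R v \<longleftrightarrow> v \<in> weight_lattice R \<and> (\<forall>p\<in>{1..nsimple R}. pairing R v (sroot R p) = 1)"

section \<open>The special chain\<close>

definition lam_chain :: "('v::euclidean_space) root_data \<Rightarrow> 'v \<Rightarrow> ('v \<times> int) set" where
  "lam_chain R lam = {(a, k). a \<in> pos_roots R \<and> 0 \<le> k \<and> of_int k < pairing R lam a}"

definition coroot_coeff :: "('v::euclidean_space) root_data \<Rightarrow> 'v \<Rightarrow> nat \<Rightarrow> real" where
  "coroot_coeff R a q =
     representation ((\<lambda>p. coroot R (sroot R p)) ` {1..nsimple R}) (coroot R a) (coroot R (sroot R q))"

definition chain_vec :: "('v::euclidean_space) root_data \<Rightarrow> 'v \<Rightarrow> 'v \<times> int \<Rightarrow> real list" where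
  "chain_vec R lam = (\<lambda>(a, k).
     map (\<lambda>x. x / pairing R lam a) (of_int k # map (coroot_coeff R a) [1..<nsimple R + 1]))"

definition chain_less :: "('v::euclidean_space) root_data \<Rightarrow> 'v \<Rightarrow> 'v \<times> int \<Rightarrow> 'v \<times> int \<Rightarrow> bool" where
  "chain_less R lam i j \<longleftrightarrow> ord_class.lexordp (chain_vec R lam i) (chain_vec R lam j)"

definition chain_time :: "('v::euclidean_space) root_data \<Rightarrow> 'v \<Rightarrow> 'v \<times> int \<Rightarrow> real" where
  "chain_time R lam = (\<lambda>(a, k). of_int k / pairing R lam a)"

definition chain_enum :: "('v::euclidean_space) root_data \<Rightarrow> 'v \<Rightarrow> ('v \<times> int) set \<Rightarrow> ('v \<times> int) list" where
  "chain_enum R lam J = (THE js. sorted_wrt (chain_less R lam) js \<and> set js = J)"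

section \<open>Admissible subsets and foldings\<close>

definition refl_prod :: "('v::euclidean_space) root_data \<Rightarrow> ('v \<times> int) list \<Rightarrow> 'v \<Rightarrow> 'v" where
  "refl_prod R js = foldr (\<lambda>j u. reflection R (fst j) \<circ> u) js id"

definition admissible :: "('v::euclidean_space) root_data \<Rightarrow> 'v \<Rightarrow> ('v \<times> int) set \<Rightarrow> bool" where
  "admissible R lam J \<longleftrightarrow> finite J \<and> J \<subseteq> lam_chain R lam \<and>
     (let js = chain_enum R lam J in
        \<forall>h<length js. bruhat_cover R (refl_prod R (take h js)) (refl_prod R (take (h + 1) js)))"

definition init_level :: "('v::euclidean_space) root_data \<Rightarrow> 'v \<Rightarrow> 'v \<times> int \<Rightarrow> nat" where
  "init_level R lam i = card {j \<in> lam_chain R lam. chain_less R lam j i \<and> fst j = fst i}"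

definition weight :: "('v::euclidean_space) root_data \<Rightarrow> 'v \<Rightarrow> ('v \<times> int) set \<Rightarrow> 'v" where
  "weight R lam J =
     foldr (\<lambda>j. affine_reflection R (fst j) (int (init_level R lam j))) (chain_enum R lam J) lam"

text \<open>
  A folding is a pair of the family \<open>i \<mapsto> (\<gamma>\<^sub>i, \<epsilon>\<^sub>i)\<close> and \<open>\<gamma>\<^sub>\<infinity>\<close>.  The family is a
  total function, of which only the values on the chain are meaningful and ever used.
\<close>

type_synonym 'v folding = "('v \<times> int \<Rightarrow> 'v \<times> int) \<times> 'v"

definition empty_folding :: "'v \<Rightarrow> 'v folding" where
  "empty_folding rho = ((\<lambda>i. (fst i, 1)), rho)"

definition fold_at ::
  "('v::euclidean_space) root_data \<Rightarrow> 'v \<Rightarrow> 'v \<times> int \<Rightarrow> 'v folding \<Rightarrow> 'v folding" where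
  "fold_at R lam i = (\<lambda>(G, g_inf).
     ((\<lambda>j. if j = i then (fst (G i), - snd (G i))
           else if chain_less R lam j i then G j
           else (reflection R (fst (G i)) (fst (G j)), snd (G j))),
      reflection R (fst (G i)) g_inf))"

definition folding ::
  "('v::euclidean_space) root_data \<Rightarrow> 'v \<Rightarrow> 'v \<Rightarrow> ('v \<times> int) set \<Rightarrow> 'v folding" where
  "folding R lam rho J = foldr (fold_at R lam) (chain_enum R lam J) (empty_folding rho)"

definition fold_root ::
  "('v::euclidean_space) root_data \<Rightarrow> 'v \<Rightarrow> 'v \<Rightarrow> ('v \<times> int) set \<Rightarrow> 'v \<times> int \<Rightarrow> 'v" where
  "fold_root R lam rho J i = fst (fst (folding R lam rho J) i)"

definition fold_sign ::
  "('v::euclidean_space) root_data \<Rightarrow> 'v \<Rightarrow> 'v \<Rightarrow> ('v \<times> int) set \<Rightarrow> 'v \<times> int \<Rightarrow> int" where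
  "fold_sign R lam rho J i = snd (fst (folding R lam rho J) i)"

definition level ::
  "('v::euclidean_space) root_data \<Rightarrow> 'v \<Rightarrow> 'v \<Rightarrow> ('v \<times> int) set \<Rightarrow> 'v \<times> int \<Rightarrow> int" where
  "level R lam rho J i =
     (let g = fold_root R lam rho J; e = fold_sign R lam rho J in
      (if g i \<in> pos_roots R then 0 else - 1) +
      (\<Sum>j | j \<in> lam_chain R lam \<and> chain_less R lam j i \<and> e j = 1 \<and> (g j = g i \<or> g j = - g i).
         root_sgn R (g j)))"

section \<open>The root operator on admissible subsets\<close>

definition root_indices ::
  "('v::euclidean_space) root_data \<Rightarrow> 'v \<Rightarrow> 'v \<Rightarrow> nat \<Rightarrow> ('v \<times> int) set \<Rightarrow> ('v \<times> int) set" where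
  "root_indices R lam rho p J =
     {i \<in> lam_chain R lam. fold_root R lam rho J i = sroot R p \<or> fold_root R lam rho J i = - sroot R p}"

definition max_level ::
  "('v::euclidean_space) root_data \<Rightarrow> 'v \<Rightarrow> 'v \<Rightarrow> nat \<Rightarrow> ('v \<times> int) set \<Rightarrow> real" where
  "max_level R lam rho p J =
     Max ((\<lambda>i. of_int (level R lam rho J i)) ` root_indices R lam rho p J
          \<union> {pairing R (weight R lam J) (sroot R p)})"

text \<open>The index \<open>m\<close>; the value \<^term>\<open>None\<close> stands for \<open>\<infinity>\<close>.\<close>

definition first_max ::
  "('v::euclidean_space) root_data \<Rightarrow> 'v \<Rightarrow> 'v \<Rightarrow> nat \<Rightarrow> ('v \<times> int) set \<Rightarrow> ('v \<times> int) option" where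
  "first_max R lam rho p J =
     (let S = {i \<in> root_indices R lam rho p J. of_int (level R lam rho J i) = max_level R lam rho p J}
      in if S = {} then None
         else Some (THE i. i \<in> S \<and> (\<forall>j\<in>S. j \<noteq> i \<longrightarrow> chain_less R lam i j)))"

definition below :: "('v::euclidean_space) root_data \<Rightarrow> 'v \<Rightarrow> 'v \<times> int \<Rightarrow> ('v \<times> int) option \<Rightarrow> bool" where
  "below R lam i m \<longleftrightarrow> (case m of None \<Rightarrow> True | Some j \<Rightarrow> chain_less R lam i j)"

definition predecessor ::
  "('v::euclidean_space) root_data \<Rightarrow> 'v \<Rightarrow> 'v \<Rightarrow> nat \<Rightarrow> ('v \<times> int) set \<Rightarrow> ('v \<times> int) option \<Rightarrow> 'v \<times> int" where
  "predecessor R lam rho p J m =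
     (THE k. k \<in> root_indices R lam rho p J \<and> below R lam k m \<and>
        (\<forall>i\<in>root_indices R lam rho p J. below R lam i m \<and> i \<noteq> k \<longrightarrow> chain_less R lam i k))"

definition F_op ::
  "('v::euclidean_space) root_data \<Rightarrow> 'v \<Rightarrow> 'v \<Rightarrow> nat \<Rightarrow> ('v \<times> int) set \<Rightarrow> ('v \<times> int) set option" where
  "F_op R lam rho p J =
     (if max_level R lam rho p J > 0 then
        (let m = first_max R lam rho p J; k = predecessor R lam rho p J m
         in Some (sym_diff J (case m of None \<Rightarrow> {k} | Some i \<Rightarrow> {k, i})))
      else None)"

section \<open>Paths\<close>

text \<open>
  Paths are functions on the unit interval, made extensional by \<^const>\<open>restrict\<close>, so that
  equality of paths is equality of functions.
\<close>

definition break_points :: "('v::euclidean_space) root_data \<Rightarrow> 'v \<Rightarrow> ('v \<times> int) set \<Rightarrow> real list" where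
  "break_points R lam J = sorted_list_of_set (chain_time R lam ` J \<union> {0}) @ [1]"

text \<open>
  The number \<open>n\<^sub>k\<close>: since the times \<open>t\<close> increase weakly along the enumeration of \<open>J\<close>, the
  \<open>h\<close>-th of them equals \<open>a\<^sub>k\<close> iff \<open>n\<^sub>k < h \<le> n\<^sub>k\<^sub>+\<^sub>1\<close>.
\<close>

definition break_count :: "('v::euclidean_space) root_data \<Rightarrow> 'v \<Rightarrow> ('v \<times> int) set \<Rightarrow> nat \<Rightarrow> nat" where
  "break_count R lam J k = card {j \<in> J. chain_time R lam j < break_points R lam J ! k}"

definition direction :: "('v::euclidean_space) root_data \<Rightarrow> 'v \<Rightarrow> ('v \<times> int) set \<Rightarrow> nat \<Rightarrow> 'v" where
  "direction R lam J k =
     refl_prod R (take (break_count R lam J (k + 1)) (chain_enum R lam J)) lam"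

definition step_fun :: "('v::euclidean_space) root_data \<Rightarrow> 'v \<Rightarrow> ('v \<times> int) set \<Rightarrow> real \<Rightarrow> 'v" where
  "step_fun R lam J t =
     (let a = break_points R lam J
      in - direction R lam J (THE k. k + 1 < length a \<and> a ! k < t \<and> t \<le> a ! (k + 1)))"

definition path_of :: "('v::euclidean_space) root_data \<Rightarrow> 'v \<Rightarrow> ('v \<times> int) set \<Rightarrow> real \<Rightarrow> 'v" where
  "path_of R lam J = (\<lambda>t\<in>{0..1}. integral {0..t} (step_fun R lam J))"

text \<open>
  Meaningful for continuous piecewise-linear paths starting at 0; for these the infimum is a
  minimum and the extremal times exist.
\<close>

definition E_op :: "('v::euclidean_space) root_data \<Rightarrow> nat \<Rightarrow> (real \<Rightarrow> 'v) \<Rightarrow> (real \<Rightarrow> 'v) option" where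
  "E_op R p x =
     (let g = (\<lambda>t. vector_derivative x (at_left t));
          h = (\<lambda>t. pairing R (x t) (sroot R p));
          m = (INF t\<in>{0..1}. h t);
          t1 = (LEAST t. t \<in> {0..1} \<and> h t = m);
          t0 = (GREATEST t. t \<in> {0..t1} \<and> (\<forall>s\<in>{0..t}. h s \<ge> m + 1))
      in if m > - 1 then None
         else Some (\<lambda>t\<in>{0..1}. integral {0..t}
                (\<lambda>s. if t0 < s \<and> s \<le> t1 then reflection R (sroot R p) (g s) else g s)))"

end

theory Submission
  imports Defs
begin

text \<open>
  Along the folded path the height \<open>t \<mapsto> - h\<^sub>p(t)\<close> is piecewise linear with slope \<open>\<langle>\<lambda>, \<eta>\<^sup>\<or>\<rangle>\<close>, where
  \<open>\<eta> = w\<^sup>-\<^sup>1 \<alpha>\<^sub>p\<close> and \<open>w\<close> is the product of the folds made so far.  Each index \<open>(\<alpha>, k)\<close> of the chain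
  is the moment at which the straight path to \<open>\<lambda>\<close> meets a hyperplane.  When the straight path is moved by
  a small generic vector, it meets these hyperplanes one at a time and in the lexicographic order; between two of
  them the perturbed height meets no integer.  Hence the levels of the folding are exactly the heights at the
  indices with \<open>\<gamma>\<^sub>i = \<plusminus>\<alpha>\<^sub>p\<close>, and the unperturbed height is trapped between consecutive integers determined
  by the preceding levels.

  Admissibility enters through the lifting property of Bruhat covers: \<open>\<eta>\<close> can turn from positive to
  negative only at a fold with \<open>\<gamma>\<^sub>i = \<alpha>\<^sub>p\<close>, so the height has integral local maxima, all of them at
  levels.  Its maximum is therefore \<open>M(J, p)\<close>, the last ascent to it takes place between the indices \<open>k\<close> and
  \<open>m\<close>, and both root operators reflect the path there.  The times \<open>t\<^sub>0, t\<^sub>1\<close> may differ from the times of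
  \<open>k, m\<close>, but only by intervals on which the height is constant and \<open>s\<^sub>p\<close> fixes the derivative.
\<close>

text \<open>Several hyperplanes can meet the straight path at the same time, and there the order of
  the chain is invisible to the heights. The moving vector is therefore chosen with pairings
  \<open>e ^ q\<close> to the simple coroots: the time at which the moved path meets
  \<open>(a, k)\<close> becomes a polynomial in \<open>e\<close> whose coefficients are the entries
  of \<open>chain_vec\<close>, so that for small \<open>e\<close> the lexicographic order is the
  order of times. How small depends on the indices compared, and the chain may be infinite; hence
  only the walls over finitely many roots are followed, which still contain every index with
  \<gamma>_i = \<plusminus>\<alpha>_p. The invariant carried from wall to wall is strict: the
  perturbed height lies in the open interval \<open>(S n - 1, S n)\<close>. In the limit only the
  closed interval survives, which suffices for upper bounds; the exact levels come from the hits,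
  where the perturbed and the unperturbed point lie on the same hyperplane. The lifting property
  rests on the sign of roots and on the exchange property, which are derived here from the root data
  themselves.\<close>

locale km_data =
  fixes R :: "('v::euclidean_space) root_data"
  assumes km: "kac_moody_root_data R"
begin

definition idx :: "nat set" where "idx = {1..nsimple R}"

abbreviation "sr \<equiv> sroot R"
abbreviation "simple_refl p \<equiv> reflection R (sroot R p)"

lemma bil: "bilinear (form R)"
  and form_sym: "form R v w = form R w v"
  and form_nondeg: "(\<And>w. form R v w = 0) \<Longrightarrow> v = 0"
  and sroot_inj: "inj_on sr idx"
  and sroot_indep: "independent (sr ` idx)"
  and sroot_norm_pos: "p \<in> idx \<Longrightarrow> form R (sr p) (sr p) > 0"
  and cartan_int: "p \<in> idx \<Longrightarrow> q \<in> idx \<Longrightarrow> p \<noteq> q \<Longrightarrow> pairing R (sr p) (sr q) \<in> \<int>"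
  and cartan_nonpos: "p \<in> idx \<Longrightarrow> q \<in> idx \<Longrightarrow> p \<noteq> q \<Longrightarrow> pairing R (sr p) (sr q) \<le> 0"
  using km unfolding kac_moody_root_data_def idx_def by blast+

lemma finite_idx [simp]: "finite idx"
  by (simp add: idx_def)

lemma weyl_step': "w \<in> weyl R \<Longrightarrow> p \<in> idx \<Longrightarrow> w \<circ> simple_refl p \<in> weyl R"
  by (simp add: idx_def weyl_step)

lemma weyl_induct [consumes 1, case_names weyl_id weyl_step, induct set: weyl]:
  assumes "w \<in> weyl R" "P id"
    and "\<And>w p. w \<in> weyl R \<Longrightarrow> P w \<Longrightarrow> p \<in> idx \<Longrightarrow> P (w \<circ> simple_refl p)"
  shows "P w"
  using assms(1,2,3) by (induction rule: weyl.induct) (auto simp: idx_def)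

lemma roots_alt: "roots R = (\<Union>p\<in>idx. (\<lambda>w. w (sr p)) ` weyl R)"
  by (simp add: roots_def idx_def)

lemma root_cases:
  assumes "a \<in> roots R"
  obtains w q where "w \<in> weyl R" "q \<in> idx" "a = w (sr q)"
  using assms unfolding roots_alt by blast

lemma weight_lattice_alt: "weight_lattice R = {v. \<forall>p\<in>idx. pairing R v (sr p) \<in> \<int>}"
  by (simp add: weight_lattice_def idx_def)

lemmas form_lin = bilinear_ladd[OF bil] bilinear_radd[OF bil] bilinear_lmul[OF bil]
  bilinear_rmul[OF bil] bilinear_lsub[OF bil] bilinear_rsub[OF bil] bilinear_lneg[OF bil]
  bilinear_rneg[OF bil] bilinear_lzero[OF bil] bilinear_rzero[OF bil]

lemma form_sum_right: "form R v (sum f A) = (\<Sum>i\<in>A. form R v (f i))"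
proof -
  have "linear (form R v)"
    using bil by (simp add: bilinear_def)
  then show ?thesis
    by (rule linear_sum)
qed

text \<open>Nondegeneracy makes the map from vectors to functionals injective, and equal finite
  dimensions make it onto. The built-in inner product turns this map into the endomorphism
  \<open>B\<close>, to which the injective-implies-surjective theorem applies.\<close>

lemma form_representable:
  fixes f :: "'v \<Rightarrow> real"
  assumes "linear f"
  shows "\<exists>e. \<forall>v. form R e v = f v"
proof -
  define B where "B v = adjoint (form R v) 1" for v
  have B: "form R v w = w \<bullet> B v" for v w
    using adjoint_works[of "form R v" w 1] bil by (simp add: B_def bilinear_def)
  have "linear B"
  proof (rule linearI)
    show "B (x + y) = B x + B y" for x y
      by (rule vector_eq_rdot[THEN iffD1], rule allI)
         (simp add: inner_right_distrib form_lin inner_commute flip: B)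
    show "B (c *\<^sub>R x) = c *\<^sub>R B x" for c x
      by (rule vector_eq_rdot[THEN iffD1], rule allI)
         (simp add: form_lin inner_commute flip: B)
  qed
  moreover have "inj B"
    unfolding linear_injective_0[OF \<open>linear B\<close>]
    using B form_nondeg by (metis inner_zero_right)
  ultimately have "surj B"
    using \<open>linear B\<close> linear_injective_imp_surjective by blast
  then obtain e where "B e = adjoint f 1"
    by (metis surjD)
  then have "form R e v = f v" for v
    using adjoint_works[OF assms, of v 1] by (simp add: B)
  then show ?thesis by blast
qed

lemma prescribed_values:
  fixes f :: "nat \<Rightarrow> real"
  shows "\<exists>e. \<forall>p\<in>idx. form R e (sr p) = f p"
proof -
  obtain g :: "'v \<Rightarrow> real" where "linear g" and g: "\<forall>x\<in>sr ` idx. g x = f (the_inv_into idx sr x)"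
    using linear_independent_extend[OF sroot_indep, of "\<lambda>x. f (the_inv_into idx sr x)"] by blast
  obtain e where "\<forall>v. form R e v = g v"
    using form_representable[OF \<open>linear g\<close>] by blast
  with g sroot_inj show ?thesis
    by (intro exI[of _ e]) (simp add: the_inv_into_f_f)
qed

text \<open>Determined only up to vectors orthogonal to all simple roots. Pairing with it reads off
  the \<open>q\<close>-th coordinate of any combination of simple roots.\<close>

definition dual :: "nat \<Rightarrow> 'v" where
  "dual q = (SOME e. \<forall>p\<in>idx. form R e (sr p) = (if p = q then 1 else 0))"

lemma dual: "p \<in> idx \<Longrightarrow> form R (dual q) (sr p) = (if p = q then 1 else 0)"
  using someI_ex[OF prescribed_values[of "\<lambda>p. if p = q then 1 else 0"]] unfolding dual_def by blast

lemma dual_sum: "q \<in> idx \<Longrightarrow> form R (dual q) (\<Sum>p\<in>idx. c p *\<^sub>R sr p) = c q"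
  by (simp add: form_sum_right form_lin dual if_distrib cong: if_cong)

lemma sum_delta_sroot: "p \<in> idx \<Longrightarrow> (\<Sum>q\<in>idx. (if q = p then c else 0) *\<^sub>R sr q) = c *\<^sub>R sr p"
  by (simp add: if_distrib[of "\<lambda>x. x *\<^sub>R _"] if_distribR cong: if_cong)

subsection \<open>Reflections\<close>

lemma pairing_form: "pairing R v a = 2 * form R v a / form R a a"
  by (simp add: pairing_def coroot_def form_lin)

lemma pairing_lin:
  "pairing R (v + w) a = pairing R v a + pairing R w a"
  "pairing R (v - w) a = pairing R v a - pairing R w a"
  "pairing R (c *\<^sub>R v) a = c * pairing R v a"
  "pairing R (- v) a = - pairing R v a"
  "pairing R 0 a = 0"
  by (simp_all add: pairing_def form_lin)

lemma linear_pairing: "linear (\<lambda>v. pairing R v a)"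
  by (rule linearI) (simp_all add: pairing_lin)

lemma pairing_minus_right: "pairing R v (- a) = - pairing R v a"
  by (simp add: pairing_form form_lin)

lemma pairing_self: "form R a a \<noteq> 0 \<Longrightarrow> pairing R a a = 2"
  by (simp add: pairing_form)

lemma linear_reflection: "linear (reflection R a)"
  by (rule linearI) (simp_all add: reflection_def pairing_lin algebra_simps)

lemma reflection_scaleR: "c \<noteq> 0 \<Longrightarrow> reflection R (c *\<^sub>R a) = reflection R a"
  by (rule ext) (simp add: reflection_def pairing_form form_lin)

lemma reflection_minus: "reflection R (- a) = reflection R a"
  using reflection_scaleR[of "-1" a] by simp

lemma form_reflection:
  assumes "form R a a \<noteq> 0"
  shows "form R (reflection R a v) (reflection R a w) = form R v w"
  using assms
  by (simp add: reflection_def form_lin pairing_form form_sym[of a w] field_simps)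

lemma reflection_invol: "form R a a \<noteq> 0 \<Longrightarrow> reflection R a (reflection R a v) = v"
  by (simp add: reflection_def pairing_lin pairing_self)

lemma reflection_self: "form R a a \<noteq> 0 \<Longrightarrow> reflection R a a = - a"
  by (simp add: reflection_def pairing_self scaleR_2)

lemma simple_refl_invol: "p \<in> idx \<Longrightarrow> simple_refl p (simple_refl p v) = v"
  using sroot_norm_pos[of p] by (simp add: reflection_invol)

lemma simple_refl_weyl: "p \<in> idx \<Longrightarrow> simple_refl p \<in> weyl R"
  using weyl_step'[OF weyl_id, of p] by simp

lemma weyl_linear: "w \<in> weyl R \<Longrightarrow> linear w"
proof (induction rule: weyl_induct)
  case (weyl_step w p)
  from linear_compose[OF linear_reflection weyl_step(3)] show ?case .
qed (rule linear_id)

lemma weyl_form: "w \<in> weyl R \<Longrightarrow> form R (w v) (w u) = form R v u"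
proof (induction arbitrary: v u rule: weyl_induct)
  case (weyl_step w p)
  then show ?case
    using sroot_norm_pos[of p] by (simp add: form_reflection)
qed simp

lemma weyl_inverse: "w \<in> weyl R \<Longrightarrow> \<exists>w'\<in>weyl R. w \<circ> w' = id \<and> w' \<circ> w = id"
proof (induction rule: weyl_induct)
  case weyl_id
  then show ?case by (intro bexI[of _ id]) (auto intro: weyl.intros)
next
  case (weyl_step w p)
  then obtain w' where w': "w' \<in> weyl R" "w \<circ> w' = id" "w' \<circ> w = id" by blast
  have s: "simple_refl p \<circ> simple_refl p = id"
    using simple_refl_invol[OF weyl_step(2)] by (simp add: fun_eq_iff)
  have "w \<circ> simple_refl p \<circ> (simple_refl p \<circ> w') = w \<circ> (simple_refl p \<circ> simple_refl p) \<circ> w'"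
    by (simp only: comp_assoc)
  moreover have "simple_refl p \<circ> w' \<circ> (w \<circ> simple_refl p) = simple_refl p \<circ> (w' \<circ> w) \<circ> simple_refl p"
    by (simp only: comp_assoc)
  moreover have "simple_refl p \<circ> w' \<in> weyl R"
    using w'(1) weyl_step(2) by (intro weyl_comp simple_refl_weyl)
  ultimately show ?case
    by (intro bexI[of _ "simple_refl p \<circ> w'"]) (simp_all only: w' s comp_id id_comp simp_thms)
qed

lemma weyl_scaleR: "w \<in> weyl R \<Longrightarrow> w (c *\<^sub>R v) = c *\<^sub>R w v"
  by (rule linear_cmul[OF weyl_linear])

lemma weyl_minus: "w \<in> weyl R \<Longrightarrow> w (- v) = - w v"
  by (rule linear_neg[OF weyl_linear])

lemma weyl_add: "w \<in> weyl R \<Longrightarrow> w (v + u) = w v + w u"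
  by (rule linear_add[OF weyl_linear])

lemma weyl_diff: "w \<in> weyl R \<Longrightarrow> w (v - u) = w v - w u"
  by (rule linear_diff[OF weyl_linear])

lemma weyl_pairing: "w \<in> weyl R \<Longrightarrow> pairing R (w v) (w a) = pairing R v a"
  by (simp add: pairing_form weyl_form)

lemma weyl_reflection: "w \<in> weyl R \<Longrightarrow> w (reflection R a v) = reflection R (w a) (w v)"
  by (simp add: reflection_def weyl_pairing weyl_diff weyl_scaleR)

lemma roots_intro: "w \<in> weyl R \<Longrightarrow> q \<in> idx \<Longrightarrow> w (sr q) \<in> roots R"
  unfolding roots_alt by blast

lemma sroot_root: "p \<in> idx \<Longrightarrow> sr p \<in> roots R"
  using roots_intro[OF weyl_id] by simp

lemma weyl_root:
  assumes "w \<in> weyl R" "a \<in> roots R"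
  shows "w a \<in> roots R"
proof -
  obtain u q where "u \<in> weyl R" "q \<in> idx" "a = u (sr q)"
    by (rule root_cases[OF assms(2)])
  then show ?thesis
    using roots_intro[OF weyl_comp[OF _ assms(1)], of u q] by simp
qed

lemma root_norm_pos:
  assumes "a \<in> roots R"
  shows "form R a a > 0"
proof -
  obtain u q where "u \<in> weyl R" "q \<in> idx" "a = u (sr q)"
    by (rule root_cases[OF assms])
  then show ?thesis
    by (simp add: weyl_form sroot_norm_pos)
qed

lemma root_nonzero: "a \<in> roots R \<Longrightarrow> a \<noteq> 0"
  using root_norm_pos[of a] by (auto simp: form_lin)

lemma uminus_root:
  assumes "a \<in> roots R"
  shows "- a \<in> roots R"
proof -
  have "reflection R a a \<in> roots R"
    using weyl_root[OF reflection_in_weyl[OF km assms] assms] .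
  then show ?thesis
    using root_norm_pos[OF assms] by (simp add: reflection_self)
qed

lemma uminus_root_iff: "- a \<in> roots R \<longleftrightarrow> a \<in> roots R"
  using uminus_root[of a] uminus_root[of "- a"] by auto

subsection \<open>Integrality\<close>

lemma pairing_sroot_int: "p \<in> idx \<Longrightarrow> q \<in> idx \<Longrightarrow> pairing R (sr p) (sr q) \<in> \<int>"
  using cartan_int[of p q] sroot_norm_pos[of p] by (cases "p = q") (auto simp: pairing_self)

lemma weight_lattice_add: "v \<in> weight_lattice R \<Longrightarrow> w \<in> weight_lattice R \<Longrightarrow> v + w \<in> weight_lattice R"
  and weight_lattice_scale: "v \<in> weight_lattice R \<Longrightarrow> c \<in> \<int> \<Longrightarrow> c *\<^sub>R v \<in> weight_lattice R"
  and sroot_weight: "p \<in> idx \<Longrightarrow> sr p \<in> weight_lattice R"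
  by (auto simp: weight_lattice_alt pairing_lin pairing_sroot_int)

lemma weyl_weight_lattice:
  assumes "w \<in> weyl R" "v \<in> weight_lattice R"
  shows "w v \<in> weight_lattice R"
  using assms
proof (induction arbitrary: v rule: weyl_induct)
  case (weyl_step w p)
  have "pairing R v (sr p) \<in> \<int>"
    using weyl_step by (simp add: weight_lattice_alt)
  then have "v + (- pairing R v (sr p)) *\<^sub>R sr p \<in> weight_lattice R"
    using weyl_step by (intro weight_lattice_add weight_lattice_scale sroot_weight) auto
  then have "simple_refl p v \<in> weight_lattice R"
    by (simp add: reflection_def)
  with weyl_step.IH show ?case by simp
qed simp

lemma root_weight: "a \<in> roots R \<Longrightarrow> a \<in> weight_lattice R"
  unfolding roots_alt using weyl_weight_lattice sroot_weight by auto

lemma pairing_root_int: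
  assumes "v \<in> weight_lattice R" "a \<in> roots R"
  shows "pairing R v a \<in> \<int>"
proof -
  obtain w q where w: "w \<in> weyl R" "q \<in> idx" "a = w (sr q)"
    by (rule root_cases[OF assms(2)])
  obtain w' where w': "w' \<in> weyl R" "w' \<circ> w = id"
    using weyl_inverse[OF w(1)] by blast
  have "pairing R v a = pairing R (w' v) (sr q)"
    using weyl_pairing[OF w'(1), of v a] w w' by (metis comp_apply id_apply)
  then show ?thesis
    using weyl_weight_lattice[OF w'(1) assms(1)] w(2) by (simp add: weight_lattice_alt)
qed

lemma root_integer_combination:
  assumes "a \<in> roots R"
  shows "\<exists>z. (\<forall>q\<in>idx. z q \<in> \<int>) \<and> a = (\<Sum>q\<in>idx. z q *\<^sub>R sr q)"
proof -
  \<comment> \<open>Membership in the weight lattice is carried along because the multiple of a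
    simple root subtracted by a simple reflection must be an integer.\<close>
  have step: "\<exists>z. (\<forall>q\<in>idx. z q \<in> \<int>) \<and> w v = (\<Sum>q\<in>idx. z q *\<^sub>R sr q)"
    if "w \<in> weyl R" "\<exists>z. (\<forall>q\<in>idx. z q \<in> \<int>) \<and> v = (\<Sum>q\<in>idx. z q *\<^sub>R sr q)" "v \<in> weight_lattice R"
    for w v
    using that
  proof (induction arbitrary: v rule: weyl_induct)
    case (weyl_step w p)
    obtain z where z: "\<forall>q\<in>idx. z q \<in> \<int>" "v = (\<Sum>q\<in>idx. z q *\<^sub>R sr q)"
      using weyl_step.prems by blast
    have c: "pairing R v (sr p) \<in> \<int>"
      using weyl_step by (simp add: weight_lattice_alt)
    have "simple_refl p v = (\<Sum>q\<in>idx. z q *\<^sub>R sr q) - (\<Sum>q\<in>idx. (if q = p then pairing R v (sr p) else 0) *\<^sub>R sr q)"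
      using weyl_step.hyps by (simp add: sum_delta_sroot reflection_def flip: z(2))
    also have "\<dots> = (\<Sum>q\<in>idx. (z q - (if q = p then pairing R v (sr p) else 0)) *\<^sub>R sr q)"
      by (simp add: scaleR_diff_left sum_subtractf)
    finally have "\<exists>z. (\<forall>q\<in>idx. z q \<in> \<int>) \<and> simple_refl p v = (\<Sum>q\<in>idx. z q *\<^sub>R sr q)"
      using z(1) c by (intro exI conjI) (auto intro!: Ints_diff)
    then show ?case
      using weyl_step.IH[of "simple_refl p v"] weyl_weight_lattice[OF simple_refl_weyl] weyl_step by simp
  qed simp
  obtain w q where w: "w \<in> weyl R" "q \<in> idx" "a = w (sr q)"
    by (rule root_cases[OF assms])
  have "\<exists>z. (\<forall>q\<in>idx. z q \<in> \<int>) \<and> sr q = (\<Sum>q\<in>idx. z q *\<^sub>R sr q)"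
    using sum_delta_sroot[OF w(2), of 1] by (intro exI[of _ "\<lambda>r. if r = q then 1 else 0"]) auto
  from step[OF w(1) this sroot_weight[OF w(2)]] w(3) show ?thesis by blast
qed

lemma root_coord_int: "a \<in> roots R \<Longrightarrow> q \<in> idx \<Longrightarrow> form R (dual q) a \<in> \<int>"
  using root_integer_combination[of a] by (auto simp: dual_sum)

lemma root_expand: "a \<in> roots R \<Longrightarrow> a = (\<Sum>q\<in>idx. form R (dual q) a *\<^sub>R sr q)"
  using root_integer_combination[of a] by (auto simp: dual_sum intro!: sum.cong)

text \<open>After moving \<open>a\<close> to a simple root, \<open>c\<close> is a coordinate of a
  root and hence an integer. The same argument applied to the inverse multiple leaves only the
  units.\<close>

lemma root_multiple_unit:
  assumes "a \<in> roots R" "c *\<^sub>R a \<in> roots R"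
  shows "c = 1 \<or> c = -1"
proof -
  have int: "c \<in> \<int>" if a: "a \<in> roots R" and ca: "c *\<^sub>R a \<in> roots R" for a c
  proof -
    obtain w q where w: "w \<in> weyl R" "q \<in> idx" "a = w (sr q)"
      by (rule root_cases[OF a])
    obtain w' where w': "w' \<in> weyl R" "w' \<circ> w = id"
      using weyl_inverse[OF w(1)] by blast
    have "w' (c *\<^sub>R a) = c *\<^sub>R sr q"
      using w w' by (simp add: weyl_scaleR) (metis comp_apply id_apply)
    then have "c *\<^sub>R sr q \<in> roots R"
      using weyl_root[OF w'(1) ca] by simp
    from root_coord_int[OF this w(2)] show ?thesis
      using w(2) by (simp add: form_lin dual)
  qed
  have "c \<noteq> 0"
    using root_nonzero[OF assms(2)] by auto
  have "c \<in> \<int>" "1 / c \<in> \<int>"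
    using int[OF assms] int[OF assms(2), of "1 / c"] assms \<open>c \<noteq> 0\<close> by auto
  then obtain m n :: int where "c = m" "1 / c = n"
    by (auto elim!: Ints_cases)
  then have "m * n = 1"
    using \<open>c \<noteq> 0\<close> by (metis nonzero_divide_eq_eq of_int_1 of_int_eq_iff of_int_mult mult.commute)
  then show ?thesis
    using \<open>c = m\<close> by (auto simp: zmult_eq_1_iff)
qed

subsection \<open>Positive and negative roots\<close>

text \<open>The cone is kept apart from being a root, so that sums and positive multiples of roots
  stay inside it.\<close>

definition nonneg :: "'v \<Rightarrow> bool" where
  "nonneg v \<longleftrightarrow> (\<exists>c. (\<forall>q\<in>idx. 0 \<le> c q) \<and> v = (\<Sum>q\<in>idx. c q *\<^sub>R sr q))"

lemma pos_roots_iff: "a \<in> pos_roots R \<longleftrightarrow> a \<in> roots R \<and> nonneg a"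
  unfolding pos_roots_def nonneg_def idx_def by auto

lemma nonneg_coord: "nonneg v \<Longrightarrow> q \<in> idx \<Longrightarrow> 0 \<le> form R (dual q) v"
  unfolding nonneg_def by (auto simp: dual_sum)

lemma nonneg_expand: "nonneg v \<Longrightarrow> v = (\<Sum>q\<in>idx. form R (dual q) v *\<^sub>R sr q)"
  unfolding nonneg_def by (auto simp: dual_sum intro!: sum.cong)

lemma nonneg_add:
  assumes "nonneg v" "nonneg w"
  shows "nonneg (v + w)"
  unfolding nonneg_def
proof (intro exI conjI ballI)
  show "v + w = (\<Sum>q\<in>idx. (form R (dual q) v + form R (dual q) w) *\<^sub>R sr q)"
    by (subst nonneg_expand[OF assms(1)], subst nonneg_expand[OF assms(2)])
       (simp add: scaleR_add_left sum.distrib)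
qed (use nonneg_coord[OF assms(1)] nonneg_coord[OF assms(2)] in auto)

lemma nonneg_scaleR:
  assumes "nonneg v" "0 \<le> c"
  shows "nonneg (c *\<^sub>R v)"
  unfolding nonneg_def
proof (intro exI conjI ballI)
  show "c *\<^sub>R v = (\<Sum>q\<in>idx. (c * form R (dual q) v) *\<^sub>R sr q)"
    by (subst nonneg_expand[OF assms(1)]) (simp add: scaleR_sum_right)
qed (use nonneg_coord[OF assms(1)] assms(2) in auto)

lemma nonneg_sroot: "p \<in> idx \<Longrightarrow> nonneg (sr p)"
  unfolding nonneg_def using sum_delta_sroot[of p 1]
  by (intro exI[of _ "\<lambda>q. if q = p then 1 else 0"]) auto

lemma nonneg_antisym: "nonneg v \<Longrightarrow> nonneg (- v) \<Longrightarrow> v = 0"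
proof -
  assume v: "nonneg v" and "nonneg (- v)"
  then have "form R (dual q) v = 0" if "q \<in> idx" for q
    using nonneg_coord[of v q] nonneg_coord[of "- v" q] that by (simp add: form_lin)
  then show ?thesis
    by (subst nonneg_expand[OF v]) simp
qed

section \<open>Words, length and the sign of roots\<close>

definition word :: "nat list \<Rightarrow> 'v \<Rightarrow> 'v" where
  "word ps = foldr (\<lambda>p u. simple_refl p \<circ> u) ps id"

lemma word_simps [simp]:
  "word [] = id" "word (p # ps) = simple_refl p \<circ> word ps" "word (ps @ qs) = word ps \<circ> word qs"
proof -
  show "word (ps @ qs) = word ps \<circ> word qs"
    by (induction ps) (auto simp: word_def)
qed (auto simp: word_def)

lemma word_weyl: "set ps \<subseteq> idx \<Longrightarrow> word ps \<in> weyl R"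
  by (induction ps) (auto intro: weyl_id weyl_comp simple_refl_weyl)

lemma weyl_word: "w \<in> weyl R \<Longrightarrow> \<exists>ps. set ps \<subseteq> idx \<and> w = word ps"
proof (induction rule: weyl_induct)
  case (weyl_step w p)
  then obtain ps where "set ps \<subseteq> idx" "w = word ps" by blast
  with weyl_step.hyps show ?case
    by (intro exI[of _ "ps @ [p]"]) auto
qed (auto intro: exI[of _ "[]"])

abbreviation "len \<equiv> weyl_length R"

lemma len_word_le: "set ps \<subseteq> idx \<Longrightarrow> len (word ps) \<le> length ps"
  unfolding weyl_length_def word_def idx_def by (rule Least_le) blast

lemma reduced_word:
  assumes "w \<in> weyl R"
  obtains ps where "length ps = len w" "set ps \<subseteq> idx" "w = word ps"
proof -
  have "\<exists>n ps. length ps = n \<and> set ps \<subseteq> idx \<and> w = foldr (\<lambda>p u. simple_refl p \<circ> u) ps id"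
    using weyl_word[OF assms] unfolding word_def by blast
  from LeastI_ex[OF this[unfolded idx_def]] show ?thesis
    using that unfolding weyl_length_def word_def idx_def by blast
qed

text \<open>Applying the letters from the right, \<open>a\<close> turns negative at some letter
  \<open>p\<close>. Just before it the image of \<open>a\<close> is a multiple of
  \<open>sr p\<close>, so deleting this letter amounts to composing with the reflection in
  \<open>a\<close>. The sign alternative is a hypothesis on subwords only: the lemma is applied in
  rank two to prove that alternative for all roots, and again afterwards.\<close>

lemma exchange:
  assumes "form R a a \<noteq> 0" "nonneg a" "set ps \<subseteq> idx" "\<not> nonneg (word ps a)"
    and "\<And>us. set us \<subseteq> set ps \<Longrightarrow> nonneg (word us a) \<or> nonneg (- word us a)"
  shows "\<exists>qs. length qs < length ps \<and> set qs \<subseteq> set ps \<and> word qs = word ps \<circ> reflection R a"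
  using assms(3-5)
proof (induction ps)
  case Nil
  then show ?case using assms(2) by simp
next
  case (Cons p ps)
  show ?case
  proof (cases "nonneg (word ps a)")
    case False
    moreover have "nonneg (word us a) \<or> nonneg (- word us a)" if "set us \<subseteq> set ps" for us
      using that by (intro Cons.prems(3)) auto
    ultimately obtain qs where "length qs < length ps" "set qs \<subseteq> set ps" "word qs = word ps \<circ> reflection R a"
      using Cons.IH[OF _ False] Cons.prems(1) by (metis insert_subset list.simps(15))
    then show ?thesis
      by (intro exI[of _ "p # qs"]) (auto simp: fun_eq_iff)
  next
    case True
    define d where "d = word ps a"
    have p: "p \<in> idx" and ps: "word ps \<in> weyl R"
      using Cons.prems word_weyl by auto
    have neg: "nonneg (- simple_refl p d)"
      using Cons.prems(2) Cons.prems(3)[of "p # ps"] unfolding d_def by auto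
    \<comment> \<open>A simple reflection changes only the \<open>p\<close>-th coordinate. Every
      other coordinate is nonnegative before it and nonpositive after it.\<close>
    have "form R (dual q) d = 0" if "q \<in> idx" "q \<noteq> p" for q
      using nonneg_coord[OF True that(1)] nonneg_coord[OF neg that(1)] p that
      by (simp add: reflection_def form_lin dual d_def)
    then have "(\<Sum>q\<in>idx. form R (dual q) d *\<^sub>R sr q) = (\<Sum>q\<in>idx. (if q = p then form R (dual p) d else 0) *\<^sub>R sr q)"
      by (intro sum.cong) auto
    then have d: "d = form R (dual p) d *\<^sub>R sr p"
      using nonneg_expand[OF True] unfolding sum_delta_sroot[OF p] d_def by (metis (no_types))
    have norm: "form R d d \<noteq> 0"
      using assms(1) ps by (simp add: d_def weyl_form)
    obtain c where c: "d = c *\<^sub>R sr p"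
      using d by blast
    with norm have "reflection R d = simple_refl p"
      by (cases "c = 0") (auto simp: form_lin reflection_scaleR)
    then have "word ps (reflection R a v) = simple_refl p (word ps v)" for v
      by (simp add: weyl_reflection[OF ps] flip: d_def)
    then have "word ps = word (p # ps) \<circ> reflection R a"
      using p by (auto simp: fun_eq_iff simple_refl_invol)
    then show ?thesis
      by (intro exI[of _ ps]) (simp only: length_Cons set_subset_Cons lessI simp_thms)
  qed
qed


text \<open>In rank two an integral combination with coefficients of opposite signs is too long to be
  a root, because the simple roots form an obtuse angle.\<close>

lemma rank_two_dichotomy:
  assumes pq: "p \<in> idx" "q \<in> idx" "p \<noteq> q" and us: "set us \<subseteq> {p, q}" and r: "r \<in> {p, q}"
  shows "\<exists>x y. word us (sr r) = x *\<^sub>R sr p + y *\<^sub>R sr q \<and> (0 \<le> x \<and> 0 \<le> y \<or> x \<le> 0 \<and> y \<le> 0)"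
proof -
  have "set us \<subseteq> idx"
    using us pq by auto
  have "\<exists>x\<in>\<int>. \<exists>y\<in>\<int>. word us (sr r) = x *\<^sub>R sr p + y *\<^sub>R sr q"
    using us
  proof (induction us)
    case Nil
    show ?case
    proof (cases "r = p")
      case True
      then show ?thesis by (intro bexI[of _ 1] bexI[of _ 0]) auto
    next
      case False
      then show ?thesis using r by (intro bexI[of _ 0] bexI[of _ 1]) auto
    qed
  next
    case (Cons u us)
    then obtain x y where xy: "x \<in> \<int>" "y \<in> \<int>" "word us (sr r) = x *\<^sub>R sr p + y *\<^sub>R sr q"
      by auto
    define c where "c = pairing R (word us (sr r)) (sr u)"
    have u: "u = p \<or> u = q"
      using Cons.prems by auto
    have c: "c \<in> \<int>"
      using u xy(1,2) pq pairing_sroot_int by (auto simp: c_def xy(3) pairing_lin)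
    have eq: "word (u # us) (sr r) = x *\<^sub>R sr p + y *\<^sub>R sr q - c *\<^sub>R sr u"
      by (simp add: reflection_def c_def xy(3))
    show ?case
    proof (cases "u = p")
      case True
      then show ?thesis
        using xy c eq by (intro bexI[of _ "x - c"] bexI[of _ y]) (auto simp: scaleR_diff_left)
    next
      case False
      then show ?thesis
        using xy c eq u by (intro bexI[of _ x] bexI[of _ "y - c"]) (auto simp: scaleR_diff_left)
    qed
  qed
  then obtain x y where xy: "x \<in> \<int>" "y \<in> \<int>" and eq: "word us (sr r) = x *\<^sub>R sr p + y *\<^sub>R sr q"
    by blast
  define A B C where "A = form R (sr p) (sr p)" and "B = form R (sr q) (sr q)" and "C = form R (sr p) (sr q)"
  have AB: "A > 0" "B > 0"
    using pq sroot_norm_pos by (auto simp: A_def B_def)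
  have C: "C \<le> 0"
    using cartan_nonpos[OF pq] AB by (simp add: pairing_form B_def C_def divide_le_0_iff)
  have norm: "x\<^sup>2 * A + y\<^sup>2 * B + 2 * (x * y) * C = form R (sr r) (sr r)"
    using weyl_form[OF word_weyl[OF \<open>set us \<subseteq> idx\<close>], of "sr r" "sr r"]
    by (simp add: eq form_lin A_def B_def C_def form_sym[of "sr q" "sr p"] power2_eq_square algebra_simps)
  have "\<not> x * y < 0"
  proof
    assume neg: "x * y < 0"
    have sq: "1 \<le> z\<^sup>2" if "z \<in> \<int>" "z \<noteq> 0" for z :: real
      using Ints_nonzero_abs_ge1[OF that] by (metis abs_one abs_le_square_iff one_power2)
    have "1 \<le> x\<^sup>2" "1 \<le> y\<^sup>2"
      using neg by (intro sq xy; auto)+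
    then have "A \<le> x\<^sup>2 * A" "B \<le> y\<^sup>2 * B"
      using AB by simp_all
    moreover have "0 \<le> 2 * (x * y) * C"
      using neg C by (intro mult_nonpos_nonpos) auto
    ultimately have "A + B \<le> form R (sr r) (sr r)"
      using norm by linarith
    moreover have "form R (sr r) (sr r) < A + B"
      using r AB by (auto simp: A_def B_def)
    ultimately show False by simp
  qed
  then have "0 \<le> x \<and> 0 \<le> y \<or> x \<le> 0 \<and> y \<le> 0"
    by (auto simp: mult_less_0_iff not_less)
  with eq show ?thesis by blast
qed

text \<open>Induction on the length. With \<open>q\<close> the last letter of a reduced word,
  \<open>w\<close> is split into a shortest possible \<open>v\<close> and a word in \<open>p\<close>
  and \<open>q\<close>. By induction \<open>v\<close> sends both simple roots into the cone, and the
  rank-two word sends \<open>sr p\<close> to a nonnegative combination of the two.\<close>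

lemma nonneg_of_length_le:
  assumes "w \<in> weyl R" "p \<in> idx" "len w \<le> len (w \<circ> simple_refl p)"
  shows "nonneg (w (sr p))"
  using assms
proof (induction "len w" arbitrary: w p rule: less_induct)
  case less
  obtain ps where ps: "length ps = len w" "set ps \<subseteq> idx" "w = word ps"
    using reduced_word[OF less.prems(1)] .
  show ?case
  proof (cases ps rule: rev_cases)
    case Nil
    then show ?thesis
      using ps nonneg_sroot[OF less.prems(2)] by simp
  next
    case (snoc us q)
    have q: "q \<in> idx" and us: "set us \<subseteq> idx"
      using snoc ps by auto
    have "w \<circ> simple_refl q = word us"
      using snoc ps(3) simple_refl_invol[OF q] by (auto simp: fun_eq_iff)
    then have lq: "len (w \<circ> simple_refl q) < len w"
      using len_word_le[OF us] ps(1) snoc by simp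
    then have "p \<noteq> q"
      using less.prems(3) by auto
    \<comment> \<open>Factorizations of \<open>w\<close> through the subgroup generated by the
      reflections in \<open>p\<close> and \<open>q\<close>, with lengths adding up to at most that
      of \<open>w\<close>; one with shortest \<open>v\<close> is used.\<close>
    define D where "D v xs \<longleftrightarrow> v \<in> weyl R \<and> set xs \<subseteq> {p, q} \<and> w = v \<circ> word xs \<and> len v + length xs \<le> len w" for v xs
    have D1: "D (word us) [q]"
      using snoc ps len_word_le[OF us] word_weyl[OF us] unfolding D_def by simp
    then obtain v xs where D: "D v xs" and min: "\<And>v' xs'. D v' xs' \<Longrightarrow> len v \<le> len v'"
      using ex_has_least_nat[of "\<lambda>(v, xs). D v xs" "(word us, [q])" "\<lambda>(v, xs). len v"] by auto
    have v: "v \<in> weyl R" "set xs \<subseteq> {p, q}" "w = v \<circ> word xs" "len v + length xs \<le> len w"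
      using D by (auto simp: D_def)
    have "len v < len w"
      using min[OF D1] len_word_le[OF us] ps(1) snoc by simp
    have up: "len v \<le> len (v \<circ> simple_refl r)" if r: "r \<in> {p, q}" for r
    proof (rule ccontr)
      assume lt: "\<not> ?thesis"
      have r': "r \<in> idx"
        using r less.prems(2) q by auto
      have "v \<circ> simple_refl r \<circ> word (r # xs) = w"
        using v(3) simple_refl_invol[OF r'] by (auto simp: fun_eq_iff)
      then have "D (v \<circ> simple_refl r) (r # xs)"
        using v lt r r' by (auto simp: D_def intro: weyl_step')
      from min[OF this] lt show False by simp
    qed
    have vp: "nonneg (v (sr p))" and vq: "nonneg (v (sr q))"
      using less.hyps[OF \<open>len v < len w\<close> v(1)] up less.prems(2) q by auto
    \<comment> \<open>Otherwise the exchange property would shorten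
      \<open>word xs \<circ> simple_refl p\<close>, and \<open>w \<circ> simple_refl p\<close> would
      be shorter than \<open>w\<close>.\<close>
    have pos: "nonneg (word xs (sr p))"
    proof (rule ccontr)
      assume *: "\<not> nonneg (word xs (sr p))"
      have "nonneg (word us (sr p)) \<or> nonneg (- word us (sr p))" if "set us \<subseteq> set xs" for us
      proof -
        have "set us \<subseteq> {p, q}" using that v(2) by auto
        from rank_two_dichotomy[OF less.prems(2) q \<open>p \<noteq> q\<close> this, of p]
        obtain x y where xy: "word us (sr p) = x *\<^sub>R sr p + y *\<^sub>R sr q"
          "0 \<le> x \<and> 0 \<le> y \<or> x \<le> 0 \<and> y \<le> 0" by blast
        have "nonneg (a *\<^sub>R sr p + b *\<^sub>R sr q)" if "0 \<le> a" "0 \<le> b" for a b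
          using that less.prems(2) q by (intro nonneg_add nonneg_scaleR nonneg_sroot) auto
        from this[of x y] this[of "-x" "-y"] xy show ?thesis
          by (auto simp: algebra_simps)
      qed
      moreover have "set xs \<subseteq> idx" "form R (sr p) (sr p) \<noteq> 0"
        using v(2) less.prems(2) q sroot_norm_pos[OF less.prems(2)] by auto
      ultimately obtain ys where ys: "length ys < length xs" "set ys \<subseteq> set xs"
          "word ys = word xs \<circ> simple_refl p"
        using exchange[OF _ nonneg_sroot[OF less.prems(2)] _ *] by blast
      obtain vs where vs: "length vs = len v" "set vs \<subseteq> idx" "v = word vs"
        using reduced_word[OF v(1)] .
      have "w \<circ> simple_refl p = word (vs @ ys)"
        by (simp add: v(3) vs(3) ys(3) comp_assoc)
      moreover have "set (vs @ ys) \<subseteq> idx"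
        using vs ys v(2) less.prems(2) q by auto
      ultimately have "len (w \<circ> simple_refl p) \<le> length (vs @ ys)"
        using len_word_le by metis
      then show False
        using vs(1) ys(1) v(4) less.prems(3) by simp
    qed
    obtain x y where xy: "word xs (sr p) = x *\<^sub>R sr p + y *\<^sub>R sr q"
      using rank_two_dichotomy[OF less.prems(2) q \<open>p \<noteq> q\<close> v(2), of p] by blast
    have "x \<ge> 0" "y \<ge> 0"
      using nonneg_coord[OF pos less.prems(2)] nonneg_coord[OF pos q] less.prems(2) q \<open>p \<noteq> q\<close>
      by (auto simp: xy form_lin dual)
    moreover have "w (sr p) = x *\<^sub>R v (sr p) + y *\<^sub>R v (sr q)"
      by (simp add: v(3) xy weyl_add[OF v(1)] weyl_scaleR[OF v(1)])
    ultimately show ?thesis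
      using vp vq by (simp add: nonneg_add nonneg_scaleR)
  qed
qed

text \<open>Of \<open>w\<close> and \<open>w \<circ> simple_refl p\<close> one is not longer than
  the other, and the two send \<open>sr p\<close> to opposite roots.\<close>

lemma root_dichotomy:
  assumes "a \<in> roots R"
  shows "nonneg a \<or> nonneg (- a)"
proof -
  obtain w p where w: "w \<in> weyl R" "p \<in> idx" "a = w (sr p)"
    by (rule root_cases[OF assms])
  define w' where "w' = w \<circ> simple_refl p"
  have w': "w' \<in> weyl R" "w' \<circ> simple_refl p = w" "w' (sr p) = - a"
    using w simple_refl_invol[OF w(2)] sroot_norm_pos[OF w(2)]
    by (auto simp: w'_def weyl_step' fun_eq_iff reflection_self weyl_minus)
  show ?thesis
  proof (cases "len w \<le> len w'")
    case True
    then show ?thesis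
      using nonneg_of_length_le[OF w(1,2)] by (simp add: w'_def w(3))
  next
    case False
    then show ?thesis
      using nonneg_of_length_le[OF w'(1) w(2)] by (simp add: w'(2,3))
  qed
qed

lemma pos_root_root: "a \<in> pos_roots R \<Longrightarrow> a \<in> roots R"
  by (simp add: pos_roots_iff)

lemma neg_root_iff:
  assumes "a \<in> roots R"
  shows "- a \<in> pos_roots R \<longleftrightarrow> a \<notin> pos_roots R"
  using root_dichotomy[OF assms] nonneg_antisym[of a] root_nonzero[OF assms] assms uminus_root_iff[of a]
  by (auto simp: pos_roots_iff)

lemma sroot_pos: "p \<in> idx \<Longrightarrow> sr p \<in> pos_roots R"
  by (simp add: pos_roots_iff sroot_root nonneg_sroot)

text \<open>The exchange property for a reduced word of \<open>w\<close>.\<close>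

lemma length_reflection_less:
  assumes "w \<in> weyl R" "a \<in> pos_roots R" "w a \<notin> pos_roots R"
  shows "len (w \<circ> reflection R a) < len w"
proof -
  obtain ps where ps: "length ps = len w" "set ps \<subseteq> idx" "w = word ps"
    using reduced_word[OF assms(1)] .
  have a: "a \<in> roots R" "nonneg a" "form R a a \<noteq> 0"
    using assms(2) root_norm_pos[of a] by (auto simp: pos_roots_iff)
  have "nonneg (word us a) \<or> nonneg (- word us a)" if "set us \<subseteq> set ps" for us
    using root_dichotomy weyl_root[OF word_weyl a(1)] that ps(2) by blast
  moreover have "\<not> nonneg (word ps a)"
    using assms(3) weyl_root[OF assms(1) a(1)] by (simp add: pos_roots_iff ps(3))
  ultimately obtain qs where qs: "length qs < length ps" "set qs \<subseteq> set ps" "word qs = w \<circ> reflection R a"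
    using exchange[OF a(3,2) ps(2)] ps(3) by blast
  have "len (w \<circ> reflection R a) \<le> length qs"
    using len_word_le[of qs] ps(2) qs(2,3) by auto
  then show ?thesis
    using qs(1) ps(1) by simp
qed

lemma length_reflection_greater:
  assumes "w \<in> weyl R" "a \<in> pos_roots R" "w a \<in> pos_roots R"
  shows "len w < len (w \<circ> reflection R a)"
proof -
  have a: "a \<in> roots R" "form R a a \<noteq> 0"
    using assms(2) root_norm_pos[of a] by (auto simp: pos_roots_iff)
  have r: "w \<circ> reflection R a \<in> weyl R"
    using weyl_comp[OF reflection_in_weyl[OF km a(1)] assms(1)] .
  have "(w \<circ> reflection R a) a \<notin> pos_roots R"
    using neg_root_iff[OF weyl_root[OF assms(1) a(1)]] assms(3) a(2) assms(1)
    by (simp add: reflection_self weyl_minus)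
  from length_reflection_less[OF r assms(2) this]
  show ?thesis
    using reflection_invol[OF a(2)] by (simp add: comp_def)
qed

text \<open>Only the \<open>p\<close>-th coordinate changes, so a change of sign would force all
  others to vanish; the root would be a multiple of \<open>sr p\<close>, hence \<open>sr p\<close>
  itself.\<close>

lemma simple_refl_pos:
  assumes "a \<in> pos_roots R" "p \<in> idx" "a \<noteq> sr p"
  shows "simple_refl p a \<in> pos_roots R"
proof (rule ccontr)
  assume *: "simple_refl p a \<notin> pos_roots R"
  have a: "a \<in> roots R" "nonneg a"
    using assms(1) by (auto simp: pos_roots_iff)
  have "- simple_refl p a \<in> pos_roots R"
    using * neg_root_iff[OF weyl_root[OF simple_refl_weyl[OF assms(2)] a(1)]] by simp
  then have neg: "nonneg (- simple_refl p a)"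
    by (simp add: pos_roots_iff)
  have "form R (dual q) a = 0" if "q \<in> idx" "q \<noteq> p" for q
    using nonneg_coord[OF a(2) that(1)] nonneg_coord[OF neg that(1)] assms(2) that
    by (simp add: reflection_def form_lin dual)
  then have "(\<Sum>q\<in>idx. form R (dual q) a *\<^sub>R sr q) = (\<Sum>q\<in>idx. (if q = p then form R (dual p) a else 0) *\<^sub>R sr q)"
    by (intro sum.cong) auto
  then have eq: "a = form R (dual p) a *\<^sub>R sr p"
    using nonneg_expand[OF a(2)] sum_delta_sroot[OF assms(2)] by metis
  then have "form R (dual p) a = 1 \<or> form R (dual p) a = -1"
    using root_multiple_unit[OF sroot_root[OF assms(2)]] a(1) by metis
  moreover have "form R (dual p) a \<ge> 0"
    using nonneg_coord[OF a(2) assms(2)] .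
  ultimately show False
    using eq assms(3) by (metis neg_0_le_iff_le not_one_le_zero scaleR_one)
qed

lemma cover_pos:
  assumes "w \<in> weyl R" "b \<in> pos_roots R" "len (w \<circ> reflection R b) = len w + 1"
  shows "w b \<in> pos_roots R"
  using length_reflection_less[OF assms(1,2)] assms(3) by fastforce

text \<open>If \<open>w b\<close> were not \<alpha>_p, then s_p would keep it positive, so l(s_p w)
  < l(s_p w s_b). But w e = \<alpha>_p with \<open>e\<close> positive gives l(w) < l(s_p w), and s_b
  e negative gives l(s_p w s_b) < l(w s_b) = l(w) + 1. Together l(s_p w s_b) \<le> l(w) < l(s_p w),
  a contradiction.\<close>

lemma cover_lifting:
  assumes w: "w \<in> weyl R" and b: "b \<in> pos_roots R" and cov: "len (w \<circ> reflection R b) = len w + 1"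
    and p: "p \<in> idx" and e: "w e = sr p" "e \<in> pos_roots R" "reflection R b e \<notin> pos_roots R"
  shows "w b = sr p"
proof (rule ccontr)
  assume ne: "w b \<noteq> sr p"
  have br: "b \<in> roots R" "e \<in> roots R" and norm: "form R b b \<noteq> 0"
    using b e pos_root_root root_norm_pos[of b] by auto
  define w' where "w' = w \<circ> reflection R b"
  define d where "d = - reflection R b e"
  have rb: "reflection R b \<in> weyl R"
    using reflection_in_weyl[OF km br(1)] .
  have w': "w' \<in> weyl R"
    unfolding w'_def using weyl_comp[OF rb w] .
  have d: "d \<in> pos_roots R"
    using neg_root_iff[OF weyl_root[OF rb br(2)]] e(3) by (simp add: d_def)
  have w'd: "w' d = - sr p"
    using e(1) norm by (simp add: w'_def d_def weyl_minus[OF rb] weyl_minus[OF w] linear_neg[OF linear_reflection] reflection_invol)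
  have neg: "- sr p \<notin> pos_roots R"
    using neg_root_iff[OF sroot_root[OF p]] sroot_pos[OF p] by simp
  \<comment> \<open>Left multiplication by s_p becomes right multiplication by a reflection, the
    form required by the length lemmas.\<close>
  have conj: "simple_refl p \<circ> u = u \<circ> reflection R c" if "u \<in> weyl R" "u c = sr p \<or> u c = - sr p" for u c
    using that weyl_reflection[OF that(1), of c] by (auto simp: fun_eq_iff reflection_minus)
  have "len (simple_refl p \<circ> w') < len w'"
    using length_reflection_less[OF w' d] w'd neg conj[OF w', of d] by simp
  then have le: "len (simple_refl p \<circ> w') \<le> len w"
    using cov by (simp add: w'_def)
  have gt: "len w < len (simple_refl p \<circ> w)"
    using length_reflection_greater[OF w e(2)] e(1) sroot_pos[OF p] conj[OF w, of e] by simp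
  have "simple_refl p (w b) \<in> pos_roots R"
    by (rule simple_refl_pos[OF cover_pos[OF w b cov] p ne])
  then have "len (simple_refl p \<circ> w) < len (simple_refl p \<circ> w \<circ> reflection R b)"
    by (intro length_reflection_greater weyl_comp simple_refl_weyl p w b) simp
  then show False
    using le gt by (simp add: w'_def comp_assoc)
qed

end

text \<open>Read as coefficients of polynomials in \<open>e\<close>, constant term first, the lists
  are compared at small positive \<open>e\<close> by the first coefficient in which they
  differ.\<close>

lemma lexordp_eventually_horner_sum:
  fixes xs ys :: "real list"
  assumes "ord_class.lexordp xs ys" "length xs = length ys"
  shows "eventually (\<lambda>e. horner_sum (\<lambda>x. x) e xs < horner_sum (\<lambda>x. x) e ys) (at_right 0)"
  using assms
proof (induction rule: lexordp_induct)
  case (Cons x xs y ys)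
  have lim: "((\<lambda>e. horner_sum (\<lambda>x. x) e zs) \<longlongrightarrow> horner_sum (\<lambda>x. x) 0 zs) (at_right 0)" for zs :: "real list"
    unfolding horner_sum_eq_sum by (intro tendsto_intros)
  show ?case
    using order_tendstoD(1)[OF tendsto_diff[OF lim[of "y # ys"] lim[of "x # xs"]], of 0] Cons
    by (simp del: horner_sum_simps) simp
next
  case (Cons_eq x xs ys)
  then have "eventually (\<lambda>e. horner_sum (\<lambda>x. x) e xs < horner_sum (\<lambda>x. x) e ys) (at_right 0)"
    by simp
  moreover have "eventually (\<lambda>e. 0 < e) (at_right (0 :: real))"
    by (rule eventually_at_right_less)
  ultimately show ?case
    by eventually_elim simp
qed simp

text \<open>Together with the existence lemma that follows, this gives a meaning to the definite
  description in \<open>chain_enum\<close>.\<close>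

lemma sorted_wrt_unique:
  assumes "irreflp r" "transp r" "sorted_wrt r xs" "sorted_wrt r ys" "set xs = set ys"
  shows "xs = ys"
  using assms(3-5)
proof (induction xs arbitrary: ys)
  case (Cons x xs)
  then obtain y ys' where ys: "ys = y # ys'"
    by (cases ys) auto
  have "x = y"
  proof (rule ccontr)
    assume "x \<noteq> y"
    then have "x \<in> set ys'" "y \<in> set xs"
      using Cons.prems(3) ys by auto
    then have "r y x" "r x y"
      using Cons.prems ys by auto
    then show False
      using assms(1,2) by (meson irreflpD transpD)
  qed
  moreover have "x \<notin> set xs" "y \<notin> set ys'"
    using Cons.prems(1,2) ys assms(1) by (auto dest: irreflpD)
  ultimately have "set xs = set ys'"
    using Cons.prems(3) ys by auto
  then show ?case
    using Cons.IH[of ys'] Cons.prems ys \<open>x = y\<close> by simp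
qed simp

lemma sorted_wrt_exists:
  assumes "transp r" "finite A" "\<And>x y. x \<in> A \<Longrightarrow> y \<in> A \<Longrightarrow> x \<noteq> y \<Longrightarrow> r x y \<or> r y x"
  shows "\<exists>xs. sorted_wrt r xs \<and> set xs = A"
  using assms(2,3)
proof (induction A)
  case (insert x A)
  then obtain xs where xs: "sorted_wrt r xs" "set xs = A" by auto
  have "sorted_wrt r (filter (\<lambda>y. r y x) xs @ x # filter (\<lambda>y. \<not> r y x) xs)"
    using xs insert.hyps insert.prems assms(1)
    by (auto simp: sorted_wrt_append sorted_wrt_filter) (metis transpD)+
  then show ?case
    using xs(2) by (intro exI conjI) auto
qed auto

section \<open>The total order of the chain and its finite subsets\<close>

locale km_weight = km_data +
  fixes lam :: 'a
  assumes lam: "lam \<in> weight_lattice R" and dom: "dominant R lam"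
begin

abbreviation "chain \<equiv> lam_chain R lam"
abbreviation before (infix "\<lhd>" 50) where "i \<lhd> j \<equiv> chain_less R lam i j"
abbreviation "time \<equiv> chain_time R lam"
abbreviation "enum \<equiv> chain_enum R lam"

lemma irreflp_before: "irreflp (chain_less R lam)"
  by (simp add: irreflp_def chain_less_def lexordp_irreflexive')

lemma transp_before: "transp (chain_less R lam)"
  by (auto simp: transp_def chain_less_def intro: lexordp_trans)

lemma before_irrefl [simp]: "\<not> i \<lhd> i"
  using irreflpD[OF irreflp_before] .

lemma before_trans: "i \<lhd> j \<Longrightarrow> j \<lhd> k \<Longrightarrow> i \<lhd> k"
  using transpD[OF transp_before] .

lemma before_asym: "i \<lhd> j \<Longrightarrow> \<not> j \<lhd> i"
  using before_trans[of i j i] by auto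

lemma time_mono: "i \<lhd> j \<Longrightarrow> time i \<le> time j"
  by (cases i; cases j) (auto simp: chain_less_def chain_vec_def chain_time_def)

lemma chain_iff: "(a, k) \<in> chain \<longleftrightarrow> a \<in> pos_roots R \<and> 0 \<le> k \<and> of_int k < pairing R lam a"
  by (simp add: lam_chain_def)

lemma chainD:
  assumes "(a, k) \<in> chain"
  shows "a \<in> pos_roots R" "a \<in> roots R" "0 \<le> k" "of_int k < pairing R lam a" "0 < pairing R lam a"
  using assms by (auto simp: chain_iff pos_root_root)

lemma dom_nonneg: "a \<in> pos_roots R \<Longrightarrow> 0 \<le> pairing R lam a"
  using dom by (simp add: dominant_def)

lemma time_range: "i \<in> chain \<Longrightarrow> 0 \<le> time i" "i \<in> chain \<Longrightarrow> time i < 1"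
  by (cases i; force simp: chain_time_def lam_chain_def)+

text \<open>Passing to coroots rescales each root by \<open>2 / form R a a\<close>, so the
  coefficients are the root coordinates times a quotient of norms. In particular they have the signs
  of the coordinates.\<close>

lemma coroot_coeff_eq:
  assumes "a \<in> roots R" "q \<in> idx"
  shows "coroot_coeff R a q = form R (dual q) a * form R (sr q) (sr q) / form R a a"
proof -
  define h where "h p = coroot R (sr p)" for p
  define d where "d p = 2 / form R (sr p) (sr p)" for p
  have d: "d p \<noteq> 0" if "p \<in> idx" for p
    using sroot_norm_pos[OF that] by (simp add: d_def)
  have h: "h p = d p *\<^sub>R sr p" for p
    by (simp add: h_def d_def coroot_def)
  have dh: "form R (dual q) (h p) = (if p = q then d p else 0)" if "p \<in> idx" for p q
    using that by (simp add: h form_lin dual)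
  have inj: "inj_on h idx"
    by (rule inj_onI) (metis dh d)
  have "independent (h ` idx)"
  proof
    assume "dependent (h ` idx)"
    then obtain c where c: "(\<Sum>v\<in>h ` idx. c v *\<^sub>R v) = 0" and "\<exists>v\<in>h ` idx. c v \<noteq> 0"
      by (auto simp: dependent_finite)
    then obtain q where q: "q \<in> idx" "c (h q) \<noteq> 0" by auto
    have "(\<Sum>p\<in>idx. c (h p) *\<^sub>R h p) = 0"
      using c by (simp add: sum.reindex[OF inj])
    then have "form R (dual q) (\<Sum>p\<in>idx. c (h p) *\<^sub>R h p) = 0"
      by (simp add: form_lin)
    moreover have "form R (dual q) (\<Sum>p\<in>idx. c (h p) *\<^sub>R h p) = c (h q) * d q"
      using q(1) by (simp add: form_sum_right form_lin dh if_distrib cong: if_cong)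
    ultimately show False
      using q d by simp
  qed
  then have rep: "representation (h ` idx) (\<Sum>p\<in>idx. z p *\<^sub>R h p) (h q) = z q" if "q \<in> idx" for z q
  proof -
    assume ind: "independent (h ` idx)"
    have "representation (h ` idx) (\<Sum>p\<in>idx. z p *\<^sub>R h p) = (\<lambda>b. \<Sum>p\<in>idx. representation (h ` idx) (z p *\<^sub>R h p) b)"
      by (intro representation_sum[OF ind]) (auto intro: span_scale span_base)
    moreover have "representation (h ` idx) (z p *\<^sub>R h p) (h q) = (if p = q then z q else 0)" if "p \<in> idx" for p
      using that \<open>q \<in> idx\<close> inj
      by (auto simp: representation_scale[OF ind span_base] representation_basis[OF ind] inj_on_def)
    ultimately show ?thesis
      using that by (simp cong: sum.cong)
  qed
  have "coroot R a = (\<Sum>p\<in>idx. (form R (dual p) a * form R (sr p) (sr p) / form R a a) *\<^sub>R h p)"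
  proof -
    have "coroot R a = (2 / form R a a) *\<^sub>R (\<Sum>p\<in>idx. form R (dual p) a *\<^sub>R sr p)"
      using root_expand[OF assms(1)] by (simp add: coroot_def)
    also have "\<dots> = (\<Sum>p\<in>idx. (form R (dual p) a * form R (sr p) (sr p) / form R a a) *\<^sub>R h p)"
      unfolding scaleR_sum_right
    proof (rule sum.cong)
      fix p assume "p \<in> idx"
      then show "(2 / form R a a) *\<^sub>R form R (dual p) a *\<^sub>R sr p
        = (form R (dual p) a * form R (sr p) (sr p) / form R a a) *\<^sub>R h p"
        using sroot_norm_pos[of p] by (simp add: h d_def)
    qed simp
    finally show ?thesis .
  qed
  then show ?thesis
    using rep[OF assms(2)] by (simp add: coroot_coeff_def h_def idx_def)
qed

text \<open>Equal coroot entries make one root a positive multiple \<open>t\<close> of the other,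
  and \<open>root_multiple_unit\<close> leaves \<open>t = 1\<close>; then the first entries give
  equal \<open>k\<close>.\<close>

lemma chain_vec_inj:
  assumes "i \<in> chain" "j \<in> chain" "chain_vec R lam i = chain_vec R lam j"
  shows "i = j"
proof -
  obtain a k b l where ij: "i = (a, k)" "j = (b, l)"
    by fastforce
  have a: "a \<in> roots R" "0 < pairing R lam a" "a \<in> pos_roots R"
    and b: "b \<in> roots R" "0 < pairing R lam b" "b \<in> pos_roots R"
    using assms chainD by (auto simp: ij)
  note norms = root_norm_pos[OF a(1)] root_norm_pos[OF b(1)]
  have k: "of_int k / pairing R lam a = of_int l / pairing R lam b"
    and c: "\<And>q. q \<in> idx \<Longrightarrow> coroot_coeff R a q / pairing R lam a = coroot_coeff R b q / pairing R lam b"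
    using assms(3) by (auto simp: ij chain_vec_def idx_def)
  define t where "t = (form R a a * pairing R lam a) / (form R b b * pairing R lam b)"
  have "t > 0"
    using norms a b by (simp add: t_def)
  have "form R (dual q) a = t * form R (dual q) b" if q: "q \<in> idx" for q
    using c[OF q] norms a b sroot_norm_pos[OF q]
    by (simp add: coroot_coeff_eq[OF _ q] t_def field_simps)
  then have "(\<Sum>q\<in>idx. form R (dual q) a *\<^sub>R sr q) = t *\<^sub>R (\<Sum>q\<in>idx. form R (dual q) b *\<^sub>R sr q)"
    by (simp add: scaleR_sum_right)
  then have "a = t *\<^sub>R b"
    using root_expand[OF a(1)] root_expand[OF b(1)] by simp
  then have "t = 1 \<or> t = -1"
    using root_multiple_unit[of b t] a(1) b(1) by simp
  then have "a = b"
    using \<open>t > 0\<close> \<open>a = t *\<^sub>R b\<close> by auto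
  then show ?thesis
    using k a(2) ij by simp
qed

lemma before_total: "i \<in> chain \<Longrightarrow> j \<in> chain \<Longrightarrow> i \<noteq> j \<Longrightarrow> i \<lhd> j \<or> j \<lhd> i"
  using chain_vec_inj[of i j] lexordp_linear[of "chain_vec R lam i" "chain_vec R lam j"]
  by (auto simp: chain_less_def)

lemma before_same_root: "(a, k) \<in> chain \<Longrightarrow> (a, l) \<in> chain \<Longrightarrow> (a, k) \<lhd> (a, l) \<longleftrightarrow> k < l"
  using chainD(5)[of a k] by (auto simp: chain_less_def chain_vec_def divide_less_cancel lexordp_irreflexive')

text \<open>All \<open>(a, l)\<close> with \<open>0 \<le> l < k\<close> belong to the chain as soon
  as \<open>(a, k)\<close> does, and they are exactly the earlier indices with the same
  root.\<close>

lemma init_level_eq: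
  assumes "(a, k) \<in> chain"
  shows "init_level R lam (a, k) = nat k"
proof -
  have "{j \<in> chain. j \<lhd> (a, k) \<and> fst j = fst (a, k)} = Pair a ` {0..<k}"
    using assms before_same_root chainD[OF assms]
    by (auto simp: chain_iff image_iff)
  then show ?thesis
    by (simp add: init_level_def card_image inj_on_def)
qed

subsection \<open>Enumerations of finite subsets of the chain\<close>

definition fin_chain :: "('a \<times> int) set \<Rightarrow> bool" where
  "fin_chain K \<longleftrightarrow> finite K \<and> K \<subseteq> chain"

lemma enum_eqI: "sorted_wrt (chain_less R lam) js \<Longrightarrow> set js = K \<Longrightarrow> enum K = js"
  unfolding chain_enum_def
  by (rule the_equality) (auto intro: sorted_wrt_unique[OF irreflp_before transp_before])

lemma enum:
  assumes "fin_chain K"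
  shows "sorted_wrt (chain_less R lam) (enum K)" "set (enum K) = K"
proof -
  obtain js where js: "sorted_wrt (chain_less R lam) js" "set js = K"
    using sorted_wrt_exists[OF transp_before, of K] before_total assms
    unfolding fin_chain_def by blast
  from enum_eqI[OF this] js
  show "sorted_wrt (chain_less R lam) (enum K)" "set (enum K) = K" by simp_all
qed

lemma distinct_before: "sorted_wrt (chain_less R lam) js \<Longrightarrow> distinct js"
  by (induction js) auto

lemma fin_chain_subset: "fin_chain K \<Longrightarrow> L \<subseteq> K \<Longrightarrow> fin_chain L"
  by (auto simp: fin_chain_def intro: finite_subset)

lemma fin_chain_insert: "fin_chain K \<Longrightarrow> i \<in> chain \<Longrightarrow> fin_chain (insert i K)"
  and fin_chain_empty: "fin_chain {}"
  by (auto simp: fin_chain_def)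

lemma enum_empty [simp]: "enum {} = []"
  by (rule enum_eqI) auto

lemma enum_singleton [simp]: "enum {i} = [i]"
  by (rule enum_eqI) auto

lemma enum_Un:
  assumes "fin_chain K" "fin_chain L" "\<And>i j. i \<in> K \<Longrightarrow> j \<in> L \<Longrightarrow> i \<lhd> j"
  shows "enum (K \<union> L) = enum K @ enum L"
  using enum[OF assms(1)] enum[OF assms(2)] assms(3)
  by (intro enum_eqI) (auto simp: sorted_wrt_append)

lemma enum_insert_last:
  assumes "fin_chain K" "i \<in> chain" "\<And>j. j \<in> K \<Longrightarrow> j \<lhd> i"
  shows "enum (insert i K) = enum K @ [i]"
  using enum_Un[OF assms(1), of "{i}"] assms by (simp add: fin_chain_def)

lemma enum_filter: "fin_chain K \<Longrightarrow> enum {i \<in> K. P i} = filter P (enum K)"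
  by (rule enum_eqI) (auto simp: enum sorted_wrt_filter)

text \<open>Adding the elements in increasing order makes the new reflection the rightmost factor of
  the products over \<open>K\<close>, the one applied first to a point.\<close>

lemma fin_chain_induct [consumes 1, case_names empty insert]:
  assumes "fin_chain K" "P {}"
    and "\<And>i K. fin_chain K \<Longrightarrow> i \<in> chain \<Longrightarrow> (\<And>j. j \<in> K \<Longrightarrow> j \<lhd> i) \<Longrightarrow> P K \<Longrightarrow> P (insert i K)"
  shows "P K"
proof -
  have "P (set js)" if "sorted_wrt (chain_less R lam) js" "set js \<subseteq> chain" for js
    using that
  proof (induction js rule: rev_induct)
    case (snoc i js)
    then have "P (insert i (set js))"
      by (intro assms(3)) (auto simp: sorted_wrt_append fin_chain_def)
    then show ?case by simp
  qed (simp add: assms(2))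
  from this[of "enum K"] show ?thesis
    using enum[OF assms(1)] assms(1) by (simp add: fin_chain_def)
qed

subsection \<open>Perturbed times\<close>

text \<open>The vector \<open>perturb \<epsilon>\<close> pairs to \<open>\<epsilon>\<^sup>q\<close> with the \<open>q\<close>-th simple coroot.  Moving the straight path from
  \<open>0\<close> to \<open>lam\<close> by \<open>- perturb \<epsilon>\<close> makes it cross the hyperplanes of the chain one at a time, in the
  lexicographic order when \<open>\<epsilon>\<close> is small.\<close>

definition perturb :: "real \<Rightarrow> 'a" where
  "perturb e = (SOME v. \<forall>q\<in>idx. form R v (sr q) = e ^ q * form R (sr q) (sr q) / 2)"

abbreviation shift :: "real \<Rightarrow> 'a \<Rightarrow> real" where
  "shift e a \<equiv> pairing R (perturb e) a"

text \<open>The time \<open>t\<close> at which \<open>t *\<^sub>R lam - perturb e\<close> meets the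
  hyperplane where the pairing with \<open>a\<close> equals \<open>k\<close>.\<close>

definition ptime :: "real \<Rightarrow> 'a \<times> int \<Rightarrow> real" where
  "ptime e = (\<lambda>(a, k). (of_int k + shift e a) / pairing R lam a)"

lemma shift_eq:
  assumes "a \<in> roots R"
  shows "shift e a = (\<Sum>q\<in>idx. e ^ q * coroot_coeff R a q)"
proof -
  have p: "\<forall>q\<in>idx. form R (perturb e) (sr q) = e ^ q * form R (sr q) (sr q) / 2"
    using someI_ex[OF prescribed_values[of "\<lambda>q. e ^ q * form R (sr q) (sr q) / 2"]]
    unfolding perturb_def .
  have "form R (perturb e) a = (\<Sum>q\<in>idx. form R (dual q) a * (e ^ q * form R (sr q) (sr q) / 2))"
    by (subst root_expand[OF assms]) (simp add: form_sum_right form_lin p)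
  then show ?thesis
    using assms by (simp add: pairing_form coroot_coeff_eq sum_divide_distrib sum_distrib_left field_simps)
qed

text \<open>Simple roots are numbered from 1, so the powers \<open>e ^ q\<close> leave the constant
  term free for \<open>k\<close>, which is the head of \<open>chain_vec\<close>.\<close>

lemma ptime_eq_horner_sum:
  assumes "i \<in> chain"
  shows "ptime e i = horner_sum (\<lambda>x. x) e (chain_vec R lam i)"
proof -
  obtain a k where i: "i = (a, k)" by fastforce
  define f where "f q = coroot_coeff R a q / pairing R lam a" for q
  have "chain_vec R lam i = of_int k / pairing R lam a # map f [1..<nsimple R + 1]"
    by (simp add: i chain_vec_def f_def)
  then have "horner_sum (\<lambda>x. x) e (chain_vec R lam i)
      = of_int k / pairing R lam a + e * (\<Sum>n<nsimple R. f (Suc n) * e ^ n)"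
    by (simp del: upt_Suc) (simp add: horner_sum_eq_sum lessThan_atLeast0 del: upt_Suc)
  also have "e * (\<Sum>n<nsimple R. f (Suc n) * e ^ n) = (\<Sum>n<nsimple R. e ^ Suc n * f (Suc n))"
    by (simp add: sum_distrib_left algebra_simps)
  also have "\<dots> = (\<Sum>q\<in>idx. e ^ q * f q)"
    unfolding idx_def by (rule sum.reindex_bij_witness[of _ "\<lambda>q. q - 1" Suc]) auto
  also have "\<dots> = shift e a / pairing R lam a"
    using chainD(2)[of a k] assms i by (simp add: shift_eq f_def sum_divide_distrib)
  finally show ?thesis
    by (simp add: i ptime_def add_divide_distrib)
qed

lemma shift_pos:
  assumes "a \<in> pos_roots R" "e > 0"
  shows "shift e a > 0"
proof -
  have a: "a \<in> roots R" "nonneg a"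
    using assms(1) by (auto simp: pos_roots_iff)
  have nn: "0 \<le> coroot_coeff R a q" if "q \<in> idx" for q
    using nonneg_coord[OF a(2) that] root_norm_pos[OF a(1)] sroot_norm_pos[OF that]
    by (simp add: coroot_coeff_eq[OF a(1) that])
  obtain q where q: "q \<in> idx" "form R (dual q) a \<noteq> 0"
    using root_expand[OF a(1)] root_nonzero[OF a(1)] by (metis (no_types, lifting) scaleR_zero_left sum.neutral)
  then have "0 < coroot_coeff R a q"
    using nonneg_coord[OF a(2) q(1)] root_norm_pos[OF a(1)] sroot_norm_pos[OF q(1)]
    by (simp add: coroot_coeff_eq[OF a(1)])
  then show ?thesis
    unfolding shift_eq[OF a(1)] using q(1) nn assms(2)
    by (intro sum_pos2[of _ q]) auto
qed

lemma shift_tendsto: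
  assumes "a \<in> roots R"
  shows "((\<lambda>e. shift e a) \<longlongrightarrow> 0) (at_right 0)"
proof -
  have "((\<lambda>e. \<Sum>q\<in>idx. e ^ q * coroot_coeff R a q) \<longlongrightarrow> (\<Sum>q\<in>idx. 0 ^ q * coroot_coeff R a q)) (at_right 0)"
    by (intro tendsto_intros)
  moreover have "(\<Sum>q\<in>idx. 0 ^ q * coroot_coeff R a q) = 0"
    by (intro sum.neutral) (auto simp: idx_def)
  ultimately show ?thesis
    by (simp add: shift_eq[OF assms])
qed

lemma ptime_tendsto: "i \<in> chain \<Longrightarrow> ((\<lambda>e. ptime e i) \<longlongrightarrow> time i) (at_right 0)"
proof (cases i)
  case (Pair a k)
  assume "i \<in> chain"
  then have "a \<in> roots R" "pairing R lam a \<noteq> 0"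
    using chainD[of a k] Pair by auto
  then show ?thesis
    unfolding Pair ptime_def chain_time_def prod.case
    by (auto intro!: tendsto_eq_intros shift_tendsto)
qed

text \<open>Relative to a set \<open>X\<close> because each pair of indices imposes its own bound on
  \<open>e\<close>, and only finitely many bounds can be met together in general.\<close>

definition small :: "('a \<times> int) set \<Rightarrow> real \<Rightarrow> bool" where
  "small X e \<longleftrightarrow> e > 0 \<and> (\<forall>i\<in>X. \<forall>j\<in>X. i \<lhd> j \<longrightarrow> ptime e i < ptime e j)"

lemma eventually_small:
  assumes "fin_chain X"
  shows "eventually (small X) (at_right 0)"
proof -
  have "eventually (\<lambda>e. i \<lhd> j \<longrightarrow> ptime e i < ptime e j) (at_right 0)" if "i \<in> X" "j \<in> X" for i j
  proof (cases "i \<lhd> j")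
    case True
    have "i \<in> chain" "j \<in> chain"
      using that assms by (auto simp: fin_chain_def)
    moreover have "length (chain_vec R lam i) = length (chain_vec R lam j)"
      by (cases i; cases j) (simp add: chain_vec_def)
    ultimately show ?thesis
      using lexordp_eventually_horner_sum[of "chain_vec R lam i" "chain_vec R lam j"] True
      by (simp add: chain_less_def ptime_eq_horner_sum)
  qed simp
  then have "eventually (\<lambda>e. \<forall>i\<in>X. \<forall>j\<in>X. i \<lhd> j \<longrightarrow> ptime e i < ptime e j) (at_right 0)"
    using assms by (auto simp: fin_chain_def eventually_ball_finite_distrib)
  moreover have "eventually (\<lambda>e. 0 < e) (at_right (0 :: real))"
    by (rule eventually_at_right_less)
  ultimately show ?thesis
    by eventually_elim (simp add: small_def)
qed

end

text \<open>Bookkeeping for a walk on the integers: \<open>S n\<close> is the ceiling of its height and \<open>sg n\<close> says whether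
  it is ascending just before time \<open>n\<close>; it meets an integer level at the times in \<open>hit\<close>, and is
  reflected there at the times in \<open>turn\<close>.  It turns downwards only at integer levels.\<close>

locale level_walk =
  fixes L :: nat and sg hit turn :: "nat \<Rightarrow> bool" and S :: "nat \<Rightarrow> int"
  assumes S_0: "S 0 = 0"
    and sg_0: "sg 0"
    and S_Suc: "n < L \<Longrightarrow> S (Suc n) = S n + (if hit n \<and> \<not> turn n then (if sg n then 1 else - 1) else 0)"
    and sg_hit: "n < L \<Longrightarrow> hit n \<Longrightarrow> sg (Suc n) \<longleftrightarrow> (if turn n then \<not> sg n else sg n)"
    and sg_nohit: "n < L \<Longrightarrow> \<not> hit n \<Longrightarrow> sg n \<Longrightarrow> sg (Suc n)"
begin

text \<open>The integer at which a hit at time \<open>n\<close> takes place: the upper end of the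
  unit interval for an ascending walk, the lower end for a descending one.\<close>

definition Lv :: "nat \<Rightarrow> int" where
  "Lv n = S n + (if sg n then 0 else - 1)"

text \<open>The final time is included because the pairing of the weight, which becomes
  \<open>Lv L\<close>, competes in the maximum of the levels.\<close>

definition stops :: "nat set" where
  "stops = {n. n < L \<and> hit n} \<union> {L}"

definition peak :: int where
  "peak = Max (Lv ` stops)"

lemma finite_stops: "finite stops"
  by (simp add: stops_def)

lemma Lv_le_peak: "n \<in> stops \<Longrightarrow> Lv n \<le> peak"
  unfolding peak_def using finite_stops by simp

text \<open>Without a hit an ascending walk keeps ascending within the same unit interval, so the
  next stop lies at its upper end.\<close>

lemma ascending_next_stop:
  assumes "n \<le> k" "k \<in> stops" "sg n"
  shows "\<exists>m\<in>stops. m \<le> k \<and> Lv m = S n"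
  using assms
proof (induction n rule: inc_induct)
  case base
  then show ?case by (auto simp: Lv_def)
next
  case (step n)
  have "n < L"
    using step.hyps assms(2) by (auto simp: stops_def)
  show ?case
  proof (cases "hit n")
    case True
    then show ?thesis
      using \<open>n < L\<close> step by (intro bexI[of _ n]) (auto simp: Lv_def stops_def)
  next
    case False
    then show ?thesis
      using step S_Suc[OF \<open>n < L\<close>] sg_nohit[OF \<open>n < L\<close>] by auto
  qed
qed

text \<open>Going back in time, a descending walk was descending already unless there was a hit;
  since the walk starts ascending, a last hit exists. Whether it was a turn or a downward crossing,
  it took place at the upper end of the present unit interval.\<close>

lemma descending_previous_stop:
  assumes "n \<le> L" "\<not> sg n"
  shows "\<exists>m\<in>stops. m < n \<and> Lv m = S n"
  using assms
proof (induction n)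
  case 0
  then show ?case using sg_0 by simp
next
  case (Suc n)
  then have n: "n < L" by simp
  show ?case
  proof (cases "hit n")
    case True
    then show ?thesis
      using n Suc.prems S_Suc[OF n] sg_hit[OF n]
      by (intro bexI[of _ n]) (auto simp: Lv_def stops_def split: if_splits)
  next
    case False
    then have "\<not> sg n" "S (Suc n) = S n"
      using Suc.prems sg_nohit[OF n] S_Suc[OF n] by auto
    then show ?thesis
      using Suc.IH n by (metis less_SucI less_imp_le)
  qed
qed

lemma S_le_peak:
  assumes "n \<le> L"
  shows "S n \<le> peak"
proof (cases "sg n")
  case True
  have "L \<in> stops" by (simp add: stops_def)
  from ascending_next_stop[OF assms this True] show ?thesis
    using Lv_le_peak by metis
next
  case False
  from descending_previous_stop[OF assms False] show ?thesis
    using Lv_le_peak by metis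
qed

lemma peak_attained: "\<exists>n\<in>stops. Lv n = peak"
proof -
  have "peak \<in> Lv ` stops"
    unfolding peak_def using finite_stops by (intro Max_in) (auto simp: stops_def)
  then show ?thesis by auto
qed

lemma S_no_stop:
  assumes "a \<le> b" "b \<le> L" "\<And>n. a \<le> n \<Longrightarrow> n < b \<Longrightarrow> \<not> hit n"
  shows "S a = S b"
  using assms(1)
proof (induction rule: inc_induct)
  case (step n)
  then show ?case
    using S_Suc[of n] assms(2,3) by simp
qed simp

text \<open>\<open>m\<close> is the first stop at the level \<open>peak\<close> and \<open>k\<close>
  the last hit before it, which exists because the walk starts at
  \<open>S 0 = 0 < peak\<close>.\<close>

lemma ascent_to_top:
  assumes "peak > 0"
  obtains k m where
    "m \<in> stops" "Lv m = peak" "\<And>n. n \<in> stops \<Longrightarrow> n < m \<Longrightarrow> Lv n < peak"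
    "k < m" "hit k" "Lv k = peak - 1" "\<And>n. k < n \<Longrightarrow> n < m \<Longrightarrow> \<not> hit n"
    "\<And>n. k < n \<Longrightarrow> n \<le> m \<Longrightarrow> S n = peak \<and> sg n"
    "\<And>n. n \<le> k \<Longrightarrow> S n \<le> peak - 1"
proof -
  define m where "m = (LEAST n. n \<in> stops \<and> Lv n = peak)"
  have m: "m \<in> stops" "Lv m = peak"
    using LeastI_ex[of "\<lambda>n. n \<in> stops \<and> Lv n = peak"] peak_attained unfolding m_def by auto
  have first: "Lv n < peak" if "n \<in> stops" "n < m" for n
    using not_less_Least[of n "\<lambda>n. n \<in> stops \<and> Lv n = peak"] that Lv_le_peak[OF that(1)]
    unfolding m_def by fastforce
  have mL: "m \<le> L"
    using m(1) by (auto simp: stops_def)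
  \<comment> \<open>A descending arrival would mean \<open>S m = peak + 1\<close>, and then some
    stop would have that level.\<close>
  have Sm: "sg m"
  proof (rule ccontr)
    assume "\<not> sg m"
    from descending_previous_stop[OF mL this] obtain i where "i \<in> stops" "Lv i = S m" by auto
    then show False
      using m(2) \<open>\<not> sg m\<close> Lv_le_peak[of i] by (simp add: Lv_def)
  qed
  then have Sm': "S m = peak"
    using m(2) by (simp add: Lv_def)
  have "\<exists>n<m. hit n"
    using S_no_stop[of 0 m] mL S_0 Sm' assms by auto
  then have ne: "{n. n < m \<and> hit n} \<noteq> {}" by auto
  define k where "k = Max {n. n < m \<and> hit n}"
  have k: "k < m" "hit k"
    using Max_in[OF _ ne] unfolding k_def by auto
  have gap: "\<not> hit n" if "k < n" "n < m" for n
  proof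
    assume "hit n"
    then have "n \<le> k"
      unfolding k_def using that(2) by (intro Max_ge) auto
    then show False using that(1) by simp
  qed
  have kL: "k < L"
    using k mL by simp
  then have ks: "k \<in> stops"
    using k by (simp add: stops_def)
  have between: "S n = peak \<and> sg n" if n: "k < n" "n \<le> m" for n
  proof -
    have S: "S n = peak"
      using S_no_stop[of n m] n mL gap Sm' by simp
    moreover have "sg n"
    proof (rule ccontr)
      assume "\<not> sg n"
      then obtain i where "i \<in> stops" "i < n" "Lv i = S n"
        using descending_previous_stop[of n] n(2) mL by (meson order_trans)
      then show False
        using first[of i] S n by auto
    qed
    ultimately show ?thesis by simp
  qed
  \<comment> \<open>The walk leaves \<open>k\<close> upwards below \<open>peak\<close>. If it
    crosses, it was ascending with \<open>S k = peak - 1\<close>; if it turns, it was descending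
    with \<open>S k = peak\<close>. Both give the same level.\<close>
  have Lvk: "Lv k = peak - 1"
    using between[of "Suc k"] k S_Suc[OF kL] sg_hit[OF kL]
    by (auto simp: Lv_def split: if_splits)
  have before: "S n \<le> peak - 1" if n: "n \<le> k" for n
  proof (cases "sg n")
    case True
    then obtain i where "i \<in> stops" "i \<le> k" "Lv i = S n"
      using ascending_next_stop[OF n ks] by blast
    then show ?thesis
      using first[of i] k by auto
  next
    case False
    then obtain i where "i \<in> stops" "i < n" "Lv i = S n"
      using descending_previous_stop[of n] n kL by (meson order_trans less_imp_le)
    then show ?thesis
      using first[of i] k n by auto
  qed
  show ?thesis
    by (rule that[of m k]) (use m first k Lvk gap between before in auto)
qed

end

section \<open>Linear and affine products over finite subsets of the chain\<close>

context km_weight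
begin

lemma refl_prod_simps [simp]:
  "refl_prod R [] = id" "refl_prod R (j # js) = reflection R (fst j) \<circ> refl_prod R js"
  "refl_prod R (is @ js) = refl_prod R is \<circ> refl_prod R js"
proof -
  show "refl_prod R (is @ js) = refl_prod R is \<circ> refl_prod R js"
    by (induction "is") (auto simp: refl_prod_def)
qed (auto simp: refl_prod_def)

abbreviation RP :: "('a \<times> int) set \<Rightarrow> 'a \<Rightarrow> 'a" where
  "RP K \<equiv> refl_prod R (enum K)"

text \<open>The second component replaces the count \<open>init_level\<close> of the weight; the two
  agree on the chain.\<close>

definition AP :: "('a \<times> int) set \<Rightarrow> 'a \<Rightarrow> 'a" where
  "AP K = foldr (\<lambda>j. affine_reflection R (fst j) (snd j)) (enum K)"

lemma chain_root: "i \<in> chain \<Longrightarrow> fst i \<in> roots R"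
  and chain_pos_root: "i \<in> chain \<Longrightarrow> fst i \<in> pos_roots R"
  using chainD(1,2)[of "fst i" "snd i"] by auto

lemma chain_refl_weyl: "i \<in> chain \<Longrightarrow> reflection R (fst i) \<in> weyl R"
  using reflection_in_weyl[OF km chain_root] .

lemma chain_refl_invol: "i \<in> chain \<Longrightarrow> reflection R (fst i) (reflection R (fst i) v) = v"
  using root_norm_pos[OF chain_root, of i] by (simp add: reflection_invol)

lemma RP_weyl:
  assumes "fin_chain K"
  shows "RP K \<in> weyl R"
proof -
  have "refl_prod R js \<in> weyl R" if "set js \<subseteq> chain" for js
    using that by (induction js) (auto intro: weyl_id weyl_comp chain_refl_weyl simp del: comp_apply simp flip: id_def)
  then show ?thesis
    using enum(2)[OF assms] assms by (simp add: fin_chain_def)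
qed

lemma RP_Un:
  "fin_chain K \<Longrightarrow> fin_chain L \<Longrightarrow> (\<And>i j. i \<in> K \<Longrightarrow> j \<in> L \<Longrightarrow> i \<lhd> j) \<Longrightarrow> RP (K \<union> L) = RP K \<circ> RP L"
  by (simp add: enum_Un)

lemma RP_insert_last:
  "fin_chain K \<Longrightarrow> i \<in> chain \<Longrightarrow> (\<And>j. j \<in> K \<Longrightarrow> j \<lhd> i) \<Longrightarrow> RP (insert i K) = RP K \<circ> reflection R (fst i)"
  by (simp add: enum_insert_last)

lemma AP_insert_last:
  "fin_chain K \<Longrightarrow> i \<in> chain \<Longrightarrow> (\<And>j. j \<in> K \<Longrightarrow> j \<lhd> i) \<Longrightarrow>
    AP (insert i K) x = AP K (affine_reflection R (fst i) (snd i) x)"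
  by (simp add: enum_insert_last AP_def)

lemma AP_empty [simp]: "AP {} x = x"
  by (simp add: AP_def)

lemma affine_reflection_fixed: "pairing R x a = of_int k \<Longrightarrow> affine_reflection R a k x = x"
  by (simp add: affine_reflection_def reflection_def)

text \<open>The translation part is a sum of integral multiples of roots, moved by the Weyl group,
  so it stays in the weight lattice. This makes the constant term of a height integral.\<close>

lemma AP_affine:
  assumes "fin_chain K"
  shows "AP K x = RP K x + AP K 0 \<and> AP K 0 \<in> weight_lattice R"
  using assms
proof (induction arbitrary: x rule: fin_chain_induct)
  case empty
  then show ?case by (simp add: weight_lattice_def pairing_lin)
next
  case (insert i K)
  have w: "RP K \<in> weyl R"
    by (rule RP_weyl[OF insert(1)])
  have aff: "affine_reflection R (fst i) (snd i) y = reflection R (fst i) y + of_int (snd i) *\<^sub>R fst i" for y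
    by (simp add: affine_reflection_def)
  have ins: "AP (insert i K) y = RP (insert i K) y + (RP K (of_int (snd i) *\<^sub>R fst i) + AP K 0)" for y
    using insert(4)[of "affine_reflection R (fst i) (snd i) y"]
    by (simp add: AP_insert_last[OF insert(1-3)] RP_insert_last[OF insert(1-3)] aff weyl_add[OF w])
  have 0: "AP (insert i K) 0 = RP K (of_int (snd i) *\<^sub>R fst i) + AP K 0"
    using ins[of 0] weyl_scaleR[OF RP_weyl[OF fin_chain_insert[OF insert(1,2)]], of 0 0] by simp
  have "of_int (snd i) *\<^sub>R fst i \<in> weight_lattice R"
    by (intro weight_lattice_scale root_weight chain_root insert) simp
  then have "AP (insert i K) 0 \<in> weight_lattice R"
    unfolding 0 by (intro weight_lattice_add weyl_weight_lattice[OF w] conjunct2[OF insert(4)])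
  with ins[of x] 0 show ?case by simp
qed

lemma weight_eq:
  assumes "fin_chain K"
  shows "weight R lam K = AP K lam"
proof -
  have "foldr (\<lambda>j. affine_reflection R (fst j) (int (init_level R lam j))) js x
      = foldr (\<lambda>j. affine_reflection R (fst j) (snd j)) js x" if "set js \<subseteq> chain" for js x
    using that
  proof (induction js)
    case (Cons j js)
    then have "int (init_level R lam j) = snd j"
      using init_level_eq[of "fst j" "snd j"] chainD(3)[of "fst j" "snd j"] by simp
    with Cons show ?case by simp
  qed simp
  then show ?thesis
    using enum(2)[OF assms] assms by (simp add: weight_def AP_def fin_chain_def)
qed

subsection \<open>Foldings\<close>

text \<open>\<open>foldr\<close> performs the last fold first. When the fold at \<open>j\<close> is
  performed, the root there is still \<open>fst j\<close>, so all later roots are changed by the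
  original reflection of \<open>j\<close>; this gives a product of unfolded reflections.\<close>

lemma folding_eq:
  assumes "sorted_wrt (chain_less R lam) js" "set js \<subseteq> chain" "i \<in> chain"
  shows "fst (foldr (fold_at R lam) js (empty_folding rho)) i
    = (refl_prod R (filter (\<lambda>j. j \<lhd> i) js) (fst i), if i \<in> set js then - 1 else 1)"
  using assms
proof (induction js arbitrary: i)
  case Nil
  then show ?case by (simp add: empty_folding_def)
next
  case (Cons j js)
  define G where "G = fst (foldr (fold_at R lam) js (empty_folding rho))"
  have IH: "G i = (refl_prod R (filter (\<lambda>j. j \<lhd> i) js) (fst i), if i \<in> set js then - 1 else 1)"
    if "i \<in> chain" for i
    unfolding G_def using Cons that by simp
  have j: "j \<in> chain" "\<And>k. k \<in> set js \<Longrightarrow> j \<lhd> k"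
    using Cons.prems by auto
  have none: "filter (\<lambda>k. k \<lhd> i) js = []" if "i = j \<or> i \<lhd> j" for i
    using that j(2) by (auto simp: filter_empty_conv dest: before_asym before_trans)
  have fold: "fst (foldr (fold_at R lam) (j # js) (empty_folding rho)) i
     = (if i = j then (fst (G j), - snd (G j)) else if i \<lhd> j then G i
        else (reflection R (fst (G j)) (fst (G i)), snd (G i)))"
    by (simp add: fold_at_def G_def split_beta)
  have Gj: "G j = (fst j, 1)"
  proof -
    have "j \<notin> set js"
      using j(2) before_irrefl by blast
    then show ?thesis
      using IH[OF j(1)] none[of j] by simp
  qed
  consider "i = j" | "i \<lhd> j" "i \<noteq> j" | "j \<lhd> i" "i \<noteq> j"
    using before_total[OF Cons.prems(3) j(1)] by blast
  then show ?case
  proof cases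
    case 1
    then show ?thesis
      using Gj none[of i] unfolding fold by simp
  next
    case 2
    then have "i \<notin> set js"
      using j(2) before_asym by blast
    then show ?thesis
      using 2 IH[OF Cons.prems(3)] none[of i] before_asym[of i j] unfolding fold by simp
  next
    case 3
    then show ?thesis
      using IH[OF Cons.prems(3)] Gj before_asym[of j i] unfolding fold by simp
  qed
qed

lemma fold_root_eq:
  assumes "fin_chain K" "i \<in> chain"
  shows "fold_root R lam rho K i = RP {j \<in> K. j \<lhd> i} (fst i)"
    and "fold_sign R lam rho K i = (if i \<in> K then - 1 else 1)"
  using folding_eq[of "enum K" i rho] enum[OF assms(1)] assms
  by (auto simp: fold_root_def fold_sign_def folding_def fin_chain_def enum_filter)

text \<open>Inserting or deleting the factor of \<open>i\<close> behind the product over the earlier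
  indices is left multiplication by its conjugate under that product, which is the reflection in the
  folded root at \<open>i\<close>.\<close>

lemma RP_toggle:
  assumes K: "fin_chain K" and i: "i \<in> chain"
  shows "RP (sym_diff K {i}) = reflection R (RP {j \<in> K. j \<lhd> i} (fst i)) \<circ> RP K"
proof -
  define A B where "A = {j \<in> K. j \<lhd> i}" and "B = {j \<in> K. i \<lhd> j}"
  have AB: "fin_chain A" "fin_chain B"
    using fin_chain_subset[OF K] by (auto simp: A_def B_def)
  have iB: "fin_chain (insert i B)" "fin_chain {i}"
    using AB i fin_chain_insert fin_chain_empty by blast+
  have sub: "K \<subseteq> chain"
    using K by (simp add: fin_chain_def)
  have without: "RP (A \<union> B) = RP A \<circ> RP B"
    by (rule RP_Un[OF AB]) (auto simp: A_def B_def intro: before_trans)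
  have "RP ({i} \<union> B) = RP {i} \<circ> RP B"
    by (rule RP_Un[OF iB(2) AB(2)]) (auto simp: B_def)
  moreover have "RP (A \<union> insert i B) = RP A \<circ> RP (insert i B)"
    by (rule RP_Un[OF AB(1) iB(1)]) (auto simp: A_def B_def intro: before_trans)
  ultimately have "with": "RP (A \<union> insert i B) = RP A \<circ> reflection R (fst i) \<circ> RP B"
    by (simp add: comp_assoc)
  have A: "reflection R (RP A (fst i)) (RP A v) = RP A (reflection R (fst i) v)" for v
    by (rule weyl_reflection[OF RP_weyl[OF AB(1)], symmetric])
  show ?thesis
  proof (cases "i \<in> K")
    case True
    then have K': "K = A \<union> insert i B" "sym_diff K {i} = A \<union> B"
      using before_total[OF _ i] sub by (auto simp: A_def B_def)
    have "reflection R (RP A (fst i)) (RP K v) = RP (sym_diff K {i}) v" for v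
      unfolding K'(2) without by (subst K'(1)) (simp only: "with" comp_apply A chain_refl_invol[OF i])
    then show ?thesis
      by (simp add: fun_eq_iff A_def)
  next
    case False
    then have K': "K = A \<union> B" "sym_diff K {i} = A \<union> insert i B"
      using before_total[OF _ i] sub by (auto simp: A_def B_def)
    have "reflection R (RP A (fst i)) (RP K v) = RP (sym_diff K {i}) v" for v
      unfolding K'(2) "with" by (subst K'(1)) (simp only: without comp_apply A)
    then show ?thesis
      by (simp add: fun_eq_iff A_def)
  qed
qed

end

subsection \<open>The direction of a simple root along the folded path\<close>

locale km_crystal = km_weight +
  fixes p :: nat
  assumes p: "p \<in> idx"
begin

definition eta :: "('a \<times> int) set \<Rightarrow> 'a" where
  "eta K = inv (RP K) (sr p)"

lemma RP_bij:
  assumes "fin_chain K"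
  shows "bij (RP K)"
  using weyl_inverse[OF RP_weyl[OF assms]] o_bij by blast

lemma RP_eta: "fin_chain K \<Longrightarrow> RP K (eta K) = sr p"
  unfolding eta_def using RP_bij by (simp add: bij_is_surj surj_f_inv_f)

lemma eta_eqI: "fin_chain K \<Longrightarrow> RP K v = sr p \<Longrightarrow> v = eta K"
  unfolding eta_def using RP_bij by (metis bij_inv_eq_iff)

lemma RP_eq_iff:
  assumes "fin_chain K"
  shows "RP K v = sr p \<longleftrightarrow> v = eta K" "RP K v = - sr p \<longleftrightarrow> v = - eta K"
proof -
  have eta: "RP K u = sr p \<longleftrightarrow> u = eta K" for u
    using RP_eta[OF assms] eta_eqI[OF assms] by blast
  show "RP K v = sr p \<longleftrightarrow> v = eta K"
    by (rule eta)
  have "RP K v = - sr p \<longleftrightarrow> RP K (- v) = sr p"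
    unfolding weyl_minus[OF RP_weyl[OF assms]] by (metis minus_minus)
  also have "\<dots> \<longleftrightarrow> - v = eta K"
    by (rule eta)
  finally show "RP K v = - sr p \<longleftrightarrow> v = - eta K"
    by (metis minus_minus)
qed

lemma eta_root:
  assumes "fin_chain K"
  shows "eta K \<in> roots R"
proof -
  obtain w' where w': "w' \<in> weyl R" "w' \<circ> RP K = id"
    using weyl_inverse[OF RP_weyl[OF assms]] by blast
  have "w' (sr p) = eta K"
    using w'(2) RP_eta[OF assms] by (metis comp_apply id_apply)
  then show ?thesis
    using weyl_root[OF w'(1) sroot_root[OF p]] by simp
qed

lemma eta_empty: "eta {} = sr p"
  by (simp add: eta_def)

lemma eta_insert_last:
  assumes "fin_chain K" "i \<in> chain" "\<And>j. j \<in> K \<Longrightarrow> j \<lhd> i"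
  shows "eta (insert i K) = reflection R (fst i) (eta K)"
  using RP_eta[OF assms(1)] chain_refl_invol[OF assms(2)]
  by (intro eta_eqI[symmetric] fin_chain_insert assms) (simp add: RP_insert_last[OF assms])

definition height :: "('a \<times> int) set \<Rightarrow> 'a \<Rightarrow> real" where
  "height K x = pairing R (AP K x) (sr p)"

definition offset :: "('a \<times> int) set \<Rightarrow> real" where
  "offset K = height K 0"

lemma height_eq:
  assumes "fin_chain K"
  shows "height K x = pairing R x (eta K) + offset K" "offset K \<in> \<int>"
proof -
  have "pairing R (RP K x) (sr p) = pairing R x (eta K)"
    using weyl_pairing[OF RP_weyl[OF assms], of x "eta K"] by (simp add: RP_eta[OF assms])
  then show "height K x = pairing R x (eta K) + offset K"
    unfolding height_def offset_def by (subst conjunct1[OF AP_affine[OF assms]]) (simp add: pairing_lin)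
  show "offset K \<in> \<int>"
    using conjunct2[OF AP_affine[OF assms]] p by (simp add: height_def offset_def weight_lattice_alt)
qed

text \<open>The new fold is an affine reflection in a hyperplane through \<open>x\<close>, so the
  height does not jump when the path is folded there.\<close>

lemma height_insert_last:
  assumes "fin_chain K" "i \<in> chain" "\<And>j. j \<in> K \<Longrightarrow> j \<lhd> i" "pairing R x (fst i) = of_int (snd i)"
  shows "height (insert i K) x = height K x"
  using affine_reflection_fixed[OF assms(4)] by (simp add: height_def AP_insert_last[OF assms(1-3)])

end

text \<open>In the limit a bound stays strict on the side from which the function moves away; the
  midpoint witnesses it.\<close>

lemma affine_endpoint:
  fixes a b c d l u :: real
  assumes "a < b" and le: "\<And>x. a < x \<Longrightarrow> x < b \<Longrightarrow> l < c * x + d \<and> c * x + d < u"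
  shows "l \<le> c * b + d" "c * b + d \<le> u" "c > 0 \<Longrightarrow> l < c * b + d" "c < 0 \<Longrightarrow> c * b + d < u"
proof -
  have lim: "((\<lambda>x. c * x + d) \<longlongrightarrow> c * b + d) (at_left b)"
    by (intro tendsto_intros)
  have ev: "eventually (\<lambda>x. a < x \<and> x < b) (at_left b)"
    using assms(1) eventually_at_left_real by fastforce
  show "l \<le> c * b + d"
    by (rule tendsto_lowerbound[OF lim]) (use ev le in \<open>auto elim!: eventually_mono intro: less_imp_le\<close>)
  show "c * b + d \<le> u"
    by (rule tendsto_upperbound[OF lim]) (use ev le in \<open>auto elim!: eventually_mono intro: less_imp_le\<close>)
  define x where "x = (a + b) / 2"
  have x: "a < x" "x < b"
    using assms(1) by (auto simp: x_def)
  show "l < c * b + d" if "c > 0"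
    using le[OF x] mult_strict_left_mono[OF x(2) that] by linarith
  show "c * b + d < u" if "c < 0"
    using le[OF x] mult_strict_left_mono_neg[OF x(2) that] by linarith
qed

text \<open>Leaving the unit interval would require an integral value on the way, and
  \<open>reach\<close> solves for the place. The alternatives in \<open>start\<close> admit an
  integral initial value when the slope points inwards, as after a hit.\<close>

lemma affine_between_integers:
  fixes a b c d :: real and s :: int
  assumes noint: "\<And>x. a < x \<Longrightarrow> x < b \<Longrightarrow> c * x + d \<notin> \<int>"
    and start: "of_int s - 1 < c * a + d \<and> c * a + d < of_int s \<or> c * a + d = of_int s \<and> c < 0
      \<or> c * a + d = of_int s - 1 \<and> c > 0"
    and x: "a < x" "x < b"
  shows "of_int s - 1 < c * x + d \<and> c * x + d < of_int s"
proof -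
  have reach: "\<exists>y. a < y \<and> y \<le> x \<and> c * y + d = v"
    if "c * a + d < v \<and> v \<le> c * x + d \<or> c * x + d \<le> v \<and> v < c * a + d" for v
  proof -
    have "c \<noteq> 0" using that by auto
    define y where "y = (v - d) / c"
    have y: "c * y + d = v"
      using \<open>c \<noteq> 0\<close> by (simp add: y_def)
    have "a < y \<and> y \<le> x"
    proof (cases "c > 0")
      case True
      with that x have "c * a < c * y" "c * y \<le> c * x"
        using y mult_strict_left_mono[OF x(1) True] by linarith+
      then show ?thesis using True by simp
    next
      case False
      then have c: "c < 0" using \<open>c \<noteq> 0\<close> by simp
      with that x have "c * y < c * a" "c * x \<le> c * y"
        using y mult_strict_left_mono_neg[OF x(1) c] by linarith+
      then show ?thesis using c by simp
    qed
    with y show ?thesis by blast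
  qed
  have avoid: "\<not> (c * a + d < of_int k \<and> of_int k \<le> c * x + d \<or> c * x + d \<le> of_int k \<and> of_int k < c * a + d)" for k
    using reach[of "of_int k"] noint x by fastforce
  have "c * x + d \<noteq> of_int s" "c * x + d \<noteq> of_int (s - 1)"
    using noint[OF x] by (metis Ints_of_int)+
  moreover have "c * a < c * x" if "c > 0"
    using mult_strict_left_mono[OF x(1) that] .
  moreover have "c * x < c * a" if "c < 0"
    using mult_strict_left_mono_neg[OF x(1) that] .
  ultimately show ?thesis
    using start avoid[of s] avoid[of "s - 1"] unfolding of_int_diff of_int_1 by smt
qed

section \<open>The walls followed for one admissible subset\<close>

locale km_walk = km_crystal +
  fixes J :: "('a \<times> int) set"
  assumes adm: "admissible R lam J"
begin

lemma J: "fin_chain J"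
  using adm by (simp add: admissible_def fin_chain_def)

lemma J_chain: "j \<in> J \<Longrightarrow> j \<in> chain"
  using J by (auto simp: fin_chain_def)

lemma J_subset: "K \<subseteq> J \<Longrightarrow> fin_chain K"
  using fin_chain_subset[OF J] .

lemma J_cover:
  assumes "j \<in> J"
  shows "len (RP {i \<in> J. i \<lhd> j} \<circ> reflection R (fst j)) = len (RP {i \<in> J. i \<lhd> j}) + 1"
proof -
  obtain h where h: "h < length (enum J)" "enum J ! h = j"
    using assms enum(2)[OF J] by (metis in_set_conv_nth)
  have s: "sorted_wrt (chain_less R lam) (enum J)"
    using enum(1)[OF J] .
  define A B where "A = take h (enum J)" and "B = drop (Suc h) (enum J)"
  have AB: "enum J = A @ j # B"
    unfolding A_def B_def using h id_take_nth_drop by metis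
  have "\<forall>x\<in>set A. x \<lhd> j" "\<forall>x\<in>set B. j \<lhd> x"
    using s by (simp_all add: AB sorted_wrt_append)
  moreover have "J = insert j (set A \<union> set B)"
    using enum(2)[OF J] by (simp add: AB)
  ultimately have "set A = {i \<in> J. i \<lhd> j}"
    using before_asym before_irrefl by blast
  then have "set (take h (enum J)) = {i \<in> J. i \<lhd> j}"
    by (simp add: A_def)
  then have *: "enum {i \<in> J. i \<lhd> j} = take h (enum J)"
    using s by (intro enum_eqI sorted_wrt_take) auto
  have "bruhat_cover R (refl_prod R (take h (enum J))) (refl_prod R (take (h + 1) (enum J)))"
    using adm h(1) by (simp add: admissible_def Let_def)
  moreover have "refl_prod R (take (h + 1) (enum J)) = refl_prod R (take h (enum J)) \<circ> reflection R (fst j)"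
    using h by (simp add: take_Suc_conv_app_nth)
  ultimately show ?thesis
    unfolding * by (auto simp: bruhat_cover_def)
qed

text \<open>All subsets \<open>K\<close> are taken, not only the initial parts of \<open>J\<close>
  that occur: the cuts \<open>cut n\<close> are indexed through the enumeration of the walls, which
  depends on this set.\<close>

definition wall_roots :: "'a set" where
  "wall_roots = {b \<in> pos_roots R. b \<in> fst ` J \<or> (\<exists>K\<subseteq>J. b = eta K \<or> b = - eta K)}"

definition walls :: "('a \<times> int) set" where
  "walls = {i \<in> chain. fst i \<in> wall_roots}"

lemma wall_root_pos: "b \<in> wall_roots \<Longrightarrow> b \<in> pos_roots R"
  by (simp add: wall_roots_def)

lemma finite_wall_roots: "finite wall_roots"
proof (rule finite_subset)
  show "wall_roots \<subseteq> fst ` J \<union> eta ` Pow J \<union> (\<lambda>K. - eta K) ` Pow J"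
    by (auto simp: wall_roots_def)
  show "finite (fst ` J \<union> eta ` Pow J \<union> (\<lambda>K. - eta K) ` Pow J)"
    using J by (simp add: fin_chain_def)
qed

lemma walls: "fin_chain walls"
proof -
  have "walls \<subseteq> (\<Union>b\<in>wall_roots. Pair b ` {0..<\<lceil>pairing R lam b\<rceil>})"
    by (auto simp: walls_def chain_iff less_ceiling_iff)
  moreover have "finite (\<Union>b\<in>wall_roots. Pair b ` {0..<\<lceil>pairing R lam b\<rceil>})"
    using finite_wall_roots by simp
  ultimately have "finite walls"
    by (rule finite_subset)
  then show ?thesis
    by (auto simp: fin_chain_def walls_def)
qed

lemma J_walls: "J \<subseteq> walls"
  using J_chain chain_pos_root by (auto simp: walls_def wall_roots_def)

definition zs :: "('a \<times> int) list" where
  "zs = enum walls"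

abbreviation "L \<equiv> length zs"

text \<open>Written with \<open>take\<close> so that it also covers \<open>n = L\<close>, past the
  last wall, where it is all of \<open>J\<close>.\<close>

definition cut :: "nat \<Rightarrow> ('a \<times> int) set" where
  "cut n = {j \<in> J. j \<in> set (take n zs)}"

definition dir :: "nat \<Rightarrow> 'a" where
  "dir n = eta (cut n)"

definition sg :: "nat \<Rightarrow> bool" where
  "sg n \<longleftrightarrow> dir n \<in> pos_roots R"

text \<open>This is the condition that the folded root at the wall is \<open>\<plusminus>\<close>
  the simple root; see \<open>fold_root_zs\<close>.\<close>

definition hit :: "nat \<Rightarrow> bool" where
  "hit n \<longleftrightarrow> fst (zs ! n) = dir n \<or> fst (zs ! n) = - dir n"

definition turn :: "nat \<Rightarrow> bool" where
  "turn n \<longleftrightarrow> zs ! n \<in> J"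

definition S :: "nat \<Rightarrow> int" where
  "S n = (\<Sum>i<n. if hit i \<and> \<not> turn i then (if sg i then 1 else - 1) else 0)"

lemma zs_sorted: "sorted_wrt (chain_less R lam) zs" and set_zs: "set zs = walls"
  using enum[OF walls] by (simp_all add: zs_def)

lemma zs_nth_chain: "n < L \<Longrightarrow> zs ! n \<in> chain"
  using nth_mem[of n zs] by (auto simp: set_zs walls_def)

lemma zs_nth_root: "n < L \<Longrightarrow> fst (zs ! n) \<in> wall_roots"
  using nth_mem[of n zs] by (auto simp: set_zs walls_def)

lemma zs_before: "i < n \<Longrightarrow> n < L \<Longrightarrow> zs ! i \<lhd> zs ! n"
  using zs_sorted by (rule sorted_wrt_nth_less)

lemma zs_before_iff:
  assumes "i < L" "n < L"
  shows "zs ! i \<lhd> zs ! n \<longleftrightarrow> i < n"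
  using zs_before[of i n] zs_before[of n i] before_asym assms
  by (cases i n rule: linorder_cases) auto

lemma zs_inj: "i < L \<Longrightarrow> n < L \<Longrightarrow> zs ! i = zs ! n \<Longrightarrow> i = n"
  using distinct_before[OF zs_sorted] by (simp add: nth_eq_iff_index_eq)

lemma walls_nth: "i \<in> walls \<Longrightarrow> \<exists>n<L. zs ! n = i"
  using set_zs by (metis in_set_conv_nth)

lemma set_take_zs: "n \<le> L \<Longrightarrow> set (take n zs) = (\<lambda>i. zs ! i) ` {..<n}"
  by (metis atLeast0LessThan nth_image)

lemma nth_mem_take_zs: "n \<le> L \<Longrightarrow> i < L \<Longrightarrow> zs ! i \<in> set (take n zs) \<longleftrightarrow> i < n"
  unfolding set_take_zs image_iff using zs_inj by (metis lessThan_iff order_less_le_trans)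

lemma cut_subset: "cut n \<subseteq> J" and cut: "fin_chain (cut n)"
  by (auto simp: cut_def intro: J_subset)

lemma cut_0: "cut 0 = {}"
  by (simp add: cut_def)

lemma cut_L: "cut L = J"
  using J_walls by (auto simp: cut_def set_zs)

lemma cut_eq:
  assumes "n < L"
  shows "cut n = {j \<in> J. j \<lhd> zs ! n}"
proof -
  have "j \<in> set (take n zs) \<longleftrightarrow> j \<lhd> zs ! n" if j: "j \<in> J" for j
  proof -
    obtain i where i: "i < L" "zs ! i = j"
      using walls_nth J_walls j by blast
    have "j \<in> set (take n zs) \<longleftrightarrow> i < n"
      using nth_mem_take_zs[of n i] i assms by simp
    then show ?thesis
      using zs_before_iff[OF i(1) assms] i(2) by simp
  qed
  then show ?thesis
    by (auto simp: cut_def)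
qed

lemma cut_Suc:
  assumes "n < L"
  shows "cut (Suc n) = (if turn n then insert (zs ! n) (cut n) else cut n)"
  using assms by (auto simp: cut_def turn_def take_Suc_conv_app_nth)

lemma cut_before: "n < L \<Longrightarrow> j \<in> cut n \<Longrightarrow> j \<lhd> zs ! n"
  by (simp add: cut_eq)

lemma dir_root: "dir n \<in> roots R"
  unfolding dir_def using eta_root[OF cut] .

lemma dir_0: "dir 0 = sr p"
  by (simp add: dir_def cut_0 eta_empty)

lemma dir_Suc:
  assumes "n < L"
  shows "dir (Suc n) = (if turn n then reflection R (fst (zs ! n)) (dir n) else dir n)"
  using eta_insert_last[OF cut zs_nth_chain[OF assms] cut_before[OF assms]] cut_Suc[OF assms]
  by (simp add: dir_def)

lemma not_sg: "\<not> sg n \<longleftrightarrow> - dir n \<in> pos_roots R"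
  using neg_root_iff[OF dir_root] by (simp add: sg_def)

lemma dir_Suc_hit:
  assumes "n < L" "hit n" "turn n"
  shows "dir (Suc n) = - dir n"
proof -
  have "reflection R (fst (zs ! n)) = reflection R (dir n)"
    using assms(2) by (auto simp: hit_def reflection_minus)
  then show ?thesis
    using assms root_norm_pos[OF dir_root, of n] by (simp add: dir_Suc reflection_self)
qed

lemma hit_root:
  assumes "n < L" "hit n"
  shows "fst (zs ! n) = (if sg n then dir n else - dir n)"
proof -
  have "fst (zs ! n) \<in> pos_roots R"
    using zs_nth_chain[OF assms(1)] chain_pos_root by simp
  then show ?thesis
    using assms(2) neg_root_iff[OF dir_root, of n] by (auto simp: hit_def sg_def)
qed

text \<open>This is where admissibility enters: by the lifting property, the direction can only turn from
  positive to negative at a fold in \<open>\<alpha>\<^sub>p\<close> itself.\<close>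

sublocale level_walk L sg hit turn S
proof
  show "S 0 = 0"
    by (simp add: S_def)
  show "sg 0"
    using sroot_pos[OF p] by (simp add: sg_def dir_0)
  fix n assume n: "n < L"
  show "S (Suc n) = S n + (if hit n \<and> \<not> turn n then if sg n then 1 else - 1 else 0)"
    by (simp add: S_def)
  show "sg (Suc n) \<longleftrightarrow> (if turn n then \<not> sg n else sg n)" if "hit n"
    using dir_Suc_hit[OF n that] dir_Suc[OF n] not_sg[of n] by (auto simp: sg_def)
  show "sg (Suc n)" if "\<not> hit n" "sg n"
  proof (rule ccontr)
    assume *: "\<not> sg (Suc n)"
    then have t: "turn n"
      using that dir_Suc[OF n] by (auto simp: sg_def split: if_splits)
    then have j: "zs ! n \<in> J" "{i \<in> J. i \<lhd> zs ! n} = cut n"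
      using cut_eq[OF n] by (auto simp: turn_def)
    have "RP (cut n) (fst (zs ! n)) = sr p"
    proof (rule cover_lifting[OF RP_weyl[OF cut] chain_pos_root[OF zs_nth_chain[OF n]] _ p])
      show "len (RP (cut n) \<circ> reflection R (fst (zs ! n))) = len (RP (cut n)) + 1"
        using J_cover[OF j(1)] by (simp add: j(2))
      show "RP (cut n) (dir n) = sr p"
        unfolding dir_def by (rule RP_eta[OF cut])
      show "dir n \<in> pos_roots R" "reflection R (fst (zs ! n)) (dir n) \<notin> pos_roots R"
        using that(2) * t dir_Suc[OF n] by (auto simp: sg_def)
    qed
    then have "fst (zs ! n) = dir n"
      unfolding dir_def using RP_eq_iff[OF cut] by blast
    with that(1) show False
      by (simp add: hit_def)
  qed
qed

subsection \<open>Heights along the perturbed path\<close>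

definition ht :: "nat \<Rightarrow> 'a \<Rightarrow> real" where
  "ht n = height (cut n)"

definition ppath :: "real \<Rightarrow> real \<Rightarrow> 'a" where
  "ppath e t = t *\<^sub>R lam - perturb e"

lemma ht_eq: "ht n x = pairing R x (dir n) + offset (cut n)"
  by (simp add: ht_def dir_def height_eq(1)[OF cut])

lemma offset_int: "offset (cut n) \<in> \<int>"
  by (rule height_eq(2)[OF cut])

lemma ht_ppath: "ht n (ppath e t) = pairing R lam (dir n) * t + (offset (cut n) - shift e (dir n))"
  by (simp add: ht_eq ppath_def pairing_lin)

lemma ht_Suc:
  assumes "n < L" "pairing R x (fst (zs ! n)) = of_int (snd (zs ! n))"
  shows "ht (Suc n) x = ht n x"
  using height_insert_last[OF cut zs_nth_chain[OF assms(1)] cut_before[OF assms(1)] assms(2)]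
  by (simp add: ht_def cut_Suc[OF assms(1)])

lemma pairing_ppath_ptime:
  assumes "i \<in> chain"
  shows "pairing R (ppath e (ptime e i)) (fst i) = of_int (snd i)"
  using chainD(5)[of "fst i" "snd i"] assms
  by (simp add: ppath_def pairing_lin ptime_def split_beta)

lemma pairing_path_time:
  assumes "i \<in> chain"
  shows "pairing R (time i *\<^sub>R lam) (fst i) = of_int (snd i)"
  using chainD(5)[of "fst i" "snd i"] assms
  by (simp add: pairing_lin chain_time_def split_beta)

lemma ht_hit:
  assumes "n < L" "hit n" "pairing R x (fst (zs ! n)) = of_int (snd (zs ! n))"
  shows "ht n x = (if sg n then of_int (snd (zs ! n)) else - of_int (snd (zs ! n))) + offset (cut n)"
  using assms hit_root[OF assms(1,2)] by (auto simp: ht_eq pairing_minus_right split: if_splits)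

lemma dir_wall_root: "(if sg n then dir n else - dir n) \<in> wall_roots"
proof -
  have "\<exists>K\<subseteq>J. b = eta K \<or> b = - eta K" if "b = dir n \<or> b = - dir n" for b
    using cut_subset[of n] that unfolding dir_def by blast
  then show ?thesis
    using not_sg[of n] unfolding wall_roots_def sg_def mem_Collect_eq by metis
qed

text \<open>Shifts below 1 keep the perturbed times of all walls inside the unit interval and start
  the perturbed height above -1.\<close>

definition good :: "real \<Rightarrow> bool" where
  "good e \<longleftrightarrow> small walls e \<and> (\<forall>b\<in>wall_roots. shift e b < 1)"

lemma eventually_good: "eventually good (at_right 0)"
proof -
  have "eventually (\<lambda>e. \<forall>b\<in>wall_roots. shift e b < 1) (at_right 0)"
  proof (rule eventually_ball_finite[OF finite_wall_roots], rule ballI)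
    fix b assume "b \<in> wall_roots"
    then have "b \<in> roots R"
      by (intro pos_root_root wall_root_pos)
    from order_tendstoD(2)[OF shift_tendsto[OF this] zero_less_one]
    show "eventually (\<lambda>e. shift e b < 1) (at_right 0)" .
  qed
  with eventually_small[OF walls] show ?thesis
    unfolding good_def by (rule eventually_conj)
qed

text \<open>Between \<open>lower\<close> and \<open>upper\<close> the moved path has passed exactly
  the first \<open>n\<close> walls; the ends 0 and 1 of the path replace missing neighbours.\<close>

definition lower :: "real \<Rightarrow> nat \<Rightarrow> real" where
  "lower e n = (if n = 0 then 0 else ptime e (zs ! (n - 1)))"

definition upper :: "real \<Rightarrow> nat \<Rightarrow> real" where
  "upper e n = (if n < L then ptime e (zs ! n) else 1)"

context
  fixes e :: real
  assumes good: "good e"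
begin

lemma e_pos: "e > 0"
  using good unfolding good_def small_def by blast

lemma shift_range: "b \<in> wall_roots \<Longrightarrow> 0 < shift e b \<and> shift e b < 1"
  using good shift_pos[OF wall_root_pos e_pos] unfolding good_def by blast

lemma ptime_less: "i < n \<Longrightarrow> n < L \<Longrightarrow> ptime e (zs ! i) < ptime e (zs ! n)"
  using good zs_before[of i n] nth_mem[of n zs] nth_mem[of i zs]
  unfolding good_def small_def set_zs by (meson order_less_trans)

lemma ptime_range:
  assumes "n < L"
  shows "0 < ptime e (zs ! n)" "ptime e (zs ! n) < 1" "time (zs ! n) < ptime e (zs ! n)"
proof -
  obtain b k where bk: "zs ! n = (b, k)" by fastforce
  have c: "(b, k) \<in> chain" and s: "0 < shift e b" "shift e b < 1"
    using zs_nth_chain[OF assms] shift_range[OF zs_nth_root[OF assms]] by (auto simp: bk)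
  note N = chainD[OF c]
  obtain N' :: int where N': "pairing R lam b = of_int N'"
    using pairing_root_int[OF lam N(2)] by (auto elim: Ints_cases)
  have "k + 1 \<le> N'"
    using N(4) by (simp add: N')
  then have "of_int k + 1 \<le> pairing R lam b"
    unfolding N' by (metis of_int_1 of_int_add of_int_le_iff)
  then show "0 < ptime e (zs ! n)" "ptime e (zs ! n) < 1" "time (zs ! n) < ptime e (zs ! n)"
    using N s by (auto simp: bk ptime_def chain_time_def divide_strict_right_mono)
qed

text \<open>An integral height puts the moved point on a hyperplane over the positive one of
  \<open>\<plusminus> dir n\<close>. It remains to see that its index belongs to the chain:
  \<open>0 \<le> k\<close> because the shift is less than 1, and \<open>k < N\<close> because
  \<open>t < 1\<close> and the shift is positive.\<close>

lemma integer_height: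
  assumes "0 < t" "t < 1" "ht n (ppath e t) \<in> \<int>"
  shows "\<exists>i<L. ptime e (zs ! i) = t \<and> (fst (zs ! i) = dir n \<or> fst (zs ! i) = - dir n)"
proof -
  define b where "b = (if sg n then dir n else - dir n)"
  have b: "b \<in> wall_roots" "b \<in> pos_roots R" "b \<in> roots R"
    unfolding b_def using dir_wall_root wall_root_pos pos_root_root by blast+
  define N where "N = pairing R lam b"
  have "N \<ge> 0"
    using dom_nonneg[OF b(2)] by (simp add: N_def)
  have s: "0 < shift e b" "shift e b < 1"
    using shift_range[OF b(1)] by auto
  have "N * t - shift e b = (if sg n then ht n (ppath e t) - offset (cut n) else offset (cut n) - ht n (ppath e t))"
    by (auto simp: ht_ppath b_def N_def pairing_minus_right)
  then have "N * t - shift e b \<in> \<int>"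
    using assms(3) offset_int[of n] by auto
  then obtain k where k: "N * t - shift e b = of_int k"
    by (auto elim: Ints_cases)
  have "0 \<le> N * t"
    using \<open>N \<ge> 0\<close> assms(1) by simp
  then have "(-1 :: real) < of_int k"
    using k s by linarith
  then have "0 \<le> k" by linarith
  \<comment> \<open>With \<open>N = 0\<close> the integer \<open>k\<close> would be minus the shift,
    hence negative.\<close>
  then have "N \<noteq> 0"
  proof -
    have "(0 :: real) \<le> of_int k"
      using \<open>0 \<le> k\<close> by simp
    then show ?thesis
      using k s by (intro notI) simp
  qed
  then have "N > 0" using \<open>N \<ge> 0\<close> by simp
  have "N * t < N"
    using \<open>N > 0\<close> assms(2) by simp
  then have "of_int k < N"
    using k s by linarith
  then have "(b, k) \<in> walls"
    using \<open>0 \<le> k\<close> b by (simp add: walls_def chain_iff N_def)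
  then obtain i where i: "i < L" "zs ! i = (b, k)"
    using walls_nth by blast
  have "ptime e (zs ! i) = t"
    using k \<open>N > 0\<close> by (simp add: i(2) ptime_def field_simps flip: N_def)
  with i show ?thesis
    by (intro exI[of _ i]) (auto simp: b_def)
qed

lemma lower_upper:
  assumes "n \<le> L"
  shows "0 \<le> lower e n" "lower e n < upper e n" "upper e n \<le> 1"
  using assms ptime_range[of n] ptime_range[of "n - 1"] ptime_less[of "n - 1" n]
  by (cases "n = 0"; cases "n < L"; force simp: lower_def upper_def)+

lemma no_integer_height:
  assumes "n \<le> L" "lower e n < t" "t < upper e n"
  shows "ht n (ppath e t) \<notin> \<int>"
proof
  assume "ht n (ppath e t) \<in> \<int>"
  then obtain i where i: "i < L" "ptime e (zs ! i) = t"
    using integer_height[of t n] lower_upper[OF assms(1)] assms by auto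
  show False
  proof (cases "i < n")
    case True
    then have "ptime e (zs ! i) \<le> lower e n"
      using assms(1) ptime_less[of i "n - 1"] by (cases "i = n - 1") (force simp: lower_def)+
    then show False using i assms by simp
  next
    case False
    then have "upper e n \<le> ptime e (zs ! i)"
      using i ptime_less[of n i] by (cases "i = n") (auto simp: upper_def)
    then show False using i assms by simp
  qed
qed

text \<open>The height is integral there and, by continuity, in the closed unit interval. The slope
  of a hit has the sign recorded in \<open>sg n\<close> and excludes one of the two ends.\<close>

lemma height_at_hit:
  assumes inv: "\<And>t. lower e n < t \<Longrightarrow> t < upper e n \<Longrightarrow> of_int (S n) - 1 < ht n (ppath e t) \<and> ht n (ppath e t) < of_int (S n)"
    and n: "n < L" and hit: "hit n"
  shows "ht n (ppath e (ptime e (zs ! n))) = of_int (Lv n)"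
    and "pairing R lam (dir n) \<noteq> 0" "pairing R lam (dir n) > 0 \<longleftrightarrow> sg n"
proof -
  define c where "c = pairing R lam (dir n)"
  define d where "d = offset (cut n) - shift e (dir n)"
  have ht: "ht n (ppath e t) = c * t + d" for t
    by (simp add: ht_ppath c_def d_def)
  have up: "upper e n = ptime e (zs ! n)"
    using n by (simp add: upper_def)
  have lu: "lower e n < upper e n"
    using lower_upper(2) n by simp
  have N: "0 < pairing R lam (fst (zs ! n))"
    using chainD(5)[of "fst (zs ! n)" "snd (zs ! n)"] zs_nth_chain[OF n] by simp
  have c: "c > 0 \<longleftrightarrow> sg n" "c \<noteq> 0"
    using N hit_root[OF n hit] by (auto simp: c_def pairing_minus_right split: if_splits)
  then show "pairing R lam (dir n) \<noteq> 0" "pairing R lam (dir n) > 0 \<longleftrightarrow> sg n"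
    by (auto simp: c_def)
  have "ht n (ppath e (upper e n)) \<in> \<int>"
    using ht_hit[OF n hit pairing_ppath_ptime[OF zs_nth_chain[OF n]]] offset_int[of n] by (auto simp: up)
  then obtain z where z: "c * upper e n + d = of_int z"
    by (auto simp: ht elim: Ints_cases)
  note ends = affine_endpoint[OF lu inv[unfolded ht]]
  have "z = Lv n"
  proof (cases "sg n")
    case True
    then have "of_int (S n) - 1 < (of_int z :: real)" "of_int z \<le> (of_int (S n) :: real)"
      using ends c z by auto
    then have "z = S n" by linarith
    then show ?thesis using True by (simp add: Lv_def)
  next
    case False
    then have "c < 0" using c by linarith
    then have "of_int (S n) - 1 \<le> (of_int z :: real)" "of_int z < (of_int (S n) :: real)"
      using ends z by auto
    then have "z = S n - 1" by linarith
    then show ?thesis using False by (simp add: Lv_def)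
  qed
  then show "ht n (ppath e (ptime e (zs ! n))) = of_int (Lv n)"
    using z by (simp add: ht up)
qed

text \<open>Inside an interval no integer is met, so only the passage through a wall matters. At a
  hit the height is an integer, which is crossed with a change of \<open>S\<close> or reflected
  without one; at any other wall it is not an integer and \<open>S\<close> is unchanged.\<close>

lemma height_invariant:
  assumes "n \<le> L" "lower e n < t" "t < upper e n"
  shows "of_int (S n) - 1 < ht n (ppath e t) \<and> ht n (ppath e t) < of_int (S n)"
  using assms
proof (induction n arbitrary: t)
  case 0
  \<comment> \<open>The moved path starts at height \<open>- shift e (sr p)\<close>, strictly
    between -1 and \<open>S 0 = 0\<close>, because \<open>sr p\<close> is the initial
    direction.\<close>
  have p': "sr p \<in> wall_roots"
    using dir_wall_root[of 0] sg_0 by (simp add: dir_0)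
  have off: "offset (cut 0) = 0"
    by (simp add: cut_0 offset_def height_def pairing_lin)
  show ?case
    unfolding ht_ppath
    by (rule affine_between_integers[of "lower e 0" "upper e 0"])
       (use no_integer_height[of 0] 0 shift_range[OF p'] in \<open>auto simp: ht_ppath lower_def S_0 dir_0 off\<close>)
next
  case (Suc n)
  have n: "n < L" "n \<le> L" using Suc.prems by auto
  note inv = Suc.IH[OF n(2)]
  define x where "x = ptime e (zs ! n)"
  have x: "upper e n = x" "lower e (Suc n) = x"
    using n by (auto simp: upper_def lower_def x_def)
  have same: "ht (Suc n) (ppath e x) = ht n (ppath e x)"
    unfolding x_def by (rule ht_Suc[OF n(1) pairing_ppath_ptime[OF zs_nth_chain[OF n(1)]]])
  define c d where "c = pairing R lam (dir (Suc n))" and "d = offset (cut (Suc n)) - shift e (dir (Suc n))"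
  have ht: "ht (Suc n) (ppath e t) = c * t + d" for t
    by (simp add: ht_ppath c_def d_def)
  have "of_int (S (Suc n)) - 1 < c * x + d \<and> c * x + d < of_int (S (Suc n))
      \<or> c * x + d = of_int (S (Suc n)) \<and> c < 0 \<or> c * x + d = of_int (S (Suc n)) - 1 \<and> c > 0"
  proof (cases "hit n")
    case True
    note H = height_at_hit[OF inv n(1) True]
    have v: "c * x + d = of_int (Lv n)"
      using H(1) same by (simp add: ht x_def)
    show ?thesis
    proof (cases "turn n")
      case turn: True
      have "c = - pairing R lam (dir n)"
        using dir_Suc_hit[OF n(1) True turn] by (simp add: c_def pairing_minus_right)
      then show ?thesis
        using H(2,3) v S_Suc[OF n(1)] turn by (cases "sg n") (auto simp: Lv_def)
    next
      case False
      then have "c = pairing R lam (dir n)"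
        using dir_Suc[OF n(1)] by (simp add: c_def)
      then show ?thesis
        using H(2,3) v S_Suc[OF n(1)] True False by (cases "sg n") (auto simp: Lv_def)
    qed
  next
    case False
    have x01: "0 < x" "x < 1"
      using ptime_range[OF n(1)] by (auto simp: x_def)
    have "ht n (ppath e x) \<notin> \<int>"
    proof
      assume "ht n (ppath e x) \<in> \<int>"
      \<comment> \<open>Perturbed times are strictly increasing, so the only wall at the time
        \<open>x\<close> is the \<open>n\<close>-th, which is not a hit.\<close>
      from integer_height[OF x01 this] obtain i where i: "i < L" "ptime e (zs ! i) = x"
        "fst (zs ! i) = dir n \<or> fst (zs ! i) = - dir n" by blast
      then have "i = n"
        using ptime_less[of i n] ptime_less[of n i] n(1) by (cases i n rule: linorder_cases) (auto simp: x_def)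
      with i False show False by (simp add: hit_def)
    qed
    moreover have "of_int (S n) - 1 \<le> ht n (ppath e x)" "ht n (ppath e x) \<le> of_int (S n)"
      using affine_endpoint(1,2)[OF lower_upper(2)[OF n(2)] inv[unfolded ht_ppath]] by (simp_all add: ht_ppath x)
    moreover have "ht n (ppath e x) \<noteq> of_int (S n)" "ht n (ppath e x) \<noteq> of_int (S n - 1)"
      using \<open>ht n (ppath e x) \<notin> \<int>\<close> by (metis Ints_of_int)+
    ultimately show ?thesis
      using S_Suc[OF n(1)] False same by (simp add: ht)
  qed
  then show ?case
    unfolding ht
    by (intro affine_between_integers[of "lower e (Suc n)" "upper e (Suc n)"])
       (use no_integer_height[OF Suc.prems(1)] Suc.prems(2,3) in \<open>auto simp: ht x\<close>)
qed

lemma height_invariant_closed: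
  assumes "n \<le> L" "lower e n < t" "t \<le> upper e n"
  shows "of_int (S n) - 1 \<le> ht n (ppath e t) \<and> ht n (ppath e t) \<le> of_int (S n)"
proof (cases "t = upper e n")
  case True
  then show ?thesis
    using affine_endpoint(1,2)[OF lower_upper(2)[OF assms(1)] height_invariant[OF assms(1), unfolded ht_ppath]]
    by (simp add: ht_ppath)
next
  case False
  then show ?thesis
    using height_invariant[of n t] assms by force
qed

end

lemma ex_good: "\<exists>e. good e"
  using eventually_happens[OF eventually_good] by simp

lemma hit_height:
  assumes "n < L" "hit n"
  shows "ht n (time (zs ! n) *\<^sub>R lam) = of_int (Lv n)"
proof -
  obtain e where e: "good e"
    using ex_good by blast
  have "ht n (ppath e (ptime e (zs ! n))) = of_int (Lv n)"
    using height_at_hit(1)[OF e height_invariant[OF e] assms] assms by simp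
  then show ?thesis
    using ht_hit[OF assms pairing_ppath_ptime[OF zs_nth_chain[OF assms(1)]]]
      ht_hit[OF assms pairing_path_time[OF zs_nth_chain[OF assms(1)]]] by simp
qed

text \<open>Walls at the time \<open>t\<close> itself count as not yet passed, in keeping with
  left-hand derivatives.\<close>

definition at_time :: "real \<Rightarrow> nat \<Rightarrow> bool" where
  "at_time t n \<longleftrightarrow> n \<le> L \<and> (\<forall>i<n. time (zs ! i) < t) \<and> (\<forall>i. n \<le> i \<and> i < L \<longrightarrow> t \<le> time (zs ! i))"

lemma zs_time_mono:
  assumes "i \<le> n" "n < L"
  shows "time (zs ! i) \<le> time (zs ! n)"
  using time_mono[OF zs_before[of i n]] assms by (cases "i = n") auto

lemma at_time_exists: "\<exists>n. at_time t n"
proof -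
  define n where "n = (LEAST n. n = L \<or> n < L \<and> t \<le> time (zs ! n))"
  have n: "n = L \<or> n < L \<and> t \<le> time (zs ! n)"
    unfolding n_def by (rule LeastI[of _ L]) simp
  have less: "i \<noteq> L \<and> \<not> (i < L \<and> t \<le> time (zs ! i))" if "i < n" for i
    using not_less_Least[of i "\<lambda>n. n = L \<or> n < L \<and> t \<le> time (zs ! n)"] that unfolding n_def by blast
  have "t \<le> time (zs ! i)" if "n \<le> i" "i < L" for i
    using n zs_time_mono[OF that] that by auto
  moreover have "time (zs ! i) < t" if "i < n" for i
    using less[OF that] n that by auto
  ultimately have "at_time t n"
    using n unfolding at_time_def by auto
  then show ?thesis by blast
qed

lemma at_time_cut:
  assumes "at_time t n"
  shows "{j \<in> J. time j < t} = cut n"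
proof -
  have "time j < t \<longleftrightarrow> j \<in> set (take n zs)" if j: "j \<in> J" for j
  proof -
    obtain i where i: "i < L" "zs ! i = j"
      using walls_nth J_walls j by blast
    have n: "n \<le> L"
      using assms by (simp add: at_time_def)
    have "j \<in> set (take n zs) \<longleftrightarrow> i < n"
      using nth_mem_take_zs[OF n i(1)] i(2) by simp
    then show ?thesis
      using assms i by (cases "i < n") (auto simp: at_time_def not_less)
  qed
  then show ?thesis
    by (auto simp: cut_def)
qed

lemma ht_tendsto: "((\<lambda>e. ht n (ppath e t)) \<longlongrightarrow> ht n (t *\<^sub>R lam)) (at_right 0)"
  unfolding ht_ppath by (rule tendsto_eq_intros shift_tendsto dir_root refl)+ (simp add: ht_eq pairing_lin)

text \<open>Letting \<open>\<epsilon> \<rightarrow> 0\<close>: a wall at time \<open>t\<close> is met just after \<open>t\<close> on the perturbed path.\<close>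

lemma height_bounds:
  assumes t: "0 < t" "t \<le> 1" and n: "at_time t n"
  shows "of_int (S n) - 1 \<le> ht n (t *\<^sub>R lam)" "ht n (t *\<^sub>R lam) \<le> of_int (S n)"
proof -
  have nL: "n \<le> L"
    using n by (simp add: at_time_def)
  have "eventually (\<lambda>e. lower e n < t) (at_right 0)"
  proof (cases "n = 0")
    case False
    then have "time (zs ! (n - 1)) < t" "zs ! (n - 1) \<in> chain"
      using n nL zs_nth_chain[of "n - 1"] by (auto simp: at_time_def)
    then show ?thesis
      using order_tendstoD(2)[OF ptime_tendsto, of "zs ! (n - 1)" t] False by (simp add: lower_def)
  qed (use t in \<open>simp add: lower_def\<close>)
  then have ev: "eventually (\<lambda>e. of_int (S n) - 1 \<le> ht n (ppath e t) \<and> ht n (ppath e t) \<le> of_int (S n)) (at_right 0)"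
    using eventually_good
  proof eventually_elim
    case (elim e)
    have "t \<le> upper e n"
    proof (cases "n < L")
      case True
      then have "t \<le> time (zs ! n)"
        using n by (simp add: at_time_def)
      then show ?thesis
        using ptime_range(3)[OF elim(2) True] True by (simp add: upper_def)
    qed (simp add: upper_def t)
    from height_invariant_closed[OF elim(2) nL elim(1) this] show ?case .
  qed
  show "of_int (S n) - 1 \<le> ht n (t *\<^sub>R lam)"
    by (rule tendsto_lowerbound[OF ht_tendsto eventually_mono[OF ev]]) simp_all
  show "ht n (t *\<^sub>R lam) \<le> of_int (S n)"
    by (rule tendsto_upperbound[OF ht_tendsto eventually_mono[OF ev]]) simp_all
qed

text \<open>The height of \<open>lam\<close> is an integer and exceeds that of the end of the moved
  path by \<open>shift e (dir L)\<close>, whose modulus lies between 0 and 1 and whose sign is known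
  from \<open>sg L\<close>. This singles out one end of the unit interval.\<close>

lemma final_height: "ht L lam = of_int (Lv L)"
proof -
  obtain e where e: "good e"
    using ex_good by blast
  obtain z where z: "ht L lam = of_int z"
    using pairing_root_int[OF lam dir_root] offset_int[of L] by (metis Ints_add Ints_cases ht_eq)
  have "lower e L < 1" "1 \<le> upper e L"
    using lower_upper[OF e order_refl] by (auto simp: upper_def)
  then have b: "of_int (S L) - 1 \<le> ht L (ppath e 1)" "ht L (ppath e 1) \<le> of_int (S L)"
    using height_invariant_closed[OF e order_refl, of 1] by auto
  have eq: "ht L (ppath e 1) = of_int z - shift e (dir L)"
    using z unfolding ht_ppath ht_eq[of L lam] by simp
  show ?thesis
  proof (cases "sg L")
    case True
    then have "0 < shift e (dir L)" "shift e (dir L) < 1"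
      using shift_range[OF e dir_wall_root[of L]] by auto
    then have "z = S L"
      using b eq by linarith
    then show ?thesis using z True by (simp add: Lv_def)
  next
    case False
    then have "0 < - shift e (dir L)" "- shift e (dir L) < 1"
      using shift_range[OF e dir_wall_root[of L]] by (auto simp: pairing_minus_right)
    then have "z = S L - 1"
      using b eq by linarith
    then show ?thesis using z False by (simp add: Lv_def)
  qed
qed

end

section \<open>The path in closed form\<close>

lemma filter_eq_take:
  assumes "distinct xs" "\<And>i j. i < j \<Longrightarrow> j < length xs \<Longrightarrow> P (xs ! j) \<Longrightarrow> P (xs ! i)"
  shows "filter P xs = take (card {x \<in> set xs. P x}) xs"
  using assms
proof (induction xs)
  case (Cons x xs)
  have IH: "filter P xs = take (card {x \<in> set xs. P x}) xs"
  proof (rule Cons.IH)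
    show "P (xs ! i)" if "i < j" "j < length xs" "P (xs ! j)" for i j
      using Cons.prems(2)[of "Suc i" "Suc j"] that by simp
  qed (use Cons.prems(1) in simp)
  show ?case
  proof (cases "P x")
    case True
    then have "{y \<in> set (x # xs). P y} = insert x {y \<in> set xs. P y}" by auto
    then have "card {y \<in> set (x # xs). P y} = Suc (card {y \<in> set xs. P y})"
      using Cons.prems(1) by simp
    then show ?thesis
      using True IH by simp
  next
    case False
    have "\<not> P y" if "y \<in> set xs" for y
    proof -
      obtain j where "j < length xs" "y = xs ! j"
        using \<open>y \<in> set xs\<close> by (metis in_set_conv_nth)
      then show ?thesis
        using Cons.prems(2)[of 0 "Suc j"] False by auto
    qed
    then have *: "{y \<in> set (x # xs). P y} = {}" "filter P (x # xs) = []"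
      using False by (auto simp: filter_empty_conv)
    show ?thesis
      unfolding * by simp
  qed
qed simp

context km_weight
begin

abbreviation upto_time :: "('a \<times> int) set \<Rightarrow> real \<Rightarrow> ('a \<times> int) set" where
  "upto_time K t \<equiv> {j \<in> K. time j < t}"

lemma fin_chain_filter: "fin_chain K \<Longrightarrow> fin_chain {j \<in> K. P j}"
  by (rule fin_chain_subset) auto

text \<open>Times increase weakly along the enumeration, so the folds counted by
  \<open>break_count\<close> form a prefix. No fold time lies between \<open>t\<close> and the next
  break point, so they are the folds with time below \<open>t\<close>.\<close>

lemma direction_at:
  assumes K: "fin_chain K" and k: "Suc k < length (break_points R lam K)"
    and t: "break_points R lam K ! k < t" "t \<le> break_points R lam K ! Suc k"
  shows "direction R lam K k = RP (upto_time K t) lam"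
proof -
  define T where "T = sorted_list_of_set (time ` K \<union> {0})"
  have fin: "finite (time ` K \<union> {0})"
    using K by (simp add: fin_chain_def)
  have T: "sorted_wrt (<) T" "set T = time ` K \<union> {0}"
    unfolding T_def strict_sorted_iff
    by (intro conjI sorted_sorted_list_of_set distinct_sorted_list_of_set)
       (rule set_sorted_list_of_set[OF fin])
  have bp: "break_points R lam K = T @ [1]"
    by (simp add: break_points_def T_def)
  have "time j < (T @ [1]) ! Suc k \<longleftrightarrow> time j < t" if j: "j \<in> K" for j
  proof
    assume less: "time j < (T @ [1]) ! Suc k"
    obtain i where i: "i < length T" "time j = T ! i"
      using j T(2) by (metis UnI1 image_eqI in_set_conv_nth)
    have "i \<le> k"
    proof (rule ccontr)
      assume "\<not> i \<le> k"
      then have "Suc k \<le> i" by simp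
      then have "T ! Suc k \<le> T ! i"
        using sorted_wrt_nth_less[OF T(1), of "Suc k" i] i by (cases "i = Suc k") auto
      then show False
        using less i \<open>Suc k \<le> i\<close> by (simp add: nth_append)
    qed
    then have "T ! i \<le> T ! k"
      using sorted_wrt_nth_less[OF T(1), of i k] i k bp by (cases "i = k") auto
    then show "time j < t"
      using t(1) k i(2) by (simp add: bp nth_append)
  qed (use t in \<open>simp add: bp\<close>)
  then have "{j \<in> K. time j < (T @ [1]) ! Suc k} = upto_time K t"
    by blast
  then have count: "break_count R lam K (k + 1) = card {j \<in> set (enum K). time j < t}"
    using enum(2)[OF K] by (simp add: break_count_def bp)
  have "filter (\<lambda>j. time j < t) (enum K) = take (card {j \<in> set (enum K). time j < t}) (enum K)"
  proof (rule filter_eq_take)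
    show "distinct (enum K)"
      by (rule distinct_before[OF enum(1)[OF K]])
    show "time (enum K ! i) < t" if "i < j" "j < length (enum K)" "time (enum K ! j) < t" for i j
      using time_mono[OF sorted_wrt_nth_less[OF enum(1)[OF K] that(1,2)]] that(3) by simp
  qed
  then show ?thesis
    unfolding direction_def count enum_filter[OF K] by simp
qed

text \<open>The index in the definition is the least \<open>k\<close> with
  \<open>t \<le> a ! Suc k\<close>. A fold at the time \<open>t\<close> itself belongs to the
  following interval, whence the strict inequality in \<open>upto_time\<close>.\<close>

lemma step_fun_eq:
  assumes K: "fin_chain K" and t: "0 < t" "t \<le> 1"
  shows "step_fun R lam K t = - RP (upto_time K t) lam"
proof -
  define T where "T = sorted_list_of_set (time ` K \<union> {0})"
  have fin: "finite (time ` K \<union> {0})"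
    using K by (simp add: fin_chain_def)
  have T: "sorted_wrt (<) T" "set T = time ` K \<union> {0}"
    unfolding T_def strict_sorted_iff
    by (intro conjI sorted_sorted_list_of_set distinct_sorted_list_of_set)
       (rule set_sorted_list_of_set[OF fin])
  have range: "0 \<le> x \<and> x < 1" if "x \<in> set T" for x
    using that T(2) K time_range by (auto simp: fin_chain_def)
  define a where "a = break_points R lam K"
  have bp: "a = T @ [1]"
    by (simp add: a_def break_points_def T_def)
  have sorted: "sorted_wrt (<) a"
    using T(1) range by (simp add: bp sorted_wrt_append)
  have len: "0 < length T"
    using T(2) by (cases T) auto
  have "a ! 0 \<le> 0"
  proof -
    obtain i where "i < length T" "T ! i = 0"
      using T(2) by (metis UnI2 in_set_conv_nth singletonI)
    then show ?thesis
      using sorted_wrt_nth_less[OF sorted, of 0 i] by (cases "i = 0") (auto simp: bp nth_append)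
  qed
  define k where "k = (LEAST k. t \<le> a ! Suc k)"
  have last: "t \<le> a ! Suc (length T - 1)"
    using t len by (simp add: bp nth_append)
  have k: "t \<le> a ! Suc k"
    unfolding k_def by (rule LeastI, rule last)
  have "k \<le> length T - 1"
    unfolding k_def by (rule Least_le, rule last)
  then have "k < length T"
    using len by linarith
  then have kl: "k + 1 < length a"
    by (simp add: bp)
  have "a ! k < t"
  proof (cases k)
    case 0
    then show ?thesis using \<open>a ! 0 \<le> 0\<close> t by simp
  next
    case (Suc l)
    then show ?thesis
      using not_less_Least[of l "\<lambda>k. t \<le> a ! Suc k"] by (simp add: k_def)
  qed
  have "(THE k. k + 1 < length a \<and> a ! k < t \<and> t \<le> a ! (k + 1)) = k"
  proof (rule the_equality)
    show "k + 1 < length a \<and> a ! k < t \<and> t \<le> a ! (k + 1)"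
      using kl k \<open>a ! k < t\<close> by simp
    fix l assume l: "l + 1 < length a \<and> a ! l < t \<and> t \<le> a ! (l + 1)"
    have "k \<le> l"
      unfolding k_def by (rule Least_le) (use l in simp)
    moreover have False if "k < l"
    proof -
      have "a ! Suc k \<le> a ! l"
        using sorted_wrt_nth_less[OF sorted, of "Suc k" l] that l by (cases "Suc k = l") auto
      then show False using k l by simp
    qed
    ultimately show "l = k" by fastforce
  qed
  then have "step_fun R lam K t = - direction R lam K k"
    by (simp add: step_fun_def flip: a_def)
  then show ?thesis
    using direction_at[OF K, of k t] kl k \<open>a ! k < t\<close> by (simp flip: a_def)
qed

text \<open>The negative of the path, as \<open>path_of_eq\<close> shows: the translation parts of
  the affine reflections account for the stretches travelled in earlier directions.\<close>

definition position :: "('a \<times> int) set \<Rightarrow> real \<Rightarrow> 'a" where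
  "position K t = AP (upto_time K t) (t *\<^sub>R lam)"

lemma position_0: "fin_chain K \<Longrightarrow> position K 0 = 0"
proof -
  assume "fin_chain K"
  then have "upto_time K 0 = {}"
    using time_range by (force simp: fin_chain_def)
  then show ?thesis
    by (simp only: position_def AP_empty scaleR_zero_left)
qed

lemma AP_path_insert_last:
  assumes "fin_chain K" "i \<in> chain" "\<And>j. j \<in> K \<Longrightarrow> j \<lhd> i"
  shows "AP (insert i K) (time i *\<^sub>R lam) = AP K (time i *\<^sub>R lam)"
proof -
  have "pairing R (time i *\<^sub>R lam) (fst i) = of_int (snd i)"
    using chainD(5)[of "fst i" "snd i"] assms(2) by (simp add: pairing_lin chain_time_def split_beta)
  then show ?thesis
    by (simp add: AP_insert_last[OF assms] affine_reflection_fixed)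
qed

lemma upto_time_insert:
  "time i < t \<Longrightarrow> upto_time (insert i K) t = insert i (upto_time K t)"
  "t \<le> time i \<Longrightarrow> upto_time (insert i K) t = upto_time K t"
  by auto

text \<open>Folds at the time \<open>t\<close> are missing from \<open>upto_time\<close>, but each
  of them fixes \<open>t *\<^sub>R lam\<close>, so including them makes no difference.\<close>

lemma position_after:
  assumes "fin_chain K" "\<And>j. j \<in> K \<Longrightarrow> time j \<le> t"
  shows "position K t = AP K (t *\<^sub>R lam)"
  using assms
proof (induction rule: fin_chain_induct)
  case empty
  then show ?case by (simp add: position_def)
next
  case (insert i K)
  show ?case
  proof (cases "time i < t")
    case True
    then have "upto_time (insert i K) t = insert i K"
      using time_mono[OF insert(3)] by force
    then show ?thesis by (simp add: position_def)
  next
    case False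
    then have "time i = t" using insert(5)[of i] by simp
    then have "position (insert i K) t = position K t"
      unfolding position_def by (subst upto_time_insert(2)) auto
    also have "\<dots> = AP K (t *\<^sub>R lam)"
      using insert by simp
    also have "\<dots> = AP (insert i K) (t *\<^sub>R lam)"
      using AP_path_insert_last[OF insert(1-3)] \<open>time i = t\<close> by simp
    finally show ?thesis .
  qed
qed

lemma AP_path: "fin_chain K \<Longrightarrow> AP K (t *\<^sub>R lam) = t *\<^sub>R RP K lam + AP K 0"
  using conjunct1[OF AP_affine[of K "t *\<^sub>R lam"]] by (simp add: weyl_scaleR[OF RP_weyl])

lemma continuous_position:
  assumes "fin_chain K"
  shows "continuous_on {0..1} (position K)"
  using assms
proof (induction rule: fin_chain_induct)
  case empty
  then show ?case
    unfolding position_def by (simp add: continuous_intros)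
next
  case (insert i K)
  have ins: "fin_chain (insert i K)"
    using insert by (simp add: fin_chain_insert)
  have eq: "position (insert i K) t = (if t \<le> time i then position K t else AP (insert i K) (t *\<^sub>R lam))" for t
  proof (cases "t \<le> time i")
    case True
    then show ?thesis
      unfolding position_def upto_time_insert(2)[OF True] by simp
  next
    case False
    have "upto_time (insert i K) t = insert i K"
      using time_mono[OF insert(3)] False by force
    then show ?thesis using False by (simp add: position_def)
  qed
  have agree: "position K (time i) = AP (insert i K) (time i *\<^sub>R lam)"
    using position_after[OF insert(1) time_mono[OF insert(3)]] AP_path_insert_last[OF insert(1-3)] by simp
  have "continuous_on {0..1} (\<lambda>t. if t \<le> time i then position K t else AP (insert i K) (t *\<^sub>R lam))"
  proof (rule continuous_on_cases_le[where h = "\<lambda>t. t"])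
    show "continuous_on {t \<in> {0..1}. t \<le> time i} (position K)"
      by (rule continuous_on_subset[OF insert(4)]) auto
    show "continuous_on {t \<in> {0..1}. time i \<le> t} (\<lambda>t. AP (insert i K) (t *\<^sub>R lam))"
      unfolding AP_path[OF ins] by (intro continuous_intros)
  qed (use agree in \<open>auto intro: continuous_intros\<close>)
  then show ?case
    by (simp add: eq[abs_def])
qed

lemma eventually_upto_time:
  assumes K: "fin_chain K" and ev: "\<And>j. j \<in> K \<Longrightarrow> eventually (\<lambda>s. time j < s \<longleftrightarrow> time j < t) F"
  shows "eventually (\<lambda>s. position K s = s *\<^sub>R RP (upto_time K t) lam + AP (upto_time K t) 0) F"
proof -
  have "finite K" using K by (simp add: fin_chain_def)
  then have "eventually (\<lambda>s. \<forall>j\<in>K. time j < s \<longleftrightarrow> time j < t) F"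
    using ev by (simp add: eventually_ball_finite)
  then show ?thesis
  proof eventually_elim
    case (elim s)
    then have "upto_time K s = upto_time K t" by auto
    then show ?case
      by (simp add: position_def AP_path[OF fin_chain_filter[OF K]])
  qed
qed

lemma position_linear_derivative:
  "((\<lambda>s. s *\<^sub>R v + (w :: 'a)) has_vector_derivative v) (at t within A)"
  by (auto intro!: derivative_eq_intros simp: has_vector_derivative_def)

lemma position_at:
  assumes "fin_chain K"
  shows "position K t = t *\<^sub>R RP (upto_time K t) lam + AP (upto_time K t) 0"
  by (simp add: position_def AP_path[OF fin_chain_filter[OF assms]])

lemma position_left_derivative:
  assumes K: "fin_chain K"
  shows "(position K has_vector_derivative RP (upto_time K t) lam) (at_left t)"
proof -
  have "eventually (\<lambda>s. time j < s \<longleftrightarrow> time j < t) (at_left t)" for j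
  proof (cases "time j < t")
    case True
    then show ?thesis
      using eventually_at_left_real[OF True] by (auto elim: eventually_mono)
  next
    case False
    then show ?thesis
      unfolding eventually_at_filter by (auto intro: always_eventually)
  qed
  from eventually_upto_time[OF K this]
  have "eventually (\<lambda>s. s \<in> {..<t} \<longrightarrow> position K s = s *\<^sub>R RP (upto_time K t) lam + AP (upto_time K t) 0) (nhds t)"
    unfolding eventually_at_filter by (rule eventually_mono) auto
  from has_vector_derivative_cong_ev[OF this position_at[OF K]] show ?thesis
    using position_linear_derivative by blast
qed

lemma position_derivative:
  assumes K: "fin_chain K" and t: "t \<notin> time ` K"
  shows "(position K has_vector_derivative RP (upto_time K t) lam) (at t)"
proof -
  have "eventually (\<lambda>s. time j < s \<longleftrightarrow> time j < t) (nhds t)" if j: "j \<in> K" for j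
  proof (cases "time j < t")
    case True
    have "eventually (\<lambda>s. s \<in> {time j<..}) (nhds t)"
      by (rule eventually_nhds_in_open) (use True in auto)
    then show ?thesis
      by (rule eventually_mono) (use True in auto)
  next
    case False
    then have "t < time j"
      using t j by force
    have "eventually (\<lambda>s. s \<in> {..<time j}) (nhds t)"
      by (rule eventually_nhds_in_open) (use \<open>t < time j\<close> in auto)
    then show ?thesis
      by (rule eventually_mono) (use False in auto)
  qed
  then have "eventually (\<lambda>s. position K s = s *\<^sub>R RP (upto_time K t) lam + AP (upto_time K t) 0) (nhds t)"
    by (rule eventually_upto_time[OF K])
  then have "eventually (\<lambda>s. s \<in> UNIV \<longrightarrow> position K s = s *\<^sub>R RP (upto_time K t) lam + AP (upto_time K t) 0) (nhds t)"
    by (rule eventually_mono) (rule impI)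
  from has_vector_derivative_cong_ev[OF this position_at[OF K]] show ?thesis
    using position_linear_derivative by blast
qed

text \<open>\<open>position K\<close> is continuous and differentiable off the finitely many fold
  times, which is enough for the fundamental theorem. The formula for \<open>step_fun\<close> leaves
  out the time 0, a null set.\<close>

lemma position_integral:
  assumes K: "fin_chain K" and t: "0 \<le> t" "t \<le> 1"
  shows "(step_fun R lam K has_integral - position K t) {0..t}"
proof -
  have "((\<lambda>s. RP (upto_time K s) lam) has_integral (position K t - position K 0)) {0..t}"
  proof (rule fundamental_theorem_of_calculus_interior_strong)
    show "finite (time ` K)"
      using K by (simp add: fin_chain_def)
    show "(position K has_vector_derivative RP (upto_time K s) lam) (at s)" if "s \<in> {0<..<t} - time ` K" for s
      using position_derivative[OF K] that by simp
    show "continuous_on {0..t} (position K)"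
      by (rule continuous_on_subset[OF continuous_position[OF K]]) (use t in auto)
  qed (use t in simp)
  from has_integral_neg[OF this]
  have *: "((\<lambda>s. - RP (upto_time K s) lam) has_integral - position K t) {0..t}"
    by (simp add: position_0[OF K])
  have "step_fun R lam K s = - RP (upto_time K s) lam" if "s \<in> {0..t} - {0}" for s
    using step_fun_eq[OF K, of s] that t by simp
  from has_integral_spike[OF negligible_sing this *] show ?thesis .
qed

lemma path_of_eq:
  assumes "fin_chain K" "0 \<le> t" "t \<le> 1"
  shows "path_of R lam K t = - position K t"
  using integral_unique[OF position_integral[OF assms]] assms by (simp add: path_of_def)

lemma path_of_left_derivative:
  assumes K: "fin_chain K" and t: "0 < t" "t \<le> 1"
  shows "vector_derivative (path_of R lam K) (at_left t) = - RP (upto_time K t) lam"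
proof (rule vector_derivative_within)
  show "at_left t \<noteq> bot" by simp
  have der: "((\<lambda>s. - position K s) has_vector_derivative - RP (upto_time K t) lam) (at_left t)"
    by (rule has_vector_derivative_minus[OF position_left_derivative[OF K]])
  have "eventually (\<lambda>s. path_of R lam K s = - position K s) (at_left t)"
    using eventually_at_left_real[OF t(1)]
    by eventually_elim (use t in \<open>auto intro: path_of_eq[OF K]\<close>)
  then have "eventually (\<lambda>s. s \<in> {..<t} \<longrightarrow> path_of R lam K s = - position K s) (nhds t)"
    unfolding eventually_at_filter by (rule eventually_mono) auto
  from has_vector_derivative_cong_ev[OF this path_of_eq[OF K]] der t
  show "(path_of R lam K has_vector_derivative - RP (upto_time K t) lam) (at_left t)"
    by simp
qed

end

context km_crystal
begin

text \<open>After \<open>time i\<close> all indices before \<open>i\<close> are present, so the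
  folded root at \<open>i\<close> is the same for \<open>upto_time K s\<close> as for
  \<open>K\<close>, and toggling \<open>i\<close> multiplies by s_p. Up to \<open>time i\<close> the
  index is not yet seen.\<close>

lemma RP_upto_time_toggle:
  assumes K: "fin_chain K" and i: "i \<in> chain"
    and root: "RP {j \<in> K. j \<lhd> i} (fst i) = sr p \<or> RP {j \<in> K. j \<lhd> i} (fst i) = - sr p"
  shows "RP (upto_time (sym_diff K {i}) s) = (if time i < s then simple_refl p \<circ> RP (upto_time K s) else RP (upto_time K s))"
proof (cases "time i < s")
  case True
  have "upto_time (sym_diff K {i}) s = sym_diff (upto_time K s) {i}"
    using True by auto
  moreover have "time j < s" if "j \<lhd> i" for j
    using time_mono[OF that] True by simp
  then have "{j \<in> upto_time K s. j \<lhd> i} = {j \<in> K. j \<lhd> i}"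
    by blast
  moreover have "reflection R (RP {j \<in> K. j \<lhd> i} (fst i)) = simple_refl p"
    using root reflection_minus by auto
  ultimately show ?thesis
    using RP_toggle[OF fin_chain_filter[OF K] i, of "\<lambda>j. time j < s"] True by simp
next
  case False
  then have "upto_time (sym_diff K {i}) s = upto_time K s" by auto
  then show ?thesis using False by simp
qed

end

context km_walk
begin

subsection \<open>The combinatorial root operator\<close>

lemma fold_root_zs:
  assumes "n < L"
  shows "fold_root R lam rho J (zs ! n) = sr p \<longleftrightarrow> fst (zs ! n) = dir n"
    and "fold_root R lam rho J (zs ! n) = - sr p \<longleftrightarrow> fst (zs ! n) = - dir n"
  unfolding fold_root_eq(1)[OF J zs_nth_chain[OF assms]] cut_eq[OF assms, symmetric] dir_def
  using RP_eq_iff[OF cut] by blast+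

lemma fold_root_hit:
  assumes "n < L" "hit n"
  shows "fold_root R lam rho J (zs ! n) = (if sg n then sr p else - sr p)"
  using hit_root[OF assms] fold_root_zs[OF assms(1)] by simp

text \<open>If the folded root at \<open>i\<close> is \<open>\<plusminus> sr p\<close>, then
  \<open>fst i\<close> is \<open>\<plusminus> eta K\<close> for the set \<open>K\<close> of folds
  before \<open>i\<close>. Hence \<open>i\<close> is a wall, and restricting attention to walls
  loses no index.\<close>

lemma root_indices_eq: "root_indices R lam rho p J = (\<lambda>n. zs ! n) ` {n. n < L \<and> hit n}"
proof (intro equalityI subsetI)
  fix i assume "i \<in> root_indices R lam rho p J"
  then have i: "i \<in> chain" "fold_root R lam rho J i = sr p \<or> fold_root R lam rho J i = - sr p"
    by (auto simp: root_indices_def)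
  define K where "K = {j \<in> J. j \<lhd> i}"
  have K: "K \<subseteq> J" "fin_chain K"
    by (auto simp: K_def intro: J_subset)
  have "RP K (fst i) = sr p \<or> RP K (fst i) = - sr p"
    using i(2) unfolding fold_root_eq(1)[OF J i(1)] K_def .
  then have "fst i = eta K \<or> fst i = - eta K"
    using RP_eq_iff[OF K(2)] by blast
  then have "fst i \<in> wall_roots"
    using K(1) chain_pos_root[OF i(1)] unfolding wall_roots_def by blast
  then obtain n where n: "n < L" "zs ! n = i"
    using walls_nth[of i] i(1) by (auto simp: walls_def)
  then have "hit n"
    using i(2) fold_root_zs[OF n(1), of rho] by (auto simp: hit_def)
  with n show "i \<in> (\<lambda>n. zs ! n) ` {n. n < L \<and> hit n}"
    by blast
next
  fix i assume "i \<in> (\<lambda>n. zs ! n) ` {n. n < L \<and> hit n}"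
  then obtain n where n: "n < L" "hit n" "i = zs ! n" by blast
  then show "i \<in> root_indices R lam rho p J"
    using fold_root_hit[OF n(1,2), of rho] zs_nth_chain[OF n(1)] by (simp add: root_indices_def)
qed

lemma neg_sroot_not_pos: "- sr p \<notin> pos_roots R"
  using neg_root_iff[OF sroot_root[OF p]] sroot_pos[OF p] by simp

text \<open>The indices in the sum are the earlier hits that are not folds of \<open>J\<close>, and
  the sign of the folded root at a hit is the one recorded by \<open>sg\<close>; so the sum is
  \<open>S n\<close>.\<close>

lemma level_eq:
  assumes n: "n < L" "hit n"
  shows "level R lam rho J (zs ! n) = Lv n"
proof -
  define g where "g = fold_root R lam rho J"
  define e where "e = fold_sign R lam rho J"
  have g: "g (zs ! i) = (if sg i then sr p else - sr p)" if "i < L" "hit i" for i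
    using fold_root_hit[OF that] by (simp add: g_def)
  have "{j. j \<in> chain \<and> j \<lhd> zs ! n \<and> e j = 1 \<and> (g j = g (zs ! n) \<or> g j = - g (zs ! n))}
      = {j \<in> root_indices R lam rho p J. j \<lhd> zs ! n \<and> j \<notin> J}"
    using g[OF n] by (auto simp: root_indices_def g_def e_def fold_root_eq(2)[OF J] split: if_splits)
  also have "\<dots> = (\<lambda>i. zs ! i) ` {i \<in> {..<n}. hit i \<and> \<not> turn i}"
    using zs_before_iff[OF _ n(1)] n(1) unfolding root_indices_eq turn_def by auto
  finally have set: "{j. j \<in> chain \<and> j \<lhd> zs ! n \<and> e j = 1 \<and> (g j = g (zs ! n) \<or> g j = - g (zs ! n))}
      = (\<lambda>i. zs ! i) ` {i \<in> {..<n}. hit i \<and> \<not> turn i}" .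
  have inj: "inj_on (\<lambda>i. zs ! i) {i \<in> {..<n}. hit i \<and> \<not> turn i}"
    using zs_inj n(1) by (auto intro!: inj_onI)
  have "(\<Sum>i\<in>{i \<in> {..<n}. hit i \<and> \<not> turn i}. root_sgn R (g (zs ! i))) = (\<Sum>i\<in>{i \<in> {..<n}. hit i \<and> \<not> turn i}. if sg i then 1 else - 1)"
    by (rule sum.cong) (use g n(1) sroot_pos[OF p] neg_sroot_not_pos in \<open>auto simp: root_sgn_def\<close>)
  also have "\<dots> = S n"
    unfolding S_def by (rule sum.inter_filter) simp
  finally have sum: "(\<Sum>i\<in>{i \<in> {..<n}. hit i \<and> \<not> turn i}. root_sgn R (g (zs ! i))) = S n" .
  have "level R lam rho J (zs ! n) = (if g (zs ! n) \<in> pos_roots R then 0 else - 1) + S n"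
    unfolding level_def Let_def g_def[symmetric] e_def[symmetric] set sum.reindex[OF inj] comp_def sum ..
  also have "\<dots> = Lv n"
    using g[OF n] sroot_pos[OF p] neg_sroot_not_pos by (simp add: Lv_def)
  finally show ?thesis .
qed

lemma pairing_weight: "pairing R (weight R lam J) (sr p) = of_int (Lv L)"
  using final_height by (simp add: weight_eq[OF J] ht_def height_def cut_L)

lemma max_level_eq: "max_level R lam rho p J = of_int peak"
proof -
  have "(\<lambda>i. real_of_int (level R lam rho J i)) ` root_indices R lam rho p J \<union> {pairing R (weight R lam J) (sr p)}
      = real_of_int ` (Lv ` stops)"
    unfolding root_indices_eq pairing_weight stops_def image_Un image_image
    using level_eq by (auto simp: image_iff)
  then have "max_level R lam rho p J = Max (real_of_int ` (Lv ` stops))"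
    by (simp add: max_level_def)
  also have "\<dots> = real_of_int (Max (Lv ` stops))"
    by (rule mono_Max_commute[symmetric]) (auto simp: mono_def finite_stops stops_def)
  finally show ?thesis
    by (simp add: peak_def)
qed

lemma first_max_eq:
  assumes m: "m \<in> stops" "Lv m = peak" "\<And>n. n \<in> stops \<Longrightarrow> n < m \<Longrightarrow> Lv n < peak"
  shows "first_max R lam rho p J = (if m = L then None else Some (zs ! m))"
proof -
  define A where "A = {i \<in> root_indices R lam rho p J. of_int (level R lam rho J i) = max_level R lam rho p J}"
  have A: "A = (\<lambda>n. zs ! n) ` {n. n < L \<and> hit n \<and> Lv n = peak}"
  proof -
    have "of_int (level R lam rho J (zs ! n)) = (of_int peak :: real) \<longleftrightarrow> Lv n = peak" if "n < L" "hit n" for n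
      using level_eq[OF that] by simp
    then show ?thesis
      unfolding A_def root_indices_eq max_level_eq by blast
  qed
  have ge: "m \<le> n" if "n < L" "hit n" "Lv n = peak" for n
  proof (rule ccontr)
    assume "\<not> m \<le> n"
    then show False
      using m(3)[of n] that by (simp add: stops_def)
  qed
  show ?thesis
  proof (cases "m = L")
    case True
    then have "A = {}"
      using ge unfolding A by (metis (mono_tags, lifting) empty_Collect_eq image_empty not_le)
    then show ?thesis
      using True unfolding first_max_def A_def Let_def by simp
  next
    case False
    then have mL: "m < L" "hit m"
      using m(1) by (auto simp: stops_def)
    have "(THE i. i \<in> A \<and> (\<forall>j\<in>A. j \<noteq> i \<longrightarrow> i \<lhd> j)) = zs ! m"
    proof (rule the_equality)
      have "zs ! m \<lhd> zs ! n" if "n < L" "hit n" "Lv n = peak" "zs ! n \<noteq> zs ! m" for n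
      proof -
        have "m < n"
          using ge[OF that(1-3)] that(4) by (cases "m = n") auto
        then show ?thesis
          using that(1) by (rule zs_before)
      qed
      then show *: "zs ! m \<in> A \<and> (\<forall>j\<in>A. j \<noteq> zs ! m \<longrightarrow> zs ! m \<lhd> j)"
        using mL m(2) unfolding A by blast
      show "i = zs ! m" if i: "i \<in> A \<and> (\<forall>j\<in>A. j \<noteq> i \<longrightarrow> i \<lhd> j)" for i
      proof (rule ccontr)
        assume "i \<noteq> zs ! m"
        then have "i \<lhd> zs ! m" "zs ! m \<lhd> i"
          using i * by metis+
        then show False
          using before_asym by blast
      qed
    qed
    moreover have "A \<noteq> {}"
      using mL m(2) unfolding A by blast
    ultimately show ?thesis
      using False unfolding first_max_def A_def[symmetric] Let_def by simp
  qed
qed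

lemma predecessor_eq:
  assumes m: "m \<in> stops" and k: "k < m" "hit k" "\<And>n. k < n \<Longrightarrow> n < m \<Longrightarrow> \<not> hit n"
  shows "predecessor R lam rho p J (if m = L then None else Some (zs ! m)) = zs ! k"
proof -
  define b where "b = (if m = L then None else Some (zs ! m))"
  have mL: "m \<le> L"
    using m by (auto simp: stops_def)
  have below: "below R lam (zs ! n) b \<longleftrightarrow> n < m" if "n < L" for n
    using that mL zs_before_iff[OF that, of m] by (auto simp: b_def below_def)
  have kL: "k < L"
    using k(1) mL by simp
  have "(THE i. i \<in> root_indices R lam rho p J \<and> below R lam i b \<and>
      (\<forall>j\<in>root_indices R lam rho p J. below R lam j b \<and> j \<noteq> i \<longrightarrow> j \<lhd> i)) = zs ! k"
  proof (rule the_equality)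
    have "zs ! n \<lhd> zs ! k" if "n < L" "hit n" "below R lam (zs ! n) b" "zs ! n \<noteq> zs ! k" for n
    proof -
      have "n < m"
        using below[OF that(1)] that(3) by simp
      then have "n < k"
        using k(3)[of n] that(2,4) by (cases n k rule: linorder_cases) auto
      then show ?thesis
        using kL by (rule zs_before)
    qed
    then show *: "zs ! k \<in> root_indices R lam rho p J \<and> below R lam (zs ! k) b \<and>
      (\<forall>j\<in>root_indices R lam rho p J. below R lam j b \<and> j \<noteq> zs ! k \<longrightarrow> j \<lhd> zs ! k)"
      using kL k below[OF kL] unfolding root_indices_eq by blast
    show "i = zs ! k" if "i \<in> root_indices R lam rho p J \<and> below R lam i b \<and>
      (\<forall>j\<in>root_indices R lam rho p J. below R lam j b \<and> j \<noteq> i \<longrightarrow> j \<lhd> i)" for i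
    proof (rule ccontr)
      assume "i \<noteq> zs ! k"
      then have "i \<lhd> zs ! k" "zs ! k \<lhd> i"
        using that * by metis+
      then show False
        using before_asym by blast
    qed
  qed
  then show ?thesis
    unfolding predecessor_def b_def .
qed

subsection \<open>Heights along the path\<close>

text \<open>The function h_p of the path with opposite sign, so that it can be compared with levels
  directly.\<close>

definition rise :: "real \<Rightarrow> real" where
  "rise t = pairing R (position J t) (sr p)"

definition slope :: "real \<Rightarrow> real" where
  "slope t = pairing R (RP (upto_time J t) lam) (sr p)"

lemma rise_at_time:
  assumes "at_time t n"
  shows "rise t = ht n (t *\<^sub>R lam)" "slope t = pairing R lam (dir n)"
proof -
  show "rise t = ht n (t *\<^sub>R lam)"
    by (simp add: rise_def position_def at_time_cut[OF assms] ht_def height_def)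
  have "pairing R (RP (cut n) lam) (RP (cut n) (dir n)) = pairing R lam (dir n)"
    by (rule weyl_pairing[OF RP_weyl[OF cut]])
  then show "slope t = pairing R lam (dir n)"
    by (simp add: slope_def at_time_cut[OF assms] dir_def RP_eta[OF cut])
qed

lemma rise_0: "rise 0 = 0"
  by (simp add: rise_def position_0[OF J] pairing_lin)

lemma rise_1: "rise 1 = of_int (Lv L)"
proof -
  have "time j \<le> 1" if "j \<in> J" for j
    using time_range(2)[OF J_chain[OF that]] by simp
  then show ?thesis
    using position_after[OF J, of 1] final_height by (simp add: rise_def ht_def height_def cut_L)
qed

text \<open>\<open>cut n\<close> may contain folds simultaneous with the \<open>n\<close>-th wall,
  which \<open>upto_time\<close> omits; by \<open>position_after\<close> they do not move the
  point.\<close>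

lemma rise_hit:
  assumes "n < L" "hit n"
  shows "rise (time (zs ! n)) = of_int (Lv n)"
proof -
  define t where "t = time (zs ! n)"
  have "j \<lhd> zs ! n" if "j \<in> J" "time j < t" for j
  proof -
    have "\<not> zs ! n \<lhd> j" "j \<noteq> zs ! n"
      using that(2) time_mono[of "zs ! n" j] by (auto simp: t_def)
    then show ?thesis
      using before_total[OF J_chain[OF that(1)] zs_nth_chain[OF assms(1)]] by blast
  qed
  then have "upto_time J t = upto_time (cut n) t"
    unfolding cut_eq[OF assms(1)] by blast
  then have "position J t = position (cut n) t"
    by (simp add: position_def)
  also have "\<dots> = AP (cut n) (t *\<^sub>R lam)"
    using time_mono[OF cut_before[OF assms(1)]] by (intro position_after[OF cut]) (simp add: t_def)
  finally show ?thesis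
    using hit_height[OF assms] by (simp add: rise_def ht_def height_def t_def)
qed

lemma rise_le_peak:
  assumes "0 \<le> t" "t \<le> 1"
  shows "rise t \<le> of_int peak"
proof (cases "t = 0")
  case True
  then show ?thesis
    using S_le_peak[of 0] by (simp add: rise_0 S_0)
next
  case False
  obtain n where n: "at_time t n"
    using at_time_exists by blast
  have "rise t \<le> of_int (S n)"
    using height_bounds(2)[OF _ assms(2) n] False assms(1) by (simp add: rise_at_time(1)[OF n])
  also have "\<dots> \<le> of_int peak"
    using S_le_peak[of n] n by (simp add: at_time_def)
  finally show ?thesis .
qed

lemma bounded_linear_pairing: "bounded_linear (\<lambda>v. pairing R v a)"
  using linear_pairing by (simp add: linear_conv_bounded_linear)

lemma rise_left_derivative: "(rise has_vector_derivative slope t) (at_left t)"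
  unfolding rise_def slope_def
  by (rule bounded_linear.has_vector_derivative[OF bounded_linear_pairing position_left_derivative[OF J]])

lemma continuous_rise: "continuous_on {0..1} rise"
  unfolding rise_def
  by (rule bounded_linear.continuous_on[OF bounded_linear_pairing continuous_position[OF J]])

lemma rise_integral:
  assumes "0 \<le> a" "a \<le> b" "b \<le> 1"
  shows "(slope has_integral (rise b - rise a)) {a..b}"
proof (rule fundamental_theorem_of_calculus_interior_strong)
  show "finite (time ` J)"
    using J by (simp add: fin_chain_def)
  show "(rise has_vector_derivative slope s) (at s)" if "s \<in> {a<..<b} - time ` J" for s
    unfolding rise_def slope_def
    by (rule bounded_linear.has_vector_derivative[OF bounded_linear_pairing position_derivative[OF J]])
       (use that in simp)
  show "continuous_on {a..b} rise"
    by (rule continuous_on_subset[OF continuous_rise]) (use assms in auto)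
qed (use assms in simp)

lemma rise_mono:
  assumes "0 \<le> a" "a \<le> b" "b \<le> 1" "\<And>s. a < s \<Longrightarrow> s \<le> b \<Longrightarrow> 0 \<le> slope s"
  shows "rise a \<le> rise b"
proof -
  have "((\<lambda>s. if s = a then 0 else slope s) has_integral (rise b - rise a)) {a..b}"
    by (rule has_integral_spike[OF negligible_sing[of a] _ rise_integral[OF assms(1-3)]]) simp
  then have "0 \<le> rise b - rise a"
    by (rule has_integral_nonneg) (use assms(4) in auto)
  then show ?thesis by simp
qed

lemma slope_eq_0:
  assumes "a < s" "\<And>x. a < x \<Longrightarrow> x \<le> s \<Longrightarrow> rise x = c"
  shows "slope s = 0"
proof (rule vector_derivative_unique_within)
  show "at_left s \<noteq> bot" by simp
  show "(rise has_vector_derivative slope s) (at_left s)"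
    by (rule rise_left_derivative)
  have "eventually (\<lambda>x. x \<in> {a<..}) (nhds s)"
    by (rule eventually_nhds_in_open) (use assms(1) in auto)
  then have "eventually (\<lambda>x. x \<in> {..<s} \<longrightarrow> rise x = c) (nhds s)"
    by (rule eventually_mono) (use assms(2) in auto)
  moreover have "rise s = c"
    using assms by simp
  ultimately have "(rise has_vector_derivative 0) (at_left s) = ((\<lambda>_. c) has_vector_derivative 0) (at_left s)"
    by (rule has_vector_derivative_cong_ev)
  then show "(rise has_vector_derivative 0) (at_left s)"
    by simp
qed

lemma path_pairing: "0 \<le> t \<Longrightarrow> t \<le> 1 \<Longrightarrow> pairing R (path_of R lam J t) (sr p) = - rise t"
  by (simp add: path_of_eq[OF J] rise_def pairing_lin)

lemma INF_path: "(INF t\<in>{0..1}. pairing R (path_of R lam J t) (sr p)) = - of_int peak"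
proof -
  obtain n where n: "n \<in> stops" "Lv n = peak"
    using peak_attained by blast
  have "\<exists>t. 0 \<le> t \<and> t \<le> 1 \<and> rise t = of_int peak"
  proof (cases "n = L")
    case True
    then show ?thesis
      using n rise_1 by (intro exI[of _ 1]) simp
  next
    case False
    then have "n < L" "hit n"
      using n by (auto simp: stops_def)
    then show ?thesis
      using n(2) rise_hit time_range[OF zs_nth_chain[of n]] by (intro exI[of _ "time (zs ! n)"]) simp
  qed
  then obtain t where t: "0 \<le> t" "t \<le> 1" "rise t = of_int peak" by blast
  show ?thesis
  proof (rule cInf_eq_minimum)
    show "- of_int peak \<in> (\<lambda>t. pairing R (path_of R lam J t) (sr p)) ` {0..1}"
      using t path_pairing[OF t(1,2)] by (intro image_eqI[of _ _ t]) auto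
    show "- of_int peak \<le> x" if "x \<in> (\<lambda>t. pairing R (path_of R lam J t) (sr p)) ` {0..1}" for x
      using that rise_le_peak by (auto simp: path_pairing)
  qed
qed

subsection \<open>The root operator on paths\<close>

lemma reflected_step:
  assumes "slope s = 0"
  shows "simple_refl p (- RP (upto_time J s) lam) = - RP (upto_time J s) lam"
  using assms by (simp add: reflection_def slope_def pairing_lin)

text \<open>By \<open>up\<close> the function \<open>rise\<close> increases weakly from
  \<open>a\<close> to \<open>b\<close>. This squeezes it to \<open>peak - 1\<close> on
  \<open>(a, t0]\<close> and to \<open>peak\<close> on \<open>(t1, b]\<close>, and its slope
  vanishes on both.\<close>

lemma E_op_eq:
  assumes peak: "peak > 0" and a: "0 \<le> a" "a < b" "b \<le> 1"
    and rise_ab: "rise a = of_int peak - 1" "rise b = of_int peak"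
    and low: "\<And>t. 0 \<le> t \<Longrightarrow> t \<le> a \<Longrightarrow> rise t \<le> of_int peak - 1"
    and up: "\<And>t. a < t \<Longrightarrow> t \<le> b \<Longrightarrow> 0 \<le> slope t"
  shows "E_op R p (path_of R lam J) = Some (\<lambda>t\<in>{0..1}. integral {0..t}
    (\<lambda>s. if a < s \<and> s \<le> b then simple_refl p (- RP (upto_time J s) lam) else - RP (upto_time J s) lam))"
proof -
  have mono: "rise x \<le> rise y" if "a \<le> x" "x \<le> y" "y \<le> b" for x y
    using that a up by (intro rise_mono) auto
  have "compact {t \<in> {0..b}. rise t = of_int peak}"
  proof -
    have "continuous_on {0..b} rise"
      by (rule continuous_on_subset[OF continuous_rise]) (use a in auto)
    then have "closed {t \<in> {0..b}. rise t = of_int peak}"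
      by (rule continuous_closed_preimage_constant) simp
    then show ?thesis
      unfolding compact_eq_bounded_closed by (intro conjI bounded_subset[OF bounded_closed_interval[of 0 b]]) auto
  qed
  moreover have "b \<in> {t \<in> {0..b}. rise t = of_int peak}"
    using a rise_ab by simp
  ultimately obtain t1 where t1: "0 \<le> t1" "t1 \<le> b" "rise t1 = of_int peak"
    and t1_least: "\<And>t. 0 \<le> t \<Longrightarrow> t \<le> b \<Longrightarrow> rise t = of_int peak \<Longrightarrow> t1 \<le> t"
    using compact_attains_inf[of "{t \<in> {0..b}. rise t = of_int peak}"] by force
  have at1: "a < t1"
    using low[of t1] t1 by force
  \<comment> \<open>\<open>t0\<close> is found as the last time up to \<open>t1\<close> with low
    \<open>rise\<close>. That all earlier times are low too, as the definition of
    \<open>E_op\<close> requires, follows from \<open>low\<close> up to \<open>a\<close> and from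
    monotonicity after \<open>a\<close>.\<close>
  have "compact {t \<in> {0..t1}. rise t \<le> of_int peak - 1}"
  proof -
    have "continuous_on {0..t1} rise"
      by (rule continuous_on_subset[OF continuous_rise]) (use a t1 in auto)
    then have "closed ({0..t1} \<inter> rise -` {..of_int peak - 1})"
      by (rule continuous_closed_preimage) auto
    then have "closed {t \<in> {0..t1}. rise t \<le> of_int peak - 1}"
      by (simp add: vimage_def Int_def)
    then show ?thesis
      unfolding compact_eq_bounded_closed by (intro conjI bounded_subset[OF bounded_closed_interval[of 0 t1]]) auto
  qed
  moreover have "a \<in> {t \<in> {0..t1}. rise t \<le> of_int peak - 1}"
    using a at1 rise_ab by simp
  ultimately obtain t0 where t0: "0 \<le> t0" "t0 \<le> t1" "rise t0 \<le> of_int peak - 1"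
    and t0_max: "\<And>t. 0 \<le> t \<Longrightarrow> t \<le> t1 \<Longrightarrow> rise t \<le> of_int peak - 1 \<Longrightarrow> t \<le> t0"
    using compact_attains_sup[of "{t \<in> {0..t1}. rise t \<le> of_int peak - 1}"] by force
  have at0: "a \<le> t0"
    using t0_max[of a] a at1 rise_ab by simp
  have low0: "rise t \<le> of_int peak - 1" if "0 \<le> t" "t \<le> t0" for t
  proof (cases "t \<le> a")
    case False
    then have "rise t \<le> rise t0"
      using that t0 t1 by (intro mono) auto
    then show ?thesis using t0 by simp
  qed (use low that in auto)
  have T1: "(LEAST t. t \<in> {0..1} \<and> pairing R (path_of R lam J t) (sr p) = - of_int peak) = t1"
  proof (rule Least_equality)
    show "t1 \<in> {0..1} \<and> pairing R (path_of R lam J t1) (sr p) = - of_int peak"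
      using t1 a path_pairing[of t1] by simp
    show "t1 \<le> t" if "t \<in> {0..1} \<and> pairing R (path_of R lam J t) (sr p) = - of_int peak" for t
      using that t1 t1_least[of t] by (cases "t \<le> b") (auto simp: path_pairing)
  qed
  have T0: "(GREATEST t. t \<in> {0..t1} \<and> (\<forall>s\<in>{0..t}. - of_int peak + 1 \<le> pairing R (path_of R lam J s) (sr p))) = t0"
  proof (rule Greatest_equality)
    show "t0 \<in> {0..t1} \<and> (\<forall>s\<in>{0..t0}. - of_int peak + 1 \<le> pairing R (path_of R lam J s) (sr p))"
      using t0 low0 t1 a by (force simp: path_pairing)
    show "t \<le> t0" if "t \<in> {0..t1} \<and> (\<forall>s\<in>{0..t}. - of_int peak + 1 \<le> pairing R (path_of R lam J s) (sr p))" for t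
    proof -
      have "- of_int peak + 1 \<le> pairing R (path_of R lam J t) (sr p)"
        using that by auto
      then show ?thesis
        using that t0_max[of t] t1 a by (auto simp: path_pairing)
    qed
  qed
  have integrand: "(if t0 < s \<and> s \<le> t1 then simple_refl p (vector_derivative (path_of R lam J) (at_left s))
        else vector_derivative (path_of R lam J) (at_left s))
      = (if a < s \<and> s \<le> b then simple_refl p (- RP (upto_time J s) lam) else - RP (upto_time J s) lam)"
    if s: "0 < s" "s \<le> 1" for s
  proof -
    note der = path_of_left_derivative[OF J s]
    consider "s \<le> a" | "a < s" "s \<le> t0" | "t0 < s" "s \<le> t1" | "t1 < s" "s \<le> b" | "b < s"
      by linarith
    then show ?thesis
    proof cases
      case 2
      have "slope s = 0"
      proof (rule slope_eq_0[OF 2(1)])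
        fix x assume x: "a < x" "x \<le> s"
        then have "rise a \<le> rise x"
          using 2 t0 t1 by (intro mono) auto
        moreover have "rise x \<le> of_int peak - 1"
          using x 2 a by (intro low0) auto
        ultimately show "rise x = of_int peak - 1"
          using rise_ab by simp
      qed
      then show ?thesis
        using 2 t0 t1 reflected_step by (simp add: der)
    next
      case 4
      have "slope s = 0"
      proof (rule slope_eq_0[OF 4(1)])
        fix x assume x: "t1 < x" "x \<le> s"
        then have "rise t1 \<le> rise x"
          using 4 at1 by (intro mono) auto
        moreover have "rise x \<le> of_int peak"
          using x 4 a t1 by (intro rise_le_peak) auto
        ultimately show "rise x = of_int peak"
          using t1 by simp
      qed
      then show ?thesis
        using 4 at1 reflected_step by (simp add: der)
    qed (use at0 at1 t0 t1 in \<open>auto simp: der\<close>)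
  qed
  have "E_op R p (path_of R lam J) = Some (\<lambda>t\<in>{0..1}. integral {0..t}
      (\<lambda>s. if t0 < s \<and> s \<le> t1 then simple_refl p (vector_derivative (path_of R lam J) (at_left s))
        else vector_derivative (path_of R lam J) (at_left s)))"
    using peak unfolding E_op_def Let_def INF_path T1 T0 by simp
  also have "\<dots> = Some (\<lambda>t\<in>{0..1}. integral {0..t}
    (\<lambda>s. if a < s \<and> s \<le> b then simple_refl p (- RP (upto_time J s) lam) else - RP (upto_time J s) lam))"
  proof (rule arg_cong[where f = Some], rule restrict_ext)
    fix t :: real assume t: "t \<in> {0..1}"
    show "integral {0..t} (\<lambda>s. if t0 < s \<and> s \<le> t1 then simple_refl p (vector_derivative (path_of R lam J) (at_left s))
        else vector_derivative (path_of R lam J) (at_left s))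
      = integral {0..t} (\<lambda>s. if a < s \<and> s \<le> b then simple_refl p (- RP (upto_time J s) lam) else - RP (upto_time J s) lam)"
      by (rule integral_spike[OF negligible_sing[of 0]]) (use t integrand in auto)
  qed
  finally show ?thesis .
qed

theorem root_operators_agree:
  "E_op R p (path_of R lam J) = map_option (path_of R lam) (F_op R lam rho p J)"
proof (cases "peak > 0")
  case False
  then have "E_op R p (path_of R lam J) = None"
    unfolding E_op_def Let_def INF_path by simp
  moreover have "F_op R lam rho p J = None"
    using False by (simp add: F_op_def max_level_eq)
  ultimately show ?thesis by simp
next
  case True
  obtain k m where m: "m \<in> stops" "Lv m = peak" "\<And>n. n \<in> stops \<Longrightarrow> n < m \<Longrightarrow> Lv n < peak"
    and k: "k < m" "hit k" "Lv k = peak - 1" "\<And>n. k < n \<Longrightarrow> n < m \<Longrightarrow> \<not> hit n"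
    and between: "\<And>n. k < n \<Longrightarrow> n \<le> m \<Longrightarrow> S n = peak \<and> sg n"
    and before: "\<And>n. n \<le> k \<Longrightarrow> S n \<le> peak - 1"
    by (rule ascent_to_top[OF True]) (rule that)
  have mL: "m \<le> L" and kL: "k < L"
    using m(1) k(1) by (auto simp: stops_def)
  define a where "a = time (zs ! k)"
  \<comment> \<open>The stop \<open>L\<close> plays the index \<infinity>, whose time is the end of
    the path.\<close>
  define b where "b = (if m = L then 1 else time (zs ! m))"
  define J' where "J' = sym_diff J (if m = L then {zs ! k} else {zs ! k, zs ! m})"
  have F: "F_op R lam rho p J = Some J'"
  proof -
    have "first_max R lam rho p J = (if m = L then None else Some (zs ! m))"
      by (rule first_max_eq[OF m(1,2)]) (rule m(3))
    moreover have "predecessor R lam rho p J (if m = L then None else Some (zs ! m)) = zs ! k"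
      by (rule predecessor_eq[OF m(1) k(1,2)]) (rule k(4))
    ultimately show ?thesis
      using True unfolding F_op_def Let_def max_level_eq J'_def by auto
  qed
  have a: "0 \<le> a" "a < 1"
    using time_range[OF zs_nth_chain[OF kL]] by (auto simp: a_def)
  have m': "m < L" "hit m" if "m \<noteq> L"
    using that m(1) by (auto simp: stops_def)
  have rise_a: "rise a = of_int peak - 1"
    using rise_hit[OF kL k(2)] k(3) by (simp add: a_def)
  have rise_b: "rise b = of_int peak"
  proof (cases "m = L")
    case True
    then show ?thesis using rise_1 m(2) by (simp add: b_def)
  next
    case False
    then show ?thesis using rise_hit[OF m'[OF False]] m(2) by (simp add: b_def)
  qed
  have "a \<le> b \<and> b \<le> 1"
  proof (cases "m = L")
    case True
    then show ?thesis using a by (simp add: b_def)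
  next
    case False
    note m'(1)[OF False]
    then show ?thesis
      using time_mono[OF zs_before[OF k(1)]] time_range(2)[OF zs_nth_chain] False
      by (simp add: a_def b_def less_imp_le)
  qed
  \<comment> \<open>Different walls may share a time; it is the difference of the heights that
    separates \<open>a\<close> from \<open>b\<close>.\<close>
  then have ab: "a < b" "b \<le> 1"
    using rise_a rise_b by (auto simp: less_le)
  have low: "rise t \<le> of_int peak - 1" if t: "0 \<le> t" "t \<le> a" for t
  proof (cases "t = 0")
    case True
    then show ?thesis using \<open>peak > 0\<close> by (simp add: rise_0)
  next
    case False
    obtain n where n: "at_time t n"
      using at_time_exists by blast
    have "n \<le> k"
    proof (rule ccontr)
      assume "\<not> n \<le> k"
      then have "a < t"
        using n by (simp add: at_time_def a_def)
      then show False using t by simp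
    qed
    then have "S n \<le> peak - 1"
      by (rule before)
    then have "(of_int (S n) :: real) \<le> of_int peak - 1"
      by linarith
    moreover have "rise t \<le> of_int (S n)"
      using height_bounds(2)[OF _ _ n] False t a by (simp add: rise_at_time(1)[OF n])
    ultimately show ?thesis by simp
  qed
  have up: "0 \<le> slope t" if t: "a < t" "t \<le> b" for t
  proof -
    obtain n where n: "at_time t n"
      using at_time_exists by blast
    have "k < n"
    proof (rule ccontr)
      assume "\<not> k < n"
      then have "t \<le> a"
        using n kL by (simp add: at_time_def a_def)
      then show False using t by simp
    qed
    moreover have "n \<le> m"
    proof (rule ccontr)
      assume "\<not> n \<le> m"
      then have "time (zs ! m) < t" "m \<noteq> L"
        using n by (auto simp: at_time_def)
      then show False using t by (simp add: b_def)
    qed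
    ultimately have "sg n"
      using between by blast
    then show ?thesis
      using dom_nonneg by (simp add: rise_at_time(2)[OF n] sg_def)
  qed
  have J': "fin_chain J'"
  proof (cases "m = L")
    case True
    then show ?thesis
      using J zs_nth_chain[OF kL] by (auto simp: J'_def fin_chain_def)
  next
    case False
    then show ?thesis
      using J zs_nth_chain[OF kL] zs_nth_chain[OF m'(1)[OF False]] by (auto simp: J'_def fin_chain_def)
  qed
  have root: "RP {j \<in> J. j \<lhd> zs ! n} (fst (zs ! n)) = sr p \<or> RP {j \<in> J. j \<lhd> zs ! n} (fst (zs ! n)) = - sr p"
    if "n < L" "hit n" for n
    using that(2) RP_eq_iff[OF cut] unfolding cut_eq[OF that(1), symmetric] hit_def dir_def by blast
  have step: "RP (upto_time J' s) v = (if a < s \<and> s \<le> b then simple_refl p (RP (upto_time J s) v) else RP (upto_time J s) v)"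
    if s: "s \<le> 1" for s v
  proof (cases "m = L")
    case True
    then have J'_eq: "J' = sym_diff J {zs ! k}"
      by (simp add: J'_def)
    show ?thesis
      unfolding J'_eq RP_upto_time_toggle[OF J zs_nth_chain[OF kL] root[OF kL k(2)]]
      using s True by (simp add: a_def b_def)
  next
    case False
    note m'' = m'[OF False]
    \<comment> \<open>Toggling the later index \<open>m\<close> first leaves the folds before
      \<open>k\<close> untouched, so the folded root at \<open>k\<close> is still
      \<open>\<plusminus> sr p\<close>.\<close>
    define K where "K = sym_diff J {zs ! m}"
    have K: "fin_chain K"
      using J zs_nth_chain[OF m''(1)] by (auto simp: K_def fin_chain_def)
    have lt: "zs ! k \<lhd> zs ! m"
      using zs_before[OF k(1) m''(1)] .
    have "zs ! k \<noteq> zs ! m"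
      using lt by auto
    then have J'_eq: "J' = sym_diff K {zs ! k}"
      using False unfolding J'_def K_def by auto
    have "\<not> zs ! m \<lhd> zs ! k"
      using before_asym[OF lt] .
    then have "{j \<in> K. j \<lhd> zs ! k} = {j \<in> J. j \<lhd> zs ! k}"
      unfolding K_def by blast
    then have rootK: "RP {j \<in> K. j \<lhd> zs ! k} (fst (zs ! k)) = sr p \<or> RP {j \<in> K. j \<lhd> zs ! k} (fst (zs ! k)) = - sr p"
      using root[OF kL k(2)] by simp
    have K_step: "RP (upto_time K s) = (if b < s then simple_refl p \<circ> RP (upto_time J s) else RP (upto_time J s))"
      unfolding K_def RP_upto_time_toggle[OF J zs_nth_chain[OF m''(1)] root[OF m'']]
      using False by (simp add: b_def)
    have "RP (upto_time J' s) = (if a < s then simple_refl p \<circ> RP (upto_time K s) else RP (upto_time K s))"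
      unfolding J'_eq RP_upto_time_toggle[OF K zs_nth_chain[OF kL] rootK] by (simp add: a_def)
    \<comment> \<open>After \<open>b\<close> the two factors s_p cancel.\<close>
    then show ?thesis
      using ab(1) simple_refl_invol[OF p] by (simp add: K_step)
  qed
  have "path_of R lam J' = (\<lambda>t\<in>{0..1}. integral {0..t}
    (\<lambda>s. if a < s \<and> s \<le> b then simple_refl p (- RP (upto_time J s) lam) else - RP (upto_time J s) lam))"
    unfolding path_of_def
  proof (rule restrict_ext)
    fix t :: real assume t: "t \<in> {0..1}"
    have "(if a < s \<and> s \<le> b then simple_refl p (- RP (upto_time J s) lam) else - RP (upto_time J s) lam)
        = step_fun R lam J' s" if "s \<in> {0..t} - {0}" for s
      using that t step_fun_eq[OF J', of s] step[of s lam] by (simp add: linear_neg[OF linear_reflection])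
    then show "integral {0..t} (step_fun R lam J') = integral {0..t}
      (\<lambda>s. if a < s \<and> s \<le> b then simple_refl p (- RP (upto_time J s) lam) else - RP (upto_time J s) lam)"
      by (rule integral_spike[OF negligible_sing[of 0]])
  qed
  with E_op_eq[OF True a(1) ab rise_a rise_b low up] F show ?thesis
    by simp
qed

end

theorem theorem9p4:
  fixes R :: "('v::euclidean_space) root_data" and lam rho :: 'v and p :: nat
    and J :: "('v \<times> int) set"
  assumes "kac_moody_root_data R"
    and "is_rho R rho"
    and "lam \<in> weight_lattice R" and "dominant R lam"
    and "p \<in> {1..nsimple R}"
    and "admissible R lam J"
  shows "E_op R p (path_of R lam J) = map_option (path_of R lam) (F_op R lam rho p J)"
proof -
  interpret km_data R
    by unfold_locales (rule assms)
  interpret km_walk R lam p J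
    by unfold_locales (use assms in \<open>simp_all add: idx_def\<close>)
  show ?thesis
    by (rule root_operators_agree)
qed

end
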